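(* Let $R$ be a right perfect ring and let $M$ be an automorphism-coinvariant right $R$-module with a projective cover $\pi:P\to M$ such that $M$ is not quasi-projective. Assume that $M$ is indecomposable with finite dual Goldie dimension. Then: (1) $\mathrm{End}(M)/J(\mathrm{End}(M))\cong\mathbb F_2$. (2) There exist an $n\ge 2$ and a set $\{P_i\}_{i=1}^n$ of (pairwise) non-isomorphic indecomposable projective modules such that $P=\bigoplus_{i=1}^n P_i$ and $\mathrm{End}_R(P_i)/J(\mathrm{End}_R(P_i))\cong\mathbb F_2$ for every $i=1,\ldots,n$.
   Context: Rings are associative with identity, modules are unitary right modules, $J(\cdot)$ is the Jacobson radical, and $\mathbb F_2$ is the field with two elements. A module $M$ with projective cover $\pi:P\to M$ is automorphism-coinvariant (respectively quasi-projective) if for every automorphism (respectively endomorphism) $g$ of $P$ there is an endomorphism $f$ of $M$ with $\pi\circ g=f\circ\pi$. *)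

theory Defs
  imports "HOL-Algebra.QuotRing" "HOL-Number_Theory.Residues"
begin

section \<open>Right modules over a ring\<close>

text \<open>
  The library's modules live over commutative rings. As there, the record extends
  \<^typ>\<open>'m ring\<close> only in order to inherit the notation for the additive group;
  the fields \<^const>\<open>monoid.mult\<close> and \<^const>\<open>one\<close> of a module are never used.
\<close>

record ('r, 'm) rmod = "'m ring" +
  ract :: "['m, 'r] \<Rightarrow> 'm" (infixl \<open>\<cdot>\<index>\<close> 70)

locale right_module = R?: ring R + M?: abelian_group M
  for R :: "('r, 'k) ring_scheme" (structure) and M :: "('r, 'm) rmod" (structure) +
  assumes ract_closed [simp, intro]:
      "\<lbrakk>x \<in> carrier M; r \<in> carrier R\<rbrakk> \<Longrightarrow> x \<cdot>\<^bsub>M\<^esub> r \<in> carrier M"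
    and ract_add_left:
      "\<lbrakk>x \<in> carrier M; y \<in> carrier M; r \<in> carrier R\<rbrakk> \<Longrightarrow>
        (x \<oplus>\<^bsub>M\<^esub> y) \<cdot>\<^bsub>M\<^esub> r = x \<cdot>\<^bsub>M\<^esub> r \<oplus>\<^bsub>M\<^esub> y \<cdot>\<^bsub>M\<^esub> r"
    and ract_add_right:
      "\<lbrakk>x \<in> carrier M; r \<in> carrier R; s \<in> carrier R\<rbrakk> \<Longrightarrow>
        x \<cdot>\<^bsub>M\<^esub> (r \<oplus>\<^bsub>R\<^esub> s) = x \<cdot>\<^bsub>M\<^esub> r \<oplus>\<^bsub>M\<^esub> x \<cdot>\<^bsub>M\<^esub> s"
    and ract_mult:
      "\<lbrakk>x \<in> carrier M; r \<in> carrier R; s \<in> carrier R\<rbrakk> \<Longrightarrow>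
        x \<cdot>\<^bsub>M\<^esub> (r \<otimes>\<^bsub>R\<^esub> s) = (x \<cdot>\<^bsub>M\<^esub> r) \<cdot>\<^bsub>M\<^esub> s"
    and ract_one [simp]: "x \<in> carrier M \<Longrightarrow> x \<cdot>\<^bsub>M\<^esub> \<one>\<^bsub>R\<^esub> = x"

definition rmod_hom ::
    "[('r, 'k) ring_scheme, ('r, 'm) rmod, ('r, 'n) rmod] \<Rightarrow> ('m \<Rightarrow> 'n) set" where
  "rmod_hom R M N = {f \<in> carrier M \<rightarrow> carrier N.
     (\<forall>x\<in>carrier M. \<forall>y\<in>carrier M. f (x \<oplus>\<^bsub>M\<^esub> y) = f x \<oplus>\<^bsub>N\<^esub> f y) \<and>
     (\<forall>x\<in>carrier M. \<forall>r\<in>carrier R. f (x \<cdot>\<^bsub>M\<^esub> r) = f x \<cdot>\<^bsub>N\<^esub> r)}"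

definition rmod_iso ::
    "[('r, 'k) ring_scheme, ('r, 'm) rmod, ('r, 'n) rmod] \<Rightarrow> ('m \<Rightarrow> 'n) set" where
  "rmod_iso R M N = {f \<in> rmod_hom R M N. bij_betw f (carrier M) (carrier N)}"

definition rsubmodule :: "['m set, ('r, 'k) ring_scheme, ('r, 'm) rmod] \<Rightarrow> bool" where
  "rsubmodule N R M \<longleftrightarrow> additive_subgroup N M \<and>
     (\<forall>x\<in>N. \<forall>r\<in>carrier R. x \<cdot>\<^bsub>M\<^esub> r \<in> N)"

text \<open>The right module \<open>R\<^sub>R\<close>; its submodules are the right ideals of \<open>R\<close>.\<close>

definition regular_rmod :: "('r, 'k) ring_scheme \<Rightarrow> ('r, 'r) rmod" where
  "regular_rmod R = \<lparr>carrier = carrier R, monoid.mult = monoid.mult R, one = \<one>\<^bsub>R\<^esub>,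
     zero = \<zero>\<^bsub>R\<^esub>, add = add R, ract = monoid.mult R\<rparr>"

text \<open>
  The endomorphism ring, acting on the left of the right module \<open>M\<close>. Endomorphisms are
  represented by extensional functions, so that equality in the ring is equality on \<open>M\<close>.
\<close>

definition End_ring :: "[('r, 'k) ring_scheme, ('r, 'm) rmod] \<Rightarrow> ('m \<Rightarrow> 'm) ring" where
  "End_ring R M = \<lparr>carrier = rmod_hom R M M \<inter> extensional (carrier M),
     monoid.mult = compose (carrier M),
     one = (\<lambda>x\<in>carrier M. x),
     zero = (\<lambda>x\<in>carrier M. \<zero>\<^bsub>M\<^esub>),
     add = (\<lambda>f g. \<lambda>x\<in>carrier M. f x \<oplus>\<^bsub>M\<^esub> g x)\<rparr>"

definition indecomposable :: "[('r, 'k) ring_scheme, ('r, 'm) rmod] \<Rightarrow> bool" where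
  "indecomposable R M \<longleftrightarrow> carrier M \<noteq> {\<zero>\<^bsub>M\<^esub>} \<and>
     (\<forall>A B. rsubmodule A R M \<and> rsubmodule B R M \<and>
        A <+>\<^bsub>M\<^esub> B = carrier M \<and> A \<inter> B = {\<zero>\<^bsub>M\<^esub>} \<longrightarrow>
        A = {\<zero>\<^bsub>M\<^esub>} \<or> B = {\<zero>\<^bsub>M\<^esub>})"

definition internal_direct_sum ::
    "[('r, 'k) ring_scheme, ('r, 'm) rmod, 'i set, 'i \<Rightarrow> 'm set] \<Rightarrow> bool" where
  \<comment> \<open>only meant for finite index sets\<close>
  "internal_direct_sum R M I N \<longleftrightarrow> finite I \<and> (\<forall>i\<in>I. rsubmodule (N i) R M) \<and>
     (\<forall>x\<in>carrier M. \<exists>!f. f \<in> (\<Pi>\<^sub>E i\<in>I. N i) \<and> x = (\<Oplus>\<^bsub>M\<^esub>i\<in>I. f i))"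

text \<open>
  A module has finite dual Goldie dimension (finite hollow dimension) iff it has no infinite
  coindependent family of proper submodules. The members of such a family are automatically
  distinct, so families are given as sets. An empty intersection is the whole module.
\<close>

definition coindependent ::
    "[('r, 'k) ring_scheme, ('r, 'm) rmod, 'm set set] \<Rightarrow> bool" where
  "coindependent R M \<N> \<longleftrightarrow> (\<forall>N\<in>\<N>. rsubmodule N R M \<and> N \<noteq> carrier M) \<and>
     (\<forall>N\<in>\<N>. \<forall>\<F>. finite \<F> \<and> \<F> \<subseteq> \<N> - {N} \<longrightarrow>
        N <+>\<^bsub>M\<^esub> (carrier M \<inter> \<Inter>\<F>) = carrier M)"

definition finite_dual_goldie_dim :: "[('r, 'k) ring_scheme, ('r, 'm) rmod] \<Rightarrow> bool" where
  "finite_dual_goldie_dim R M \<longleftrightarrow> \<not> (\<exists>\<N>. infinite \<N> \<and> coindependent R M \<N>)"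


section \<open>Jacobson radical and right perfect rings\<close>

definition maximal_rsubmodule :: "['m set, ('r, 'k) ring_scheme, ('r, 'm) rmod] \<Rightarrow> bool" where
  "maximal_rsubmodule N R M \<longleftrightarrow> rsubmodule N R M \<and> N \<noteq> carrier M \<and>
     (\<forall>L. rsubmodule L R M \<and> N \<subseteq> L \<longrightarrow> L = N \<or> L = carrier M)"

definition jacobson :: "('r, 'k) ring_scheme \<Rightarrow> 'r set" where
  "jacobson R = carrier R \<inter> \<Inter>{I. maximal_rsubmodule I R (regular_rmod R)}"

definition semisimple_rmod :: "[('r, 'k) ring_scheme, ('r, 'm) rmod] \<Rightarrow> bool" where
  "semisimple_rmod R M \<longleftrightarrow> (\<forall>A. rsubmodule A R M \<longrightarrow>
     (\<exists>B. rsubmodule B R M \<and> A <+>\<^bsub>M\<^esub> B = carrier M \<and> A \<inter> B = {\<zero>\<^bsub>M\<^esub>}))"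

definition semisimple_ring :: "('r, 'k) ring_scheme \<Rightarrow> bool" where
  "semisimple_ring R \<longleftrightarrow> semisimple_rmod R (regular_rmod R)"

text \<open>\<open>rev_prod R a n\<close> is the product \<open>a\<^sub>n\<^sub>-\<^sub>1 \<cdots> a\<^sub>1 a\<^sub>0\<close>, later factors standing on the left.\<close>

primrec rev_prod :: "('r, 'k) ring_scheme \<Rightarrow> (nat \<Rightarrow> 'r) \<Rightarrow> nat \<Rightarrow> 'r" where
  "rev_prod R a 0 = \<one>\<^bsub>R\<^esub>"
| "rev_prod R a (Suc n) = a n \<otimes>\<^bsub>R\<^esub> rev_prod R a n"

definition right_T_nilpotent :: "('r, 'k) ring_scheme \<Rightarrow> 'r set \<Rightarrow> bool" where
  "right_T_nilpotent R A \<longleftrightarrow> (\<forall>a. (\<forall>i. a i \<in> A) \<longrightarrow> (\<exists>n. rev_prod R a n = \<zero>\<^bsub>R\<^esub>))"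

text \<open>
  Right perfect rings as in Lam, \<^emph>\<open>A First Course in Noncommutative Rings\<close>, (23.18). This is the
  side convention for which every right \<open>R\<close>-module has a projective cover (equivalently, \<open>R\<close> has
  the descending chain condition on principal left ideals).
\<close>

definition right_perfect :: "('r, 'k) ring_scheme \<Rightarrow> bool" where
  "right_perfect R \<longleftrightarrow> ring R \<and>
     semisimple_ring (R Quot jacobson R) \<and> right_T_nilpotent R (jacobson R)"


section \<open>Projective modules and projective covers\<close>

text \<open>
  A definition cannot quantify over modules of all types. It is enough to test the lifting
  property on modules over the types \<^typ>\<open>'p \<Rightarrow> 'r\<close> (which has room for the free module on
  the set \<open>P\<close>) and \<^typ>\<open>'p\<close>: lemma \<open>projective_lift\<close> below recovers the lifting property
  for modules of arbitrary types.
\<close>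

definition projective :: "[('r, 'k) ring_scheme, ('r, 'p) rmod] \<Rightarrow> bool" where
  "projective R P \<longleftrightarrow> right_module R P \<and>
     (\<forall>(A :: ('r, 'p \<Rightarrow> 'r) rmod) (B :: ('r, 'p) rmod) g h.
        right_module R A \<and> right_module R B \<and>
        g \<in> rmod_hom R A B \<and> g ` carrier A = carrier B \<and> h \<in> rmod_hom R P B \<longrightarrow>
        (\<exists>l \<in> rmod_hom R P A. \<forall>x\<in>carrier P. g (l x) = h x))"

definition superfluous :: "['m set, ('r, 'k) ring_scheme, ('r, 'm) rmod] \<Rightarrow> bool" where
  "superfluous K R M \<longleftrightarrow> rsubmodule K R M \<and>
     (\<forall>N. rsubmodule N R M \<and> K <+>\<^bsub>M\<^esub> N = carrier M \<longrightarrow> N = carrier M)"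

definition projective_cover ::
    "[('r, 'k) ring_scheme, ('r, 'p) rmod, 'p \<Rightarrow> 'm, ('r, 'm) rmod] \<Rightarrow> bool" where
  "projective_cover R P \<pi> M \<longleftrightarrow> right_module R M \<and> projective R P \<and>
     \<pi> \<in> rmod_hom R P M \<and> \<pi> ` carrier P = carrier M \<and>
     superfluous {x \<in> carrier P. \<pi> x = \<zero>\<^bsub>M\<^esub>} R P"

text \<open>The next two notions are meant for a projective cover \<open>\<pi>\<close> of \<open>M\<close> by \<open>P\<close>.\<close>

definition automorphism_coinvariant ::
    "[('r, 'k) ring_scheme, ('r, 'p) rmod, 'p \<Rightarrow> 'm, ('r, 'm) rmod] \<Rightarrow> bool" where
  "automorphism_coinvariant R P \<pi> M \<longleftrightarrow>
     (\<forall>g \<in> rmod_iso R P P. \<exists>f \<in> rmod_hom R M M. \<forall>x\<in>carrier P. \<pi> (g x) = f (\<pi> x))"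

definition quasi_projective ::
    "[('r, 'k) ring_scheme, ('r, 'p) rmod, 'p \<Rightarrow> 'm, ('r, 'm) rmod] \<Rightarrow> bool" where
  "quasi_projective R P \<pi> M \<longleftrightarrow>
     (\<forall>g \<in> rmod_hom R P P. \<exists>f \<in> rmod_hom R M M. \<forall>x\<in>carrier P. \<pi> (g x) = f (\<pi> x))"

lemma rmod_homD:
  assumes "f \<in> rmod_hom R M N"
  shows "x \<in> carrier M \<Longrightarrow> f x \<in> carrier N"
    and "x \<in> carrier M \<Longrightarrow> y \<in> carrier M \<Longrightarrow> f (x \<oplus>\<^bsub>M\<^esub> y) = f x \<oplus>\<^bsub>N\<^esub> f y"
    and "x \<in> carrier M \<Longrightarrow> r \<in> carrier R \<Longrightarrow> f (x \<cdot>\<^bsub>M\<^esub> r) = f x \<cdot>\<^bsub>N\<^esub> r"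
  using assms by (auto simp: rmod_hom_def)

lemma rmod_homI:
  assumes "\<And>x. x \<in> carrier M \<Longrightarrow> f x \<in> carrier N"
    and "\<And>x y. x \<in> carrier M \<Longrightarrow> y \<in> carrier M \<Longrightarrow> f (x \<oplus>\<^bsub>M\<^esub> y) = f x \<oplus>\<^bsub>N\<^esub> f y"
    and "\<And>x r. x \<in> carrier M \<Longrightarrow> r \<in> carrier R \<Longrightarrow> f (x \<cdot>\<^bsub>M\<^esub> r) = f x \<cdot>\<^bsub>N\<^esub> r"
  shows "f \<in> rmod_hom R M N"
  using assms by (auto simp: rmod_hom_def)

lemma (in right_module) zero_ract [simp]:
  assumes "r \<in> carrier R" shows "\<zero>\<^bsub>M\<^esub> \<cdot>\<^bsub>M\<^esub> r = \<zero>\<^bsub>M\<^esub>"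
proof -
  have "\<zero>\<^bsub>M\<^esub> \<cdot>\<^bsub>M\<^esub> r \<oplus>\<^bsub>M\<^esub> \<zero>\<^bsub>M\<^esub> \<cdot>\<^bsub>M\<^esub> r = \<zero>\<^bsub>M\<^esub> \<cdot>\<^bsub>M\<^esub> r \<oplus>\<^bsub>M\<^esub> \<zero>\<^bsub>M\<^esub>"
    using assms ract_add_left[of "\<zero>\<^bsub>M\<^esub>" "\<zero>\<^bsub>M\<^esub>" r] by simp
  then show ?thesis using assms by (metis M.add.l_cancel_one M.zero_closed ract_closed M.r_zero)
qed

lemma (in right_module) ract_zero [simp]:
  assumes "x \<in> carrier M" shows "x \<cdot>\<^bsub>M\<^esub> \<zero>\<^bsub>R\<^esub> = \<zero>\<^bsub>M\<^esub>"
proof -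
  have "x \<cdot>\<^bsub>M\<^esub> \<zero>\<^bsub>R\<^esub> \<oplus>\<^bsub>M\<^esub> x \<cdot>\<^bsub>M\<^esub> \<zero>\<^bsub>R\<^esub> = x \<cdot>\<^bsub>M\<^esub> \<zero>\<^bsub>R\<^esub> \<oplus>\<^bsub>M\<^esub> \<zero>\<^bsub>M\<^esub>"
    using assms ract_add_right[of x "\<zero>\<^bsub>R\<^esub>" "\<zero>\<^bsub>R\<^esub>"] by simp
  then show ?thesis using assms by (metis M.add.l_cancel_one M.zero_closed R.zero_closed ract_closed M.r_zero)
qed

lemma (in right_module) finsum_ract:
  assumes "finite S" "f \<in> S \<rightarrow> carrier M" "r \<in> carrier R"
  shows "(\<Oplus>\<^bsub>M\<^esub>i\<in>S. f i) \<cdot>\<^bsub>M\<^esub> r = (\<Oplus>\<^bsub>M\<^esub>i\<in>S. f i \<cdot>\<^bsub>M\<^esub> r)"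
  using assms
proof (induction S rule: finite_induct)
  case (insert i S)
  have "(\<lambda>i. f i \<cdot>\<^bsub>M\<^esub> r) \<in> S \<rightarrow> carrier M" using insert by auto
  then show ?case
    using insert by (simp add: ract_add_left M.finsum_closed)
qed simp

lemma rmod_hom_zero:
  assumes "right_module R M" "right_module R N" "f \<in> rmod_hom R M N"
  shows "f \<zero>\<^bsub>M\<^esub> = \<zero>\<^bsub>N\<^esub>"
proof -
  interpret M: right_module R M by fact
  interpret N: right_module R N by fact
  have "f \<zero>\<^bsub>M\<^esub> = f (\<zero>\<^bsub>M\<^esub> \<cdot>\<^bsub>M\<^esub> \<zero>\<^bsub>R\<^esub>)" by simp
  also have "\<dots> = f \<zero>\<^bsub>M\<^esub> \<cdot>\<^bsub>N\<^esub> \<zero>\<^bsub>R\<^esub>" by (rule rmod_homD(3)[OF assms(3)]) auto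
  finally show ?thesis using rmod_homD(1)[OF assms(3) M.M.zero_closed] by simp
qed

lemma rmod_hom_finsum:
  assumes "right_module R M" "right_module R N" "f \<in> rmod_hom R M N"
    and "finite S" "a \<in> S \<rightarrow> carrier M"
  shows "f (\<Oplus>\<^bsub>M\<^esub>i\<in>S. a i) = (\<Oplus>\<^bsub>N\<^esub>i\<in>S. f (a i))"
proof -
  interpret M: right_module R M by fact
  interpret N: right_module R N by fact
  show ?thesis using assms(4,5)
  proof (induction S rule: finite_induct)
    case empty
    then show ?case using rmod_hom_zero[OF assms(1-3)] by simp
  next
    case (insert i S)
    have "(\<lambda>i. f (a i)) \<in> S \<rightarrow> carrier N" using insert rmod_homD(1)[OF assms(3)] by auto
    then show ?case
      using insert rmod_homD(1,2)[OF assms(3)] by (simp add: M.M.finsum_closed)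
  qed
qed

text \<open>The free right module on a set.\<close>

definition free_rmod :: "[('r, 'k) ring_scheme, 'x set] \<Rightarrow> ('r, 'x \<Rightarrow> 'r) rmod" where
  "free_rmod R X = \<lparr>
     carrier = {f. (\<forall>x. f x \<in> carrier R) \<and> (\<forall>x. x \<notin> X \<longrightarrow> f x = \<zero>\<^bsub>R\<^esub>) \<and>
       finite {x. f x \<noteq> \<zero>\<^bsub>R\<^esub>}},
     monoid.mult = undefined, one = undefined,
     zero = (\<lambda>x. \<zero>\<^bsub>R\<^esub>), add = (\<lambda>f g x. f x \<oplus>\<^bsub>R\<^esub> g x), ract = (\<lambda>f r x. f x \<otimes>\<^bsub>R\<^esub> r)\<rparr>"

lemma free_rmod_module:
  assumes "ring R" shows "right_module R (free_rmod R X)"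
proof -
  interpret ring R by fact
  have fin_add: "finite {x. f x \<oplus>\<^bsub>R\<^esub> g x \<noteq> \<zero>\<^bsub>R\<^esub>}"
    if "finite {x. f x \<noteq> \<zero>\<^bsub>R\<^esub>}" "finite {x. g x \<noteq> \<zero>\<^bsub>R\<^esub>}" for f g :: "_ \<Rightarrow> _"
    by (rule finite_subset[OF _ finite_UnI[OF that]]) auto
  have fin_mul: "finite {x. f x \<otimes>\<^bsub>R\<^esub> r \<noteq> \<zero>\<^bsub>R\<^esub>}"
    if "finite {x. f x \<noteq> \<zero>\<^bsub>R\<^esub>}" "r \<in> carrier R" for f :: "_ \<Rightarrow> _" and r
    by (rule finite_subset[OF _ that(1)]) (use that in auto)
  have fin_neg: "finite {x. \<ominus>\<^bsub>R\<^esub> f x \<noteq> \<zero>\<^bsub>R\<^esub>}"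
    if "finite {x. f x \<noteq> \<zero>\<^bsub>R\<^esub>}" for f :: "_ \<Rightarrow> _"
    by (rule finite_subset[OF _ that(1)]) auto
  have ag: "abelian_group (free_rmod R X)"
  proof (rule abelian_groupI, goal_cases)
    case (6 f)
    then show ?case
      by (intro bexI[of _ "\<lambda>x. \<ominus>\<^bsub>R\<^esub> f x"]) (auto simp: free_rmod_def fin_neg l_neg)
  qed (auto simp: free_rmod_def fin_add a_ac)
  show ?thesis
    by (intro right_module.intro right_module_axioms.intro ag assms)
      (auto simp: free_rmod_def fin_mul l_distr r_distr m_assoc)
qed

text \<open>The homomorphism from the free module on \<open>X\<close> that sends the basis element \<open>x\<close> to \<open>a x\<close>.\<close>

definition free_eval ::
    "[('r, 'k) ring_scheme, ('r, 'm) rmod, 'x \<Rightarrow> 'm, 'x \<Rightarrow> 'r] \<Rightarrow> 'm" where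
  "free_eval R M a f = (\<Oplus>\<^bsub>M\<^esub>x\<in>{x. f x \<noteq> \<zero>\<^bsub>R\<^esub>}. a x \<cdot>\<^bsub>M\<^esub> f x)"

lemma free_eval_superset:
  assumes "right_module R M" "a \<in> X \<rightarrow> carrier M" "f \<in> carrier (free_rmod R X)"
    and "finite S" "S \<subseteq> X" "{x. f x \<noteq> \<zero>\<^bsub>R\<^esub>} \<subseteq> S"
  shows "free_eval R M a f = (\<Oplus>\<^bsub>M\<^esub>x\<in>S. a x \<cdot>\<^bsub>M\<^esub> f x)"
proof -
  interpret right_module R M by fact
  have "a x \<in> carrier M" "f x \<in> carrier R" if "x \<in> S" for x
    using that assms(2,3,5) by (auto simp: free_rmod_def)
  then show ?thesis
    unfolding free_eval_def using assms(4,6)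
    by (intro M.add.finprod_mono_neutral_cong_left) auto
qed

lemma free_eval_hom:
  assumes "right_module R M" "a \<in> X \<rightarrow> carrier M"
  shows "free_eval R M a \<in> rmod_hom R (free_rmod R X) M"
proof -
  interpret right_module R M by fact
  interpret F: right_module R "free_rmod R X" by (rule free_rmod_module) (rule R.ring_axioms)
  have supp: "finite {x. f x \<noteq> \<zero>\<^bsub>R\<^esub>}" "{x. f x \<noteq> \<zero>\<^bsub>R\<^esub>} \<subseteq> X" "\<And>x. f x \<in> carrier R"
    if "f \<in> carrier (free_rmod R X)" for f using that by (auto simp: free_rmod_def)
  have a: "a x \<in> carrier M" if "x \<in> X" for x using assms(2) that by auto
  show ?thesis
  proof (rule rmod_homI)
    fix f assume f: "f \<in> carrier (free_rmod R X)"
    show "free_eval R M a f \<in> carrier M"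
      unfolding free_eval_def using supp[OF f] a by (intro M.finsum_closed) auto
  next
    fix f g assume f: "f \<in> carrier (free_rmod R X)" and g: "g \<in> carrier (free_rmod R X)"
    let ?S = "{x. f x \<noteq> \<zero>\<^bsub>R\<^esub>} \<union> {x. g x \<noteq> \<zero>\<^bsub>R\<^esub>}"
    have S: "finite ?S" "?S \<subseteq> X" using supp[OF f] supp[OF g] by auto
    have fg: "f \<oplus>\<^bsub>free_rmod R X\<^esub> g \<in> carrier (free_rmod R X)" using f g by simp
    have eq: "(f \<oplus>\<^bsub>free_rmod R X\<^esub> g) x = f x \<oplus>\<^bsub>R\<^esub> g x" for x by (simp add: free_rmod_def)
    have "free_eval R M a (f \<oplus>\<^bsub>free_rmod R X\<^esub> g)
        = (\<Oplus>\<^bsub>M\<^esub>x\<in>?S. a x \<cdot>\<^bsub>M\<^esub> (f \<oplus>\<^bsub>free_rmod R X\<^esub> g) x)"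
      by (rule free_eval_superset[OF assms fg S]) (auto simp: eq)
    also have "\<dots> = (\<Oplus>\<^bsub>M\<^esub>x\<in>?S. a x \<cdot>\<^bsub>M\<^esub> f x \<oplus>\<^bsub>M\<^esub> a x \<cdot>\<^bsub>M\<^esub> g x)"
      using S(2) a supp(3)[OF f] supp(3)[OF g]
      by (intro M.finsum_cong') (auto simp: eq ract_add_right)
    also have "\<dots> = (\<Oplus>\<^bsub>M\<^esub>x\<in>?S. a x \<cdot>\<^bsub>M\<^esub> f x) \<oplus>\<^bsub>M\<^esub> (\<Oplus>\<^bsub>M\<^esub>x\<in>?S. a x \<cdot>\<^bsub>M\<^esub> g x)"
      using S(2) a supp(3)[OF f] supp(3)[OF g] by (intro M.finsum_addf) auto
    also have "\<dots> = free_eval R M a f \<oplus>\<^bsub>M\<^esub> free_eval R M a g"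
      using free_eval_superset[OF assms f S] free_eval_superset[OF assms g S] by simp
    finally show "free_eval R M a (f \<oplus>\<^bsub>free_rmod R X\<^esub> g)
        = free_eval R M a f \<oplus>\<^bsub>M\<^esub> free_eval R M a g" .
  next
    fix f r assume f: "f \<in> carrier (free_rmod R X)" and r: "r \<in> carrier R"
    let ?S = "{x. f x \<noteq> \<zero>\<^bsub>R\<^esub>}"
    have S: "finite ?S" "?S \<subseteq> X" using supp[OF f] by auto
    have fr: "f \<cdot>\<^bsub>free_rmod R X\<^esub> r \<in> carrier (free_rmod R X)" using f r by simp
    have eq: "(f \<cdot>\<^bsub>free_rmod R X\<^esub> r) x = f x \<otimes>\<^bsub>R\<^esub> r" for x by (simp add: free_rmod_def)
    have "free_eval R M a (f \<cdot>\<^bsub>free_rmod R X\<^esub> r)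
        = (\<Oplus>\<^bsub>M\<^esub>x\<in>?S. a x \<cdot>\<^bsub>M\<^esub> (f \<cdot>\<^bsub>free_rmod R X\<^esub> r) x)"
      by (rule free_eval_superset[OF assms fr S]) (use r in \<open>auto simp: eq\<close>)
    also have "\<dots> = (\<Oplus>\<^bsub>M\<^esub>x\<in>?S. (a x \<cdot>\<^bsub>M\<^esub> f x) \<cdot>\<^bsub>M\<^esub> r)"
      using S(2) a supp(3)[OF f] r by (intro M.finsum_cong') (auto simp: eq ract_mult)
    also have "\<dots> = free_eval R M a f \<cdot>\<^bsub>M\<^esub> r"
      unfolding free_eval_def using S a supp(3)[OF f] r by (intro finsum_ract[symmetric]) auto
    finally show "free_eval R M a (f \<cdot>\<^bsub>free_rmod R X\<^esub> r) = free_eval R M a f \<cdot>\<^bsub>M\<^esub> r" .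
  qed
qed

lemma free_eval_comp:
  assumes "right_module R A" "right_module R B" "g \<in> rmod_hom R A B"
    and "a \<in> X \<rightarrow> carrier A" "\<And>x. x \<in> X \<Longrightarrow> g (a x) = b x" "f \<in> carrier (free_rmod R X)"
  shows "g (free_eval R A a f) = free_eval R B b f"
proof -
  interpret A: right_module R A by fact
  interpret B: right_module R B by fact
  let ?S = "{x. f x \<noteq> \<zero>\<^bsub>R\<^esub>}"
  have S: "finite ?S" "?S \<subseteq> X" "\<And>x. f x \<in> carrier R" using assms(6) by (auto simp: free_rmod_def)
  have a: "a x \<in> carrier A" if "x \<in> X" for x using assms(4) that by auto
  have "g (free_eval R A a f) = (\<Oplus>\<^bsub>B\<^esub>x\<in>?S. g (a x \<cdot>\<^bsub>A\<^esub> f x))"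
    unfolding free_eval_def
    by (rule rmod_hom_finsum[OF assms(1-3) S(1)]) (use S a in auto)
  also have "\<dots> = free_eval R B b f"
    unfolding free_eval_def
  proof (rule B.M.finsum_cong'[OF refl])
    show "g (a x \<cdot>\<^bsub>A\<^esub> f x) = b x \<cdot>\<^bsub>B\<^esub> f x" if "x \<in> ?S" for x
      using rmod_homD(3)[OF assms(3)] S a assms(5) that by auto
    have "b x \<in> carrier B" if "x \<in> X" for x
      using rmod_homD(1)[OF assms(3) a[OF that]] assms(5)[OF that] by simp
    then show "(\<lambda>x. b x \<cdot>\<^bsub>B\<^esub> f x) \<in> ?S \<rightarrow> carrier B"
      using S(2,3) by auto
  qed
  finally show ?thesis .
qed

lemma projective_lift:
  fixes P :: "('r, 'p) rmod" and A :: "('r, 'a) rmod" and B :: "('r, 'b) rmod"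
  assumes P: "projective R P" and A: "right_module R A" and B: "right_module R B"
    and g: "g \<in> rmod_hom R A B" "g ` carrier A = carrier B" and h: "h \<in> rmod_hom R P B"
  shows "\<exists>l \<in> rmod_hom R P A. \<forall>x\<in>carrier P. g (l x) = h x"
proof -
  let ?F = "free_rmod R (carrier P)" and ?e = "free_eval R P (\<lambda>x. x)"
  interpret P: right_module R P using P by (simp add: projective_def)
  interpret A: right_module R A by fact
  interpret B: right_module R B by fact
  have F: "right_module R ?F" by (rule free_rmod_module) (rule P.R.ring_axioms)
  interpret F: right_module R ?F by (rule F)
  have e: "?e \<in> rmod_hom R ?F P" by (rule free_eval_hom[OF P.right_module_axioms]) auto
  have "x \<in> ?e ` carrier ?F" if x: "x \<in> carrier P" for x
  proof (cases "\<one>\<^bsub>R\<^esub> = \<zero>\<^bsub>R\<^esub>")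
    case True
    then have "x = \<zero>\<^bsub>P\<^esub>" using P.ract_one[OF x] x by simp
    then show ?thesis
      using rmod_hom_zero[OF F P.right_module_axioms e] by (auto intro!: rev_image_eqI)
  next
    case False
    let ?d = "\<lambda>y. if y = x then \<one>\<^bsub>R\<^esub> else \<zero>\<^bsub>R\<^esub>"
    have supp: "{y. ?d y \<noteq> \<zero>\<^bsub>R\<^esub>} = {x}" using False by auto
    have "?e ?d = x"
      unfolding free_eval_def supp using x by (subst P.M.finsum_insert) auto
    moreover have "?d \<in> carrier ?F" using x supp by (auto simp: free_rmod_def)
    ultimately show ?thesis by (metis image_eqI)
  qed
  then have e_onto: "?e ` carrier ?F = carrier P" using rmod_homD(1)[OF e] by auto
  have id: "(\<lambda>x. x) \<in> rmod_hom R P P" by (simp add: rmod_hom_def)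
  have "\<exists>s \<in> rmod_hom R P ?F. \<forall>x\<in>carrier P. ?e (s x) = x"
    using P F P.right_module_axioms e e_onto id unfolding projective_def by blast
  then obtain s where s: "s \<in> rmod_hom R P ?F" "\<And>x. x \<in> carrier P \<Longrightarrow> ?e (s x) = x"
    by blast
  have "\<forall>x\<in>carrier P. \<exists>y\<in>carrier A. g y = h x"
    using g(2) rmod_homD(1)[OF h] by (metis imageE)
  then obtain a where a: "\<And>x. x \<in> carrier P \<Longrightarrow> a x \<in> carrier A \<and> g (a x) = h x"
    by metis
  have ea: "free_eval R A a \<in> rmod_hom R ?F A" by (rule free_eval_hom[OF A]) (use a in auto)
  show ?thesis
  proof (intro bexI ballI)
    show "(\<lambda>x. free_eval R A a (s x)) \<in> rmod_hom R P A"
      by (intro rmod_homI) (simp_all add: rmod_homD[OF ea] rmod_homD[OF s(1)])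
    fix x assume x: "x \<in> carrier P"
    have sx: "s x \<in> carrier ?F" using rmod_homD(1)[OF s(1) x] .
    have "g (free_eval R A a (s x)) = free_eval R B h (s x)"
      by (rule free_eval_comp[OF A B g(1) _ _ sx]) (use a in auto)
    also have "\<dots> = h (?e (s x))"
      by (rule free_eval_comp[OF P.right_module_axioms B h _ _ sx, symmetric]) auto
    finally show "g (free_eval R A a (s x)) = h x" using s(2)[OF x] by simp
  qed
qed

lemma regular_rmod_module:
  assumes "ring R" shows "right_module R (regular_rmod R)"
proof -
  interpret ring R by fact
  have "abelian_group (regular_rmod R)"
  proof (rule abelian_groupI, goal_cases)
    case (6 x)
    then show ?case by (intro bexI[of _ "\<ominus>\<^bsub>R\<^esub> x"]) (auto simp: regular_rmod_def l_neg)
  qed (auto simp: regular_rmod_def a_ac)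
  then show ?thesis
    by (intro right_module.intro right_module_axioms.intro assms)
      (auto simp: regular_rmod_def l_distr r_distr m_assoc)
qed

lemma End_ring_ring:
  assumes "right_module R M" shows "ring (End_ring R M)"
proof -
  interpret right_module R M by fact
  have zero: "(\<lambda>x\<in>carrier M. \<zero>\<^bsub>M\<^esub>) \<in> carrier (End_ring R M)"
    and one: "(\<lambda>x\<in>carrier M. x) \<in> carrier (End_ring R M)"
    by (auto simp: End_ring_def rmod_hom_def)
  have add: "(\<lambda>x\<in>carrier M. f x \<oplus>\<^bsub>M\<^esub> g x) \<in> carrier (End_ring R M)"
    and mul: "compose (carrier M) f g \<in> carrier (End_ring R M)"
    if "f \<in> carrier (End_ring R M)" "g \<in> carrier (End_ring R M)" for f g
    using that by (auto simp: End_ring_def rmod_hom_def compose_def ract_add_left M.a_ac Pi_iff)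
  have neg: "(\<lambda>x\<in>carrier M. \<ominus>\<^bsub>M\<^esub> f x) \<in> carrier (End_ring R M)"
    if f: "f \<in> carrier (End_ring R M)" for f
  proof -
    have "\<ominus>\<^bsub>M\<^esub> (y \<cdot>\<^bsub>M\<^esub> r) = (\<ominus>\<^bsub>M\<^esub> y) \<cdot>\<^bsub>M\<^esub> r" if "y \<in> carrier M" "r \<in> carrier R" for y r
    proof (rule M.minus_equality)
      show "(\<ominus>\<^bsub>M\<^esub> y) \<cdot>\<^bsub>M\<^esub> r \<oplus>\<^bsub>M\<^esub> y \<cdot>\<^bsub>M\<^esub> r = \<zero>\<^bsub>M\<^esub>"
        using that by (subst ract_add_left[symmetric]) (auto simp: M.l_neg)
    qed (use that in auto)
    then show ?thesis
      using f by (auto simp: End_ring_def rmod_hom_def Pi_iff M.minus_add)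
  qed
  show ?thesis
  proof (rule ringI)
    show "abelian_group (End_ring R M)"
    proof (rule abelian_groupI, goal_cases)
      case (6 f)
      then show ?case
        by (intro bexI[of _ "\<lambda>x\<in>carrier M. \<ominus>\<^bsub>M\<^esub> f x"] neg)
          (auto simp: End_ring_def rmod_hom_def Pi_iff fun_eq_iff M.l_neg)
    next
      case (1 f g) then show ?case using add by (simp add: End_ring_def)
    next
      case 2 then show ?case using zero by (simp add: End_ring_def)
    qed (auto simp: End_ring_def rmod_hom_def Pi_iff fun_eq_iff M.a_ac extensional_def)
    show "monoid (End_ring R M)"
    proof (rule monoidI, goal_cases)
      case (1 f g) then show ?case using mul by (simp add: End_ring_def)
    next
      case 2 then show ?case using one by (simp add: End_ring_def)
    qed (auto simp: End_ring_def rmod_hom_def Pi_iff fun_eq_iff compose_def extensional_def)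
  qed (auto simp: End_ring_def rmod_hom_def Pi_iff fun_eq_iff compose_def)
qed

end

theory Submission
  imports Defs
begin

text \<open>
  Let \<open>S\<close> be the endomorphism ring of \<open>P\<close>, \<open>L\<close> the ideal of endomorphisms with image in \<open>PJ(R)\<close>, and
  \<open>T\<close> the subring of endomorphisms preserving the kernel of \<open>\<pi>\<close>. By coinvariance \<open>T\<close> contains all
  units of \<open>S\<close>, hence \<open>L\<close> and all elements of square zero; it has only trivial idempotents because \<open>M\<close>
  is indecomposable, and \<open>T \<noteq> S\<close> because \<open>M\<close> is not quasi-projective.

  Finite dual Goldie dimension splits \<open>P\<close> into finitely many indecomposable summands \<open>P\<^sub>i\<close> with
  projections \<open>p\<^sub>i\<close>, and T-nilpotence of \<open>J(R)\<close> makes them local. A homomorphism between different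
  summands has square zero as an element of \<open>S\<close>, so an isomorphism \<open>P\<^sub>i \<cong> P\<^sub>j\<close> would exhibit the
  nontrivial idempotent \<open>p\<^sub>i\<close> as a product of elements of \<open>T\<close>. The same contradiction arises if some
  \<open>v\<close> and \<open>v - 1\<close> are both automorphisms of \<open>P\<^sub>i\<close>, so the residue ring of \<open>P\<^sub>i\<close> has two elements.
  Modulo \<open>L\<close>, every element of \<open>T\<close> is therefore a sum of distinct \<open>p\<^sub>i\<close>, which is an idempotent of \<open>T\<close>
  and so \<open>0\<close> or \<open>1\<close>; and every endomorphism of \<open>M\<close> lifts to an element of \<open>T\<close>.
\<close>

text \<open>\<open>P\<close> is not assumed finitely generated, so neither the usual Nakayama lemma
  nor the quasi-regularity of endomorphisms with image in \<open>PJ(R)\<close> comes for free. Both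
  are drawn from T-nilpotence by one descent argument on products of ring elements. Statements about
  \<open>P/PJ(R)\<close> are phrased as membership in \<open>times_jacobson\<close>, so that no
  quotient module has to be formed. The field with two elements appears because \<open>T\<close> is
  only known to contain the units of \<open>S\<close>. If a residue ring has an element other than 0
  and 1, then differences and products of units of \<open>S\<close> already produce the projection
  onto one summand, and this would split \<open>M\<close>. With two elements the only invertible
  residue is 1, and units cannot tell the summands apart. At least two summands are needed because
  with a single one \<open>S\<close> is local: everything outside \<open>L\<close> is a unit, and
  \<open>T\<close> would be all of \<open>S\<close>.\<close>

lemma (in abelian_group) minus_eq_zero_iff:
  assumes "x \<in> carrier G" "y \<in> carrier G"
  shows "x \<ominus> y = \<zero> \<longleftrightarrow> x = y"
proof
  assume "x \<ominus> y = \<zero>"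
  then have "\<ominus> (\<ominus> y) = x"
    using assms by (intro minus_equality) (simp_all add: a_minus_def)
  then show "x = y" using assms by simp
qed (use assms in \<open>simp add: a_minus_def r_neg\<close>)

section \<open>Submodules and homomorphisms of right modules\<close>

context right_module
begin

lemma ract_uminus:
  assumes "x \<in> carrier M" "r \<in> carrier R"
  shows "(\<ominus>\<^bsub>M\<^esub> x) \<cdot>\<^bsub>M\<^esub> r = \<ominus>\<^bsub>M\<^esub> (x \<cdot>\<^bsub>M\<^esub> r)"
    and "x \<cdot>\<^bsub>M\<^esub> (\<ominus>\<^bsub>R\<^esub> r) = \<ominus>\<^bsub>M\<^esub> (x \<cdot>\<^bsub>M\<^esub> r)"
proof -
  have "(\<ominus>\<^bsub>M\<^esub> x) \<cdot>\<^bsub>M\<^esub> r \<oplus>\<^bsub>M\<^esub> x \<cdot>\<^bsub>M\<^esub> r = \<zero>\<^bsub>M\<^esub>"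
    using assms by (subst ract_add_left[symmetric]) (auto simp: M.l_neg)
  then show "(\<ominus>\<^bsub>M\<^esub> x) \<cdot>\<^bsub>M\<^esub> r = \<ominus>\<^bsub>M\<^esub> (x \<cdot>\<^bsub>M\<^esub> r)"
    using assms by (metis M.minus_equality M.a_inv_closed ract_closed)
  have "x \<cdot>\<^bsub>M\<^esub> (\<ominus>\<^bsub>R\<^esub> r) \<oplus>\<^bsub>M\<^esub> x \<cdot>\<^bsub>M\<^esub> r = \<zero>\<^bsub>M\<^esub>"
    using assms by (subst ract_add_right[symmetric]) (auto simp: R.l_neg)
  then show "x \<cdot>\<^bsub>M\<^esub> (\<ominus>\<^bsub>R\<^esub> r) = \<ominus>\<^bsub>M\<^esub> (x \<cdot>\<^bsub>M\<^esub> r)"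
    using assms by (metis M.minus_equality R.a_inv_closed ract_closed)
qed

text \<open>Negatives come for free, since \<open>- x\<close> is the action of \<open>- 1\<close> on
  \<open>x\<close>. Later submodule proofs therefore check only zero, sums and the action.\<close>

lemma rsubmodule_iff:
  "rsubmodule N R M \<longleftrightarrow> N \<subseteq> carrier M \<and> \<zero>\<^bsub>M\<^esub> \<in> N \<and>
     (\<forall>x\<in>N. \<forall>y\<in>N. x \<oplus>\<^bsub>M\<^esub> y \<in> N) \<and> (\<forall>x\<in>N. \<forall>r\<in>carrier R. x \<cdot>\<^bsub>M\<^esub> r \<in> N)"
  (is "_ = ?rhs")
proof
  assume N: "rsubmodule N R M"
  then interpret N: additive_subgroup N M by (simp add: rsubmodule_def)
  show ?rhs using N N.a_subset N.zero_closed N.a_closed by (auto simp: rsubmodule_def)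
next
  assume N: ?rhs
  have "\<ominus>\<^bsub>M\<^esub> x \<in> N" if "x \<in> N" for x
  proof -
    have "x \<cdot>\<^bsub>M\<^esub> (\<ominus>\<^bsub>R\<^esub> \<one>\<^bsub>R\<^esub>) \<in> N" using N that by blast
    then show ?thesis using that N by (subst (asm) ract_uminus) auto
  qed
  then have "subgroup N (add_monoid M)"
    using N by (intro M.add.subgroupI) (auto simp: a_inv_def[symmetric])
  then show "rsubmodule N R M" using N by (auto simp: rsubmodule_def additive_subgroup_def)
qed

lemma rsubmoduleD:
  assumes "rsubmodule N R M"
  shows "x \<in> N \<Longrightarrow> x \<in> carrier M" "\<zero>\<^bsub>M\<^esub> \<in> N" "x \<in> N \<Longrightarrow> y \<in> N \<Longrightarrow> x \<oplus>\<^bsub>M\<^esub> y \<in> N"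
    "x \<in> N \<Longrightarrow> r \<in> carrier R \<Longrightarrow> x \<cdot>\<^bsub>M\<^esub> r \<in> N"
    "x \<in> N \<Longrightarrow> \<ominus>\<^bsub>M\<^esub> x \<in> N" "x \<in> N \<Longrightarrow> y \<in> N \<Longrightarrow> x \<ominus>\<^bsub>M\<^esub> y \<in> N"
proof -
  show 1: "x \<in> N \<Longrightarrow> \<ominus>\<^bsub>M\<^esub> x \<in> N" for x
    using assms by (auto simp: rsubmodule_def additive_subgroup.a_inv_closed M.abelian_group_axioms)
  show "x \<in> N \<Longrightarrow> y \<in> N \<Longrightarrow> x \<ominus>\<^bsub>M\<^esub> y \<in> N"
    using assms 1[of y] by (auto simp: rsubmodule_iff a_minus_def)
qed (use assms in \<open>auto simp: rsubmodule_iff\<close>)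

lemma rsubmodule_sum:
  assumes A: "rsubmodule A R M" and B: "rsubmodule B R M"
  shows "rsubmodule (A <+>\<^bsub>M\<^esub> B) R M"
  unfolding rsubmodule_iff
proof (intro conjI ballI)
  show "A <+>\<^bsub>M\<^esub> B \<subseteq> carrier M"
    using rsubmoduleD(1)[OF A] rsubmoduleD(1)[OF B] by (auto simp: set_add_def')
  show "\<zero>\<^bsub>M\<^esub> \<in> A <+>\<^bsub>M\<^esub> B"
    using rsubmoduleD(2)[OF A] rsubmoduleD(2)[OF B] by (force simp: set_add_def')
next
  fix x y assume "x \<in> A <+>\<^bsub>M\<^esub> B" "y \<in> A <+>\<^bsub>M\<^esub> B"
  then obtain a b c d where *: "a \<in> A" "b \<in> B" "c \<in> A" "d \<in> B"
    "x = a \<oplus>\<^bsub>M\<^esub> b" "y = c \<oplus>\<^bsub>M\<^esub> d" by (auto simp: set_add_def')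
  then have "x \<oplus>\<^bsub>M\<^esub> y = (a \<oplus>\<^bsub>M\<^esub> c) \<oplus>\<^bsub>M\<^esub> (b \<oplus>\<^bsub>M\<^esub> d)"
    using rsubmoduleD(1)[OF A] rsubmoduleD(1)[OF B] by (simp add: M.a_ac)
  then show "x \<oplus>\<^bsub>M\<^esub> y \<in> A <+>\<^bsub>M\<^esub> B"
    using rsubmoduleD(3)[OF A *(1,3)] rsubmoduleD(3)[OF B *(2,4)] by (auto simp: set_add_def')
next
  fix x r assume "x \<in> A <+>\<^bsub>M\<^esub> B" and r: "r \<in> carrier R"
  then obtain a b where *: "a \<in> A" "b \<in> B" "x = a \<oplus>\<^bsub>M\<^esub> b" by (auto simp: set_add_def')
  then have "x \<cdot>\<^bsub>M\<^esub> r = a \<cdot>\<^bsub>M\<^esub> r \<oplus>\<^bsub>M\<^esub> b \<cdot>\<^bsub>M\<^esub> r"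
    using rsubmoduleD(1)[OF A] rsubmoduleD(1)[OF B] r by (simp add: ract_add_left)
  then show "x \<cdot>\<^bsub>M\<^esub> r \<in> A <+>\<^bsub>M\<^esub> B"
    using rsubmoduleD(4)[OF A *(1) r] rsubmoduleD(4)[OF B *(2) r] by (auto simp: set_add_def')
qed

lemma rsubmodule_sum_upper:
  assumes A: "rsubmodule A R M" and B: "rsubmodule B R M"
  shows "A \<subseteq> A <+>\<^bsub>M\<^esub> B" "B \<subseteq> A <+>\<^bsub>M\<^esub> B"
proof -
  show "A \<subseteq> A <+>\<^bsub>M\<^esub> B"
  proof
    fix a assume "a \<in> A"
    then show "a \<in> A <+>\<^bsub>M\<^esub> B"
      using rsubmoduleD(1)[OF A] rsubmoduleD(2)[OF B] by (force simp: set_add_def')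
  qed
  show "B \<subseteq> A <+>\<^bsub>M\<^esub> B"
  proof
    fix b assume "b \<in> B"
    then show "b \<in> A <+>\<^bsub>M\<^esub> B"
      using rsubmoduleD(1)[OF B] rsubmoduleD(2)[OF A] by (force simp: set_add_def')
  qed
qed

lemma rsubmodule_cyclic:
  assumes "x \<in> carrier M"
  shows "rsubmodule {x \<cdot>\<^bsub>M\<^esub> r |r. r \<in> carrier R} R M"
  unfolding rsubmodule_iff
proof (intro conjI ballI)
  show "\<zero>\<^bsub>M\<^esub> \<in> {x \<cdot>\<^bsub>M\<^esub> r |r. r \<in> carrier R}"
    using assms ract_zero[OF assms] R.zero_closed by (metis (mono_tags, lifting) mem_Collect_eq)
next
  fix y z assume "y \<in> {x \<cdot>\<^bsub>M\<^esub> r |r. r \<in> carrier R}" "z \<in> {x \<cdot>\<^bsub>M\<^esub> r |r. r \<in> carrier R}"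
  then obtain r s where "r \<in> carrier R" "s \<in> carrier R" "y = x \<cdot>\<^bsub>M\<^esub> r" "z = x \<cdot>\<^bsub>M\<^esub> s" by blast
  then show "y \<oplus>\<^bsub>M\<^esub> z \<in> {x \<cdot>\<^bsub>M\<^esub> r |r. r \<in> carrier R}"
    using ract_add_right[OF assms, of r s] R.add.m_closed by (metis (mono_tags, lifting) mem_Collect_eq)
next
  fix y s assume "y \<in> {x \<cdot>\<^bsub>M\<^esub> r |r. r \<in> carrier R}" and s: "s \<in> carrier R"
  then obtain r where "r \<in> carrier R" "y = x \<cdot>\<^bsub>M\<^esub> r" by blast
  then show "y \<cdot>\<^bsub>M\<^esub> s \<in> {x \<cdot>\<^bsub>M\<^esub> r |r. r \<in> carrier R}"
    using ract_mult[OF assms, of r s] R.m_closed s by (metis (mono_tags, lifting) mem_Collect_eq)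
qed (use assms in auto)

lemma mem_cyclic:
  assumes "x \<in> carrier M"
  shows "x \<in> {x \<cdot>\<^bsub>M\<^esub> r |r. r \<in> carrier R}"
  using ract_one[OF assms] R.one_closed by (metis (mono_tags, lifting) mem_Collect_eq)

lemma rsubmodule_carrier: "rsubmodule (carrier M) R M"
  by (auto simp: rsubmodule_iff)

lemma right_module_rsubmodule:
  assumes N: "rsubmodule N R M"
  shows "right_module R (M\<lparr>carrier := N\<rparr>)"
proof -
  note D = rsubmoduleD[OF N]
  have "abelian_group (M\<lparr>carrier := N\<rparr>)"
  proof (rule abelian_groupI, goal_cases)
    case (6 x)
    then show ?case using D by (intro bexI[of _ "\<ominus>\<^bsub>M\<^esub> x"]) (auto simp: M.l_neg)
  qed (use D in \<open>auto simp: M.a_ac\<close>)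
  then show ?thesis
    by (intro right_module.intro right_module_axioms.intro R.ring_axioms)
      (use D in \<open>auto simp: ract_add_left ract_add_right ract_mult\<close>)
qed

end

lemma rmod_hom_uminus:
  assumes "right_module R M" "right_module R N" "f \<in> rmod_hom R M N"
  shows "x \<in> carrier M \<Longrightarrow> f (\<ominus>\<^bsub>M\<^esub> x) = \<ominus>\<^bsub>N\<^esub> f x"
    and "x \<in> carrier M \<Longrightarrow> y \<in> carrier M \<Longrightarrow> f (x \<ominus>\<^bsub>M\<^esub> y) = f x \<ominus>\<^bsub>N\<^esub> f y"
proof -
  interpret M: right_module R M by fact
  interpret N: right_module R N by fact
  note D = rmod_homD[OF assms(3)]
  show 1: "f (\<ominus>\<^bsub>M\<^esub> x) = \<ominus>\<^bsub>N\<^esub> f x" if x: "x \<in> carrier M" for x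
  proof -
    have "f (\<ominus>\<^bsub>M\<^esub> x) \<oplus>\<^bsub>N\<^esub> f x = f (\<ominus>\<^bsub>M\<^esub> x \<oplus>\<^bsub>M\<^esub> x)" using D x by simp
    also have "\<dots> = \<zero>\<^bsub>N\<^esub>" using x rmod_hom_zero[OF assms] by (simp add: M.M.l_neg)
    finally show ?thesis using D x by (metis N.M.minus_equality M.M.a_inv_closed)
  qed
  show "f (x \<ominus>\<^bsub>M\<^esub> y) = f x \<ominus>\<^bsub>N\<^esub> f y" if "x \<in> carrier M" "y \<in> carrier M"
    using that D 1[of y] by (simp add: a_minus_def)
qed

lemma rmod_hom_image:
  assumes "right_module R M" "right_module R N" "f \<in> rmod_hom R M N" "rsubmodule L R M"
  shows "rsubmodule (f ` L) R N"
proof -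
  interpret M: right_module R M by fact
  interpret N: right_module R N by fact
  note D = rmod_homD[OF assms(3)] and L = M.rsubmoduleD[OF assms(4)]
  show ?thesis unfolding N.rsubmodule_iff
  proof (intro conjI ballI)
    show "\<zero>\<^bsub>N\<^esub> \<in> f ` L" using L(2) rmod_hom_zero[OF assms(1-3)] by force
    fix x y assume "x \<in> f ` L" "y \<in> f ` L"
    then obtain u v where "u \<in> L" "v \<in> L" "x = f u" "y = f v" by blast
    then show "x \<oplus>\<^bsub>N\<^esub> y \<in> f ` L" using L(1,3) D(2) by (intro image_eqI[of _ _ "u \<oplus>\<^bsub>M\<^esub> v"]) simp_all
  next
    fix x r assume "x \<in> f ` L" and r: "r \<in> carrier R"
    then obtain u where "u \<in> L" "x = f u" by blast
    then show "x \<cdot>\<^bsub>N\<^esub> r \<in> f ` L" using r L(1,4) D(3) by (intro image_eqI[of _ _ "u \<cdot>\<^bsub>M\<^esub> r"]) simp_all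
  qed (use L(1) D(1) in auto)
qed

lemma rmod_hom_vimage:
  assumes "right_module R M" "right_module R N" "f \<in> rmod_hom R M N" "rsubmodule L R N"
  shows "rsubmodule {x \<in> carrier M. f x \<in> L} R M"
proof -
  interpret M: right_module R M by fact
  interpret N: right_module R N by fact
  note D = rmod_homD[OF assms(3)] and L = N.rsubmoduleD[OF assms(4)]
  show ?thesis unfolding M.rsubmodule_iff
    using D L rmod_hom_zero[OF assms(1-3)] by auto
qed

lemma rmod_hom_kernel:
  assumes "right_module R M" "right_module R N" "f \<in> rmod_hom R M N"
  shows "rsubmodule {x \<in> carrier M. f x = \<zero>\<^bsub>N\<^esub>} R M"
proof -
  interpret N: right_module R N by fact
  have "rsubmodule {\<zero>\<^bsub>N\<^esub>} R N" by (auto simp: N.rsubmodule_iff)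
  from rmod_hom_vimage[OF assms this] show ?thesis by simp
qed

lemma rmod_hom_compose:
  assumes "f \<in> rmod_hom R M N" "g \<in> rmod_hom R L M"
  shows "(\<lambda>x. f (g x)) \<in> rmod_hom R L N"
  using assms by (auto simp: rmod_hom_def Pi_iff)

lemma rmod_iso_inverse:
  assumes "right_module R M" "right_module R N" "f \<in> rmod_iso R M N"
  shows "inv_into (carrier M) f \<in> rmod_hom R N M"
proof -
  interpret M: right_module R M by fact
  interpret N: right_module R N by fact
  let ?g = "inv_into (carrier M) f"
  have f: "f \<in> rmod_hom R M N" and b: "bij_betw f (carrier M) (carrier N)"
    using assms(3) by (auto simp: rmod_iso_def)
  note D = rmod_homD[OF f]
  have g: "?g y \<in> carrier M" "f (?g y) = y" if "y \<in> carrier N" for y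
    using b that by (auto simp: bij_betw_def inv_into_into f_inv_into_f)
  have inj: "x = y" if "x \<in> carrier M" "y \<in> carrier M" "f x = f y" for x y
    using b that by (auto simp: bij_betw_def inj_on_def)
  show ?thesis
    by (rule rmod_homI) (auto simp: g D intro!: inj)
qed

section \<open>The submodule generated by the action of the Jacobson radical\<close>

text \<open>This is \<open>MJ(R)\<close>, the finite sums of products of an element of
  \<open>M\<close> with one of \<open>J(R)\<close>. Building sums one product at a time gives an
  induction rule that replaces arguments about representing families.\<close>

inductive_set times_jacobson :: "[('r, 'k) ring_scheme, ('r, 'm) rmod] \<Rightarrow> 'm set"
  for R M where
    zero: "\<zero>\<^bsub>M\<^esub> \<in> times_jacobson R M"
  | step: "x \<in> carrier M \<Longrightarrow> a \<in> jacobson R \<Longrightarrow> y \<in> times_jacobson R M \<Longrightarrow>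
      x \<cdot>\<^bsub>M\<^esub> a \<oplus>\<^bsub>M\<^esub> y \<in> times_jacobson R M"

lemma jacobson_rsubmodule:
  assumes "ring R" shows "rsubmodule (jacobson R) R (regular_rmod R)"
proof -
  interpret ring R by fact
  interpret reg: right_module R "regular_rmod R" by (rule regular_rmod_module) fact
  have "rsubmodule I R (regular_rmod R)" if "maximal_rsubmodule I R (regular_rmod R)" for I
    using that by (simp add: maximal_rsubmodule_def)
  then show ?thesis
    unfolding reg.rsubmodule_iff jacobson_def
    using reg.rsubmoduleD by (auto simp: regular_rmod_def)
qed

text \<open>Since \<open>jacobson\<close> intersects maximal right ideals, the left-hand closure is
  the one with content. For a maximal right ideal \<open>I\<close>, the elements \<open>s\<close>
  with \<open>r s\<close> in \<open>I\<close> form a right ideal that is either everything or again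
  maximal, because the quotient by it embeds in the simple module \<open>R/I\<close>. In both cases
  it contains \<open>a\<close>.\<close>

lemma jacobson_left_closed:
  assumes "ring R" and a: "a \<in> jacobson R" and r: "r \<in> carrier R"
  shows "r \<otimes>\<^bsub>R\<^esub> a \<in> jacobson R"
proof -
  interpret ring R by fact
  interpret reg: right_module R "regular_rmod R" by (rule regular_rmod_module) fact
  have reg_simps: "carrier (regular_rmod R) = carrier R" "x \<cdot>\<^bsub>regular_rmod R\<^esub> y = x \<otimes>\<^bsub>R\<^esub> y"
    "x \<oplus>\<^bsub>regular_rmod R\<^esub> y = x \<oplus>\<^bsub>R\<^esub> y" "\<zero>\<^bsub>regular_rmod R\<^esub> = \<zero>\<^bsub>R\<^esub>" for x y
    by (simp_all add: regular_rmod_def)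
  have ac: "a \<in> carrier R" using a by (simp add: jacobson_def)
  have "r \<otimes>\<^bsub>R\<^esub> a \<in> I" if I: "maximal_rsubmodule I R (regular_rmod R)" for I
  proof -
    have Is: "rsubmodule I R (regular_rmod R)" using I by (simp add: maximal_rsubmodule_def)
    note ID = reg.rsubmoduleD[OF Is, unfolded reg_simps]
    let ?L = "{s \<in> carrier R. r \<otimes>\<^bsub>R\<^esub> s \<in> I}"
    have Ls: "rsubmodule ?L R (regular_rmod R)"
      unfolding reg.rsubmodule_iff reg_simps using ID r
      by (auto simp: r_distr m_assoc[symmetric])
    show ?thesis
    proof (cases "?L = carrier R")
      case True then show ?thesis using ac by blast
    next
      case False
      have "maximal_rsubmodule ?L R (regular_rmod R)"
        unfolding maximal_rsubmodule_def reg_simps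
      proof (intro conjI allI impI Ls False)
        fix N assume N: "rsubmodule N R (regular_rmod R) \<and> ?L \<subseteq> N"
        then have Ns: "rsubmodule N R (regular_rmod R)" by simp
        note ND = reg.rsubmoduleD[OF Ns, unfolded reg_simps]
        show "N = ?L \<or> N = carrier R"
        proof (rule ccontr)
          assume *: "\<not> (N = ?L \<or> N = carrier R)"
          then obtain l where l: "l \<in> N" "l \<notin> ?L" using N by blast
          then have lc: "l \<in> carrier R" "r \<otimes>\<^bsub>R\<^esub> l \<notin> I" using ND(1) by auto
          let ?C = "{(r \<otimes>\<^bsub>R\<^esub> l) \<cdot>\<^bsub>regular_rmod R\<^esub> t |t. t \<in> carrier R}"
          have rl: "r \<otimes>\<^bsub>R\<^esub> l \<in> carrier (regular_rmod R)" using r lc by (simp add: reg_simps)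
          note C = reg.rsubmodule_cyclic[OF rl]
          note S = reg.rsubmodule_sum[OF Is C] and U = reg.rsubmodule_sum_upper[OF Is C]
          have "r \<otimes>\<^bsub>R\<^esub> l \<in> I <+>\<^bsub>regular_rmod R\<^esub> ?C"
            using U(2) reg.mem_cyclic[OF rl] by blast
          then have "I <+>\<^bsub>regular_rmod R\<^esub> ?C = carrier R"
            using I S U(1) lc unfolding maximal_rsubmodule_def reg_simps by blast
          \<comment> \<open>Expanding \<open>r\<close> itself, rather than 1, yields
            \<open>r (1 - l t) = i\<close>. This puts \<open>1 - l t\<close> into \<open>?L\<close>,
            hence into \<open>N\<close>, which already contains \<open>l t\<close>.\<close>
          then have "r \<in> I <+>\<^bsub>regular_rmod R\<^esub> ?C" using r by simp
          then obtain i t where it: "i \<in> I" "t \<in> carrier R" "r = i \<oplus>\<^bsub>R\<^esub> r \<otimes>\<^bsub>R\<^esub> l \<otimes>\<^bsub>R\<^esub> t"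
            by (auto simp: set_add_def' reg_simps)
          have ic: "i \<in> carrier R" using it ID(1) by simp
          have "r \<otimes>\<^bsub>R\<^esub> (\<one>\<^bsub>R\<^esub> \<ominus>\<^bsub>R\<^esub> l \<otimes>\<^bsub>R\<^esub> t) = r \<ominus>\<^bsub>R\<^esub> r \<otimes>\<^bsub>R\<^esub> l \<otimes>\<^bsub>R\<^esub> t"
            using r lc it by (simp add: a_minus_def r_distr r_minus m_assoc)
          also have "\<dots> = i"
            using it ic r lc by (metis add.inv_solve_right' a_minus_def m_closed)
          finally have "\<one>\<^bsub>R\<^esub> \<ominus>\<^bsub>R\<^esub> l \<otimes>\<^bsub>R\<^esub> t \<in> ?L" using it lc by simp
          then have m: "\<one>\<^bsub>R\<^esub> \<ominus>\<^bsub>R\<^esub> l \<otimes>\<^bsub>R\<^esub> t \<in> N" using N by blast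
          have "l \<otimes>\<^bsub>R\<^esub> t \<in> N" using ND(4) l it by simp
          then have "\<one>\<^bsub>R\<^esub> \<ominus>\<^bsub>R\<^esub> l \<otimes>\<^bsub>R\<^esub> t \<oplus>\<^bsub>R\<^esub> l \<otimes>\<^bsub>R\<^esub> t \<in> N" using ND(3) m by simp
          then have "\<one>\<^bsub>R\<^esub> \<in> N" using lc it by (simp add: a_minus_def a_assoc l_neg)
          then have "s \<in> N" if "s \<in> carrier R" for s using ND(4)[of "\<one>\<^bsub>R\<^esub>" s] that by simp
          then have "N = carrier R" using ND(1) by blast
          then show False using * by simp
        qed
      qed
      then have "a \<in> ?L" using a unfolding jacobson_def by blast
      then show ?thesis by simp
    qed
  qed
  then show ?thesis using ac r unfolding jacobson_def by auto
qed

lemma jacobson_ideal: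
  assumes "ring R" shows "ideal (jacobson R) R"
proof -
  interpret ring R by fact
  interpret reg: right_module R "regular_rmod R" by (rule regular_rmod_module) fact
  note J = jacobson_rsubmodule[OF assms]
  show ?thesis
  proof (rule idealI[OF assms])
    have "subgroup (jacobson R) (add_monoid (regular_rmod R))"
      using J by (simp add: rsubmodule_def additive_subgroup_def)
    then show "subgroup (jacobson R) (add_monoid R)"
      by (auto simp: regular_rmod_def subgroup_def m_inv_def)
    show "a \<otimes>\<^bsub>R\<^esub> x \<in> jacobson R" if "a \<in> jacobson R" "x \<in> carrier R" for a x
      using reg.rsubmoduleD(4)[OF J that] by (simp add: regular_rmod_def)
  qed (rule jacobson_left_closed[OF assms])
qed

lemma (in right_module) jacobson_closed:
  "a \<in> jacobson R \<Longrightarrow> a \<in> carrier R"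
  "a \<in> jacobson R \<Longrightarrow> r \<in> carrier R \<Longrightarrow> a \<otimes>\<^bsub>R\<^esub> r \<in> jacobson R"
  by (simp add: jacobson_def) (rule ideal.I_r_closed[OF jacobson_ideal[OF R.ring_axioms]])

lemma (in right_module) times_jacobson_rsubmodule: "rsubmodule (times_jacobson R M) R M"
  unfolding rsubmodule_iff
proof (intro conjI ballI subsetI)
  show c: "y \<in> carrier M" if "y \<in> times_jacobson R M" for y
    using that by induction (auto simp: jacobson_closed)
  show "x \<oplus>\<^bsub>M\<^esub> y \<in> times_jacobson R M"
    if "x \<in> times_jacobson R M" "y \<in> times_jacobson R M" for x y
    using that
  proof induction
    case (step x a z)
    have "x \<cdot>\<^bsub>M\<^esub> a \<oplus>\<^bsub>M\<^esub> z \<oplus>\<^bsub>M\<^esub> y = x \<cdot>\<^bsub>M\<^esub> a \<oplus>\<^bsub>M\<^esub> (z \<oplus>\<^bsub>M\<^esub> y)"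
      using step c by (simp add: M.a_assoc jacobson_closed)
    then show ?case using step times_jacobson.step by metis
  qed (simp add: c)
  show "x \<cdot>\<^bsub>M\<^esub> r \<in> times_jacobson R M"
    if "x \<in> times_jacobson R M" "r \<in> carrier R" for x r
    using that
  proof induction
    case (step x a z)
    have "(x \<cdot>\<^bsub>M\<^esub> a \<oplus>\<^bsub>M\<^esub> z) \<cdot>\<^bsub>M\<^esub> r = x \<cdot>\<^bsub>M\<^esub> (a \<otimes>\<^bsub>R\<^esub> r) \<oplus>\<^bsub>M\<^esub> z \<cdot>\<^bsub>M\<^esub> r"
      using step c by (simp add: ract_add_left ract_mult jacobson_closed)
    then show ?case using step times_jacobson.step jacobson_closed(2) by metis
  qed (simp add: times_jacobson.zero)
qed (rule times_jacobson.zero)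

lemma (in right_module) ract_jacobson_mem:
  assumes "x \<in> carrier M" "a \<in> jacobson R"
  shows "x \<cdot>\<^bsub>M\<^esub> a \<in> times_jacobson R M"
  using times_jacobson.step[OF assms times_jacobson.zero] assms by (simp add: jacobson_closed)

lemma rmod_hom_times_jacobson:
  assumes "right_module R M" "right_module R N" "f \<in> rmod_hom R M N" "y \<in> times_jacobson R M"
  shows "f y \<in> times_jacobson R N"
proof -
  interpret M: right_module R M by fact
  interpret N: right_module R N by fact
  note D = rmod_homD[OF assms(3)] and c = M.rsubmoduleD(1)[OF M.times_jacobson_rsubmodule]
  from assms(4) show ?thesis
  proof induction
    case zero then show ?case using rmod_hom_zero[OF assms(1-3)] times_jacobson.zero by metis
  next
    case (step x a z)
    then show ?case using D c M.jacobson_closed(1) by (auto intro: times_jacobson.step)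
  qed
qed

section \<open>T-nilpotence and Nakayama's lemma\<close>

text \<open>\<open>Q y c\<close> is to be read as "\<open>y\<close> times \<open>c\<close> is bad".
  If badness can always be passed on by multiplying \<open>c\<close> on the left with an element of
  \<open>A\<close>, dependent choice yields a sequence in \<open>A\<close> whose products all stay
  bad, and T-nilpotence makes one of these products zero. The witness \<open>y\<close> may change at
  every step.\<close>

lemma right_T_nilpotent_descent:
  assumes T: "right_T_nilpotent R A" and A: "\<And>a. a \<in> A \<Longrightarrow> a \<in> carrier R" and R: "ring R"
    and start: "Q x \<one>\<^bsub>R\<^esub>"
    and step: "\<And>y c. Q y c \<Longrightarrow> c \<in> carrier R \<Longrightarrow> \<exists>y' a. a \<in> A \<and> Q y' (a \<otimes>\<^bsub>R\<^esub> c)"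
  shows "\<exists>y. Q y \<zero>\<^bsub>R\<^esub>"
proof -
  interpret ring R by fact
  let ?st = "{(y, c). Q y c \<and> c \<in> carrier R}"
  \<comment> \<open>The clause for \<open>n = 0\<close> pins the start at \<open>(x, 1)\<close>, so
    that the second components are exactly the products \<open>rev_prod R a n\<close>.\<close>
  have "\<exists>g. \<forall>n. (g n \<in> ?st \<and> (n = 0 \<longrightarrow> g n = (x, \<one>\<^bsub>R\<^esub>))) \<and>
      (\<exists>a\<in>A. snd (g (Suc n)) = a \<otimes>\<^bsub>R\<^esub> snd (g n))"
  proof (rule dependent_nat_choice)
    show "\<exists>s. s \<in> ?st \<and> (0 = 0 \<longrightarrow> s = (x, \<one>\<^bsub>R\<^esub>))"
      using start by auto
    fix s and n :: nat assume "s \<in> ?st \<and> (n = 0 \<longrightarrow> s = (x, \<one>\<^bsub>R\<^esub>))"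
    then have s: "s \<in> ?st" by simp
    then obtain y' a where "a \<in> A" "Q y' (a \<otimes>\<^bsub>R\<^esub> snd s)" using step[of "fst s" "snd s"] by auto
    then show "\<exists>t. (t \<in> ?st \<and> (Suc n = 0 \<longrightarrow> t = (x, \<one>\<^bsub>R\<^esub>))) \<and>
        (\<exists>a\<in>A. snd t = a \<otimes>\<^bsub>R\<^esub> snd s)"
      using s A by (intro exI[of _ "(y', a \<otimes>\<^bsub>R\<^esub> snd s)"]) auto
  qed
  then obtain g where gall: "\<forall>n. (g n \<in> ?st \<and> (n = 0 \<longrightarrow> g n = (x, \<one>\<^bsub>R\<^esub>))) \<and>
      (\<exists>a\<in>A. snd (g (Suc n)) = a \<otimes>\<^bsub>R\<^esub> snd (g n))" by (rule exE)
  have g: "g n \<in> ?st" "\<exists>a\<in>A. snd (g (Suc n)) = a \<otimes>\<^bsub>R\<^esub> snd (g n)" "g 0 = (x, \<one>\<^bsub>R\<^esub>)" for n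
    using gall by simp_all
  from g(2) obtain a where a: "\<And>n. a n \<in> A" "\<And>n. snd (g (Suc n)) = a n \<otimes>\<^bsub>R\<^esub> snd (g n)"
    by (metis (no_types, lifting))
  have "snd (g n) = rev_prod R a n" for n
    by (induction n) (simp_all add: g(3) a(2))
  moreover obtain n where "rev_prod R a n = \<zero>\<^bsub>R\<^esub>"
    using T a(1) unfolding right_T_nilpotent_def by blast
  ultimately show ?thesis using g(1)[of n] by (auto simp: case_prod_beta)
qed

text \<open>The hypothesis \<open>sum\<close> says \<open>M = N + MJ(R)\<close>. If
  \<open>y c\<close> is outside \<open>N\<close>, write \<open>y\<close> as an element of
  \<open>N\<close> plus a sum of products \<open>x a\<close> with \<open>a\<close> in
  \<open>J(R)\<close>; some \<open>x (a c)\<close> is then outside \<open>N\<close>. The descent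
  ends with \<open>y 0\<close> outside \<open>N\<close>, which is absurd. No finiteness of
  \<open>M\<close> is involved.\<close>

lemma (in right_module) nakayama:
  assumes T: "right_T_nilpotent R (jacobson R)" and N: "rsubmodule N R M"
    and sum: "\<And>x. x \<in> carrier M \<Longrightarrow> \<exists>n\<in>N. \<exists>y\<in>times_jacobson R M. x = n \<oplus>\<^bsub>M\<^esub> y"
  shows "N = carrier M"
proof (rule ccontr)
  note D = rsubmoduleD[OF N]
  assume "N \<noteq> carrier M"
  then obtain x where x: "x \<in> carrier M" "x \<notin> N" using D(1) by blast
  define Q where "Q y c \<longleftrightarrow> y \<in> carrier M \<and> y \<cdot>\<^bsub>M\<^esub> c \<notin> N" for y c
  have "\<exists>y. Q y \<zero>\<^bsub>R\<^esub>"
  proof (rule right_T_nilpotent_descent[OF T jacobson_closed(1) R.ring_axioms])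
    show "Q x \<one>\<^bsub>R\<^esub>" using x by (simp add: Q_def)
    fix y c assume Q: "Q y c" and c: "c \<in> carrier R"
    show "\<exists>y' a. a \<in> jacobson R \<and> Q y' (a \<otimes>\<^bsub>R\<^esub> c)"
    proof (rule ccontr)
      assume "\<not> ?thesis"
      then have no: "y' \<cdot>\<^bsub>M\<^esub> (a \<otimes>\<^bsub>R\<^esub> c) \<in> N" if "a \<in> jacobson R" "y' \<in> carrier M" for y' a
        using that by (auto simp: Q_def)
      have *: "z \<cdot>\<^bsub>M\<^esub> c \<in> N" if "z \<in> times_jacobson R M" for z
        using that
      proof induction
        case zero then show ?case using c D(2) by simp
      next
        case (step x a z)
        have z: "z \<in> carrier M" using step rsubmoduleD(1)[OF times_jacobson_rsubmodule] by simp
        have "(x \<cdot>\<^bsub>M\<^esub> a \<oplus>\<^bsub>M\<^esub> z) \<cdot>\<^bsub>M\<^esub> c = x \<cdot>\<^bsub>M\<^esub> (a \<otimes>\<^bsub>R\<^esub> c) \<oplus>\<^bsub>M\<^esub> z \<cdot>\<^bsub>M\<^esub> c"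
          using step c z by (simp add: ract_add_left ract_mult jacobson_closed)
        then show ?case using step no D(3) by simp
      qed
      have y: "y \<in> carrier M" using Q by (simp add: Q_def)
      then obtain n z where nz: "n \<in> N" "z \<in> times_jacobson R M" "y = n \<oplus>\<^bsub>M\<^esub> z" using sum by blast
      then have "y \<cdot>\<^bsub>M\<^esub> c = n \<cdot>\<^bsub>M\<^esub> c \<oplus>\<^bsub>M\<^esub> z \<cdot>\<^bsub>M\<^esub> c"
        using D(1) rsubmoduleD(1)[OF times_jacobson_rsubmodule] c by (simp add: ract_add_left)
      then show False using nz * D(3,4) c Q by (simp add: Q_def)
    qed
  qed
  then show False using D(2) by (auto simp: Q_def)
qed

lemma (in right_module) times_jacobson_proper:
  assumes "right_T_nilpotent R (jacobson R)" "carrier M \<noteq> {\<zero>\<^bsub>M\<^esub>}"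
  shows "times_jacobson R M \<noteq> carrier M"
proof
  assume eq: "times_jacobson R M = carrier M"
  have "{\<zero>\<^bsub>M\<^esub>} = carrier M"
    by (rule nakayama[OF assms(1)]) (auto simp: rsubmodule_iff eq)
  then show False using assms(2) by simp
qed

section \<open>Endomorphism rings\<close>

lemma End_ring_apply [simp]:
  assumes "x \<in> carrier M"
  shows "\<one>\<^bsub>End_ring R M\<^esub> x = x" "\<zero>\<^bsub>End_ring R M\<^esub> x = \<zero>\<^bsub>M\<^esub>"
    "(f \<otimes>\<^bsub>End_ring R M\<^esub> g) x = f (g x)" "(f \<oplus>\<^bsub>End_ring R M\<^esub> g) x = f x \<oplus>\<^bsub>M\<^esub> g x"
  using assms by (simp_all add: End_ring_def compose_eq)

lemma End_ring_hom: "f \<in> carrier (End_ring R M) \<Longrightarrow> f \<in> rmod_hom R M M"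
  by (simp add: End_ring_def)

lemma End_ring_closed [simp]:
  "f \<in> carrier (End_ring R M) \<Longrightarrow> x \<in> carrier M \<Longrightarrow> f x \<in> carrier M"
  by (rule rmod_homD(1)[OF End_ring_hom])

lemma restrict_in_End_ring:
  assumes "right_module R M" "f \<in> rmod_hom R M M"
  shows "restrict f (carrier M) \<in> carrier (End_ring R M)"
proof -
  interpret right_module R M by fact
  have "restrict f (carrier M) \<in> rmod_hom R M M"
    by (rule rmod_homI) (simp_all add: rmod_homD[OF assms(2)])
  then show ?thesis by (simp add: End_ring_def)
qed

lemma End_ring_eqI:
  assumes "f \<in> carrier (End_ring R M)" "g \<in> carrier (End_ring R M)"
    "\<And>x. x \<in> carrier M \<Longrightarrow> f x = g x"
  shows "f = g"
proof (rule extensionalityI)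
  show "f \<in> extensional (carrier M)" "g \<in> extensional (carrier M)"
    using assms(1,2) by (simp_all add: End_ring_def)
qed (rule assms(3))

context right_module
begin

lemma End_ring_minus [simp]:
  assumes f: "f \<in> carrier (End_ring R M)" and g: "g \<in> carrier (End_ring R M)" and x: "x \<in> carrier M"
  shows "(\<ominus>\<^bsub>End_ring R M\<^esub> f) x = \<ominus>\<^bsub>M\<^esub> f x" "(f \<ominus>\<^bsub>End_ring R M\<^esub> g) x = f x \<ominus>\<^bsub>M\<^esub> g x"
proof -
  interpret E: ring "End_ring R M" by (rule End_ring_ring) (rule right_module_axioms)
  have *: "(\<ominus>\<^bsub>End_ring R M\<^esub> f) x = \<ominus>\<^bsub>M\<^esub> f x" if f: "f \<in> carrier (End_ring R M)" for f
  proof -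
    have "(\<ominus>\<^bsub>End_ring R M\<^esub> f \<oplus>\<^bsub>End_ring R M\<^esub> f) x = \<zero>\<^bsub>M\<^esub>"
      using f x by (subst E.l_neg) auto
    then show ?thesis
      using End_ring_closed[OF f x] End_ring_closed[OF E.a_inv_closed[OF f] x] x
        M.minus_equality[symmetric] by simp
  qed
  show "(\<ominus>\<^bsub>End_ring R M\<^esub> f) x = \<ominus>\<^bsub>M\<^esub> f x" by (rule *[OF f])
  show "(f \<ominus>\<^bsub>End_ring R M\<^esub> g) x = f x \<ominus>\<^bsub>M\<^esub> g x"
    using *[OF g] x by (simp add: a_minus_def)
qed

lemma End_ring_Units:
  assumes "f \<in> carrier (End_ring R M)" "bij_betw f (carrier M) (carrier M)"
  shows "f \<in> Units (End_ring R M)"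
proof -
  interpret E: ring "End_ring R M" by (rule End_ring_ring) (rule right_module_axioms)
  let ?g = "restrict (inv_into (carrier M) f) (carrier M)"
  have "f \<in> rmod_iso R M M" using End_ring_hom[OF assms(1)] assms(2) by (simp add: rmod_iso_def)
  then have g: "?g \<in> carrier (End_ring R M)"
    using rmod_iso_inverse[OF right_module_axioms right_module_axioms]
      restrict_in_End_ring[OF right_module_axioms] by simp
  have "?g \<otimes>\<^bsub>End_ring R M\<^esub> f = \<one>\<^bsub>End_ring R M\<^esub>"
    by (rule End_ring_eqI) (use assms g in \<open>auto simp: bij_betw_def\<close>)
  moreover have "f \<otimes>\<^bsub>End_ring R M\<^esub> ?g = \<one>\<^bsub>End_ring R M\<^esub>"
    by (rule End_ring_eqI) (use assms g in \<open>auto simp: bij_betw_def f_inv_into_f\<close>)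
  ultimately show ?thesis using assms(1) g by (auto simp: Units_def)
qed

lemma Units_End_ring_iso:
  assumes "f \<in> Units (End_ring R M)"
  shows "f \<in> rmod_iso R M M"
proof -
  obtain g where f: "f \<in> carrier (End_ring R M)" and g: "g \<in> carrier (End_ring R M)"
    and fg: "f \<otimes>\<^bsub>End_ring R M\<^esub> g = \<one>\<^bsub>End_ring R M\<^esub>" "g \<otimes>\<^bsub>End_ring R M\<^esub> f = \<one>\<^bsub>End_ring R M\<^esub>"
    using assms by (auto simp: Units_def)
  have "f (g x) = x" "g (f x) = x" if "x \<in> carrier M" for x
    using fun_cong[OF fg(1), of x] fun_cong[OF fg(2), of x] that by simp_all
  then have "bij_betw f (carrier M) (carrier M)"
    using f g by (intro bij_betw_byWitness[of _ g]) auto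
  then show ?thesis using End_ring_hom[OF f] by (simp add: rmod_iso_def)
qed

text \<open>Call an element surviving if no power of \<open>f\<close> kills it. If
  \<open>y c\<close> survives, then so does \<open>f y c\<close>, and \<open>f y\<close> is a finite
  sum of products \<open>x a\<close> with \<open>a\<close> in \<open>J(R)\<close>. If every
  \<open>x (a c)\<close> were killed, the largest exponent would kill the sum, so some
  \<open>x (a c)\<close> survives. The descent ends with a surviving \<open>y 0\<close>. The
  exponent depends on \<open>x\<close>.\<close>

lemma locally_nilpotent:
  assumes T: "right_T_nilpotent R (jacobson R)" and f: "f \<in> carrier (End_ring R M)"
    and im: "\<And>x. x \<in> carrier M \<Longrightarrow> f x \<in> times_jacobson R M" and x: "x \<in> carrier M"
  shows "\<exists>n. (f ^^ n) x = \<zero>\<^bsub>M\<^esub>"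
proof (rule ccontr)
  assume non: "\<not> ?thesis"
  note fD = rmod_homD[OF End_ring_hom[OF f]]
  have f0: "f \<zero>\<^bsub>M\<^esub> = \<zero>\<^bsub>M\<^esub>"
    using rmod_hom_zero[OF right_module_axioms right_module_axioms End_ring_hom[OF f]] .
  have cl: "(f ^^ n) y \<in> carrier M" if "y \<in> carrier M" for n y
    using that fD(1) by (induction n) auto
  have add: "(f ^^ n) (y \<oplus>\<^bsub>M\<^esub> z) = (f ^^ n) y \<oplus>\<^bsub>M\<^esub> (f ^^ n) z"
    if "y \<in> carrier M" "z \<in> carrier M" for n y z
    using that fD cl by (induction n) auto
  have act: "(f ^^ n) (y \<cdot>\<^bsub>M\<^esub> r) = (f ^^ n) y \<cdot>\<^bsub>M\<^esub> r" if "y \<in> carrier M" "r \<in> carrier R" for n y r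
    using that fD cl by (induction n) auto
  have mono: "(f ^^ m) y = \<zero>\<^bsub>M\<^esub>" if "(f ^^ n) y = \<zero>\<^bsub>M\<^esub>" "n \<le> m" for n m y
    using that(2,1) by (induction m rule: dec_induct) (auto simp: f0)
  define Q where "Q y c \<longleftrightarrow> y \<in> carrier M \<and> (\<forall>n. (f ^^ n) (y \<cdot>\<^bsub>M\<^esub> c) \<noteq> \<zero>\<^bsub>M\<^esub>)" for y c
  have "\<exists>y. Q y \<zero>\<^bsub>R\<^esub>"
  proof (rule right_T_nilpotent_descent[OF T jacobson_closed(1) R.ring_axioms])
    show "Q x \<one>\<^bsub>R\<^esub>" using x non by (simp add: Q_def)
    fix y c assume Q: "Q y c" and c: "c \<in> carrier R"
    show "\<exists>y' a. a \<in> jacobson R \<and> Q y' (a \<otimes>\<^bsub>R\<^esub> c)"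
    proof (rule ccontr)
      assume "\<not> ?thesis"
      then have no: "\<exists>n. (f ^^ n) (y' \<cdot>\<^bsub>M\<^esub> (a \<otimes>\<^bsub>R\<^esub> c)) = \<zero>\<^bsub>M\<^esub>"
        if "a \<in> jacobson R" "y' \<in> carrier M" for y' a
        using that by (auto simp: Q_def)
      have "\<exists>n. (f ^^ n) (z \<cdot>\<^bsub>M\<^esub> c) = \<zero>\<^bsub>M\<^esub>" if "z \<in> times_jacobson R M" for z
        using that
      proof induction
        case zero then show ?case using c by (intro exI[of _ 0]) simp
      next
        case (step x a z)
        have z: "z \<in> carrier M" using step rsubmoduleD(1)[OF times_jacobson_rsubmodule] by simp
        obtain n where n: "(f ^^ n) (z \<cdot>\<^bsub>M\<^esub> c) = \<zero>\<^bsub>M\<^esub>" using step by blast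
        obtain m where m: "(f ^^ m) (x \<cdot>\<^bsub>M\<^esub> (a \<otimes>\<^bsub>R\<^esub> c)) = \<zero>\<^bsub>M\<^esub>" using step no by blast
        have "(x \<cdot>\<^bsub>M\<^esub> a \<oplus>\<^bsub>M\<^esub> z) \<cdot>\<^bsub>M\<^esub> c = x \<cdot>\<^bsub>M\<^esub> (a \<otimes>\<^bsub>R\<^esub> c) \<oplus>\<^bsub>M\<^esub> z \<cdot>\<^bsub>M\<^esub> c"
          using step c z by (simp add: ract_add_left ract_mult jacobson_closed)
        then have "(f ^^ (max n m)) ((x \<cdot>\<^bsub>M\<^esub> a \<oplus>\<^bsub>M\<^esub> z) \<cdot>\<^bsub>M\<^esub> c) = \<zero>\<^bsub>M\<^esub>"
          using step c z mono[OF n, of "max n m"] mono[OF m, of "max n m"]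
          by (simp add: add jacobson_closed)
        then show ?case by blast
      qed
      moreover have y: "y \<in> carrier M" using Q by (simp add: Q_def)
      ultimately obtain n where "(f ^^ n) (f y \<cdot>\<^bsub>M\<^esub> c) = \<zero>\<^bsub>M\<^esub>" using im by blast
      then have "(f ^^ Suc n) (y \<cdot>\<^bsub>M\<^esub> c) = \<zero>\<^bsub>M\<^esub>"
        using fD(3) y c by (simp add: funpow_swap1)
      then show False using Q by (auto simp: Q_def simp del: funpow.simps)
    qed
  qed
  then show False by (auto simp: Q_def dest: spec[of _ 0])
qed

text \<open>A geometric series is replaced by two separate arguments. An element of the kernel of
  \<open>1 - f\<close> is fixed by \<open>f\<close>, hence by all its powers, and local nilpotence
  makes it zero. Surjectivity is Nakayama's lemma, since \<open>x = (1 - f) x + f x\<close> with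
  \<open>f x\<close> in \<open>MJ(R)\<close>.\<close>

lemma one_minus_Units:
  assumes T: "right_T_nilpotent R (jacobson R)" and f: "f \<in> carrier (End_ring R M)"
    and im: "\<And>x. x \<in> carrier M \<Longrightarrow> f x \<in> times_jacobson R M"
  shows "\<one>\<^bsub>End_ring R M\<^esub> \<ominus>\<^bsub>End_ring R M\<^esub> f \<in> Units (End_ring R M)" (is "?g \<in> _")
proof (rule End_ring_Units)
  interpret E: ring "End_ring R M" by (rule End_ring_ring) (rule right_module_axioms)
  show g: "?g \<in> carrier (End_ring R M)" using f by simp
  note gh = End_ring_hom[OF g]
  have ap: "?g x = x \<ominus>\<^bsub>M\<^esub> f x" if "x \<in> carrier M" for x
    using that f E.one_closed by (subst End_ring_minus) auto
  have "inj_on ?g (carrier M)"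
  proof (rule inj_onI)
    fix x y assume x: "x \<in> carrier M" and y: "y \<in> carrier M" and eq: "?g x = ?g y"
    let ?d = "x \<ominus>\<^bsub>M\<^esub> y"
    have d: "?d \<in> carrier M" using x y by simp
    have "?g ?d = \<zero>\<^bsub>M\<^esub>"
      using rmod_hom_uminus(2)[OF right_module_axioms right_module_axioms gh x y] eq
        End_ring_closed[OF g y] by (simp add: M.r_neg a_minus_def)
    then have "f ?d = ?d" using ap[OF d] d f by (metis End_ring_closed M.minus_eq_zero_iff)
    then have "(f ^^ n) ?d = ?d" for n by (induction n) auto
    then have "?d = \<zero>\<^bsub>M\<^esub>" using locally_nilpotent[OF T f im d] by metis
    then show "x = y" using x y by (simp add: M.minus_eq_zero_iff)
  qed
  moreover have "?g ` carrier M = carrier M"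
  proof (rule nakayama[OF T])
    show "rsubmodule (?g ` carrier M) R M"
      by (rule rmod_hom_image[OF right_module_axioms right_module_axioms gh rsubmodule_carrier])
    fix x assume x: "x \<in> carrier M"
    have "x = ?g x \<oplus>\<^bsub>M\<^esub> f x"
      using x f by (simp add: ap a_minus_def M.a_assoc M.l_neg)
    then show "\<exists>n\<in>?g ` carrier M. \<exists>y\<in>times_jacobson R M. x = n \<oplus>\<^bsub>M\<^esub> y"
      using x im by blast
  qed
  ultimately show "bij_betw ?g (carrier M) (carrier M)" by (simp add: bij_betw_def)
qed

end

lemma (in abelian_group) add_minus_cancel:
  assumes x: "x \<in> carrier G" and y: "y \<in> carrier G"
  shows "x \<oplus> (y \<ominus> x) = y" "(y \<ominus> x) \<oplus> x = y" "(x \<oplus> y) \<ominus> x = y" "(y \<oplus> x) \<ominus> x = y"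
    "x \<ominus> (x \<oplus> y) = \<ominus> y"
proof -
  have nx: "\<ominus> x \<in> carrier G" using x by simp
  have 1: "(y \<oplus> x) \<ominus> x = y" if "x \<in> carrier G" "y \<in> carrier G" for x y
    using that by (simp add: a_minus_def a_assoc r_neg)
  then show "(y \<oplus> x) \<ominus> x = y" using x y .
  show "(x \<oplus> y) \<ominus> x = y" using 1[OF x y] a_comm[OF x y] by simp
  have 2: "(y \<ominus> x) \<oplus> x = y" using x y by (simp add: a_minus_def a_assoc l_neg)
  then show "(y \<ominus> x) \<oplus> x = y" .
  show "x \<oplus> (y \<ominus> x) = y" using 2 a_comm[of x "y \<ominus> x"] x y by simp
  have "x \<ominus> (x \<oplus> y) = (\<ominus> y \<oplus> \<ominus> x) \<oplus> x"
    using x y by (simp add: a_minus_def minus_add a_comm)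
  also have "\<dots> = \<ominus> y" using x y by (simp add: a_assoc l_neg)
  finally show "x \<ominus> (x \<oplus> y) = \<ominus> y" .
qed

section \<open>Complements modulo the radical\<close>

text \<open>A complement of \<open>I/J(R)\<close> in \<open>R/J(R)\<close> is pulled back along the
  quotient map. The conclusion speaks of elements of \<open>R\<close> only, so that the quotient
  ring does not appear again.\<close>

lemma semisimple_quotient_complement:
  assumes R: "ring R" and ss: "semisimple_ring (R Quot jacobson R)"
    and I: "rsubmodule I R (regular_rmod R)" and JI: "jacobson R \<subseteq> I"
  shows "\<exists>L. rsubmodule L R (regular_rmod R) \<and> I \<inter> L = jacobson R \<and>
    (\<exists>i\<in>I. \<exists>l\<in>L. \<one>\<^bsub>R\<^esub> = i \<oplus>\<^bsub>R\<^esub> l)"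
proof -
  interpret ring R by fact
  interpret J: ideal "jacobson R" R by (rule jacobson_ideal[OF R])
  let ?Q = "R Quot jacobson R" and ?q = "(+>\<^bsub>R\<^esub>) (jacobson R)"
  interpret q: ring_hom_ring R ?Q ?q by (rule J.rcos_ring_hom_ring)
  interpret reg: right_module R "regular_rmod R" by (rule regular_rmod_module) fact
  interpret regQ: right_module ?Q "regular_rmod ?Q"
    by (rule regular_rmod_module) (rule J.quotient_is_ring)
  have reg_simps: "carrier (regular_rmod S) = carrier S" "x \<cdot>\<^bsub>regular_rmod S\<^esub> y = x \<otimes>\<^bsub>S\<^esub> y"
    "x \<oplus>\<^bsub>regular_rmod S\<^esub> y = x \<oplus>\<^bsub>S\<^esub> y" "\<zero>\<^bsub>regular_rmod S\<^esub> = \<zero>\<^bsub>S\<^esub>" for S :: "('z, 'w) ring_scheme" and x y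
    by (simp_all add: regular_rmod_def)
  have reg_simps': "carrier (regular_rmod S) = carrier S" "x \<cdot>\<^bsub>regular_rmod S\<^esub> y = x \<otimes>\<^bsub>S\<^esub> y"
    "x \<oplus>\<^bsub>regular_rmod S\<^esub> y = x \<oplus>\<^bsub>S\<^esub> y" "\<zero>\<^bsub>regular_rmod S\<^esub> = \<zero>\<^bsub>S\<^esub>" for S :: "'z ring" and x y
    by (simp_all add: regular_rmod_def)
  note ID = reg.rsubmoduleD[OF I, unfolded reg_simps]
  have onto: "\<exists>r\<in>carrier R. X = ?q r" if "X \<in> carrier ?Q" for X
    using that unfolding FactRing_def A_RCOSETS_def' partial_object.simps by blast
  have zero_Q: "\<zero>\<^bsub>?Q\<^esub> = jacobson R" by (simp only: FactRing_def ring.simps)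
  have ker: "?q x = \<zero>\<^bsub>?Q\<^esub> \<longleftrightarrow> x \<in> jacobson R" if "x \<in> carrier R" for x
    unfolding zero_Q using J.a_rcos_self[OF that] J.a_rcos_const by blast
  have A: "rsubmodule (?q ` I) ?Q (regular_rmod ?Q)"
    unfolding regQ.rsubmodule_iff reg_simps'
  proof (intro conjI ballI)
    show "?q ` I \<subseteq> carrier ?Q" using q.hom_closed[OF ID(1)] by (rule image_subsetI)
    show "\<zero>\<^bsub>?Q\<^esub> \<in> ?q ` I" by (rule image_eqI[where x = "\<zero>\<^bsub>R\<^esub>"]) (rule q.hom_zero[symmetric], rule ID(2))
  next
    fix x y assume "x \<in> ?q ` I" "y \<in> ?q ` I"
    then obtain u v where "u \<in> I" "v \<in> I" "x = ?q u" "y = ?q v" by blast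
    then show "x \<oplus>\<^bsub>?Q\<^esub> y \<in> ?q ` I"
      by (intro image_eqI[of _ _ "u \<oplus>\<^bsub>R\<^esub> v"]) (simp_all only: q.hom_add[OF ID(1) ID(1)] ID(3))
  next
    fix x r assume "x \<in> ?q ` I" "r \<in> carrier ?Q"
    then obtain u v where "u \<in> I" "v \<in> carrier R" "x = ?q u" "r = ?q v" using onto by blast
    then show "x \<otimes>\<^bsub>?Q\<^esub> r \<in> ?q ` I"
      by (intro image_eqI[of _ _ "u \<otimes>\<^bsub>R\<^esub> v"]) (simp_all only: q.hom_mult[OF ID(1)] ID(4))
  qed
  then obtain B where B: "rsubmodule B ?Q (regular_rmod ?Q)"
    "?q ` I <+>\<^bsub>regular_rmod ?Q\<^esub> B = carrier ?Q" "?q ` I \<inter> B = {\<zero>\<^bsub>?Q\<^esub>}"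
    using ss unfolding semisimple_ring_def semisimple_rmod_def reg_simps' by blast
  note BD = regQ.rsubmoduleD[OF B(1), unfolded reg_simps']
  let ?L = "{r \<in> carrier R. ?q r \<in> B}"
  have "rsubmodule ?L R (regular_rmod R)"
    unfolding reg.rsubmodule_iff reg_simps
    by (auto simp only: q.hom_zero q.hom_add q.hom_mult q.hom_closed BD(2-4) mem_Collect_eq
        zero_closed a_closed m_closed)
  moreover have "I \<inter> ?L = jacobson R"
  proof (intro equalityI subsetI)
    fix x assume x: "x \<in> I \<inter> ?L"
    then have "?q x \<in> ?q ` I \<inter> B" by blast
    then have "?q x = \<zero>\<^bsub>?Q\<^esub>" unfolding B(3) by blast
    then show "x \<in> jacobson R" using x ker by simp
  next
    fix x assume x: "x \<in> jacobson R"
    then have "?q x = \<zero>\<^bsub>?Q\<^esub>" using ker J.Icarr by blast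
    then show "x \<in> I \<inter> ?L" using x JI J.Icarr BD(2) by auto
  qed
  moreover have "\<exists>i\<in>I. \<exists>l\<in>?L. \<one>\<^bsub>R\<^esub> = i \<oplus>\<^bsub>R\<^esub> l"
  proof -
    have "?q \<one>\<^bsub>R\<^esub> \<in> ?q ` I <+>\<^bsub>regular_rmod ?Q\<^esub> B" unfolding B(2) by (rule q.hom_closed) simp
    then obtain i b where ib: "i \<in> I" "b \<in> B" "?q \<one>\<^bsub>R\<^esub> = ?q i \<oplus>\<^bsub>?Q\<^esub> b"
      by (auto simp: set_add_def' reg_simps')
    obtain r where r: "r \<in> carrier R" "b = ?q r" using onto BD(1) ib(2) by blast
    have i: "i \<in> carrier R" using ID(1) ib by simp
    have "?q (\<one>\<^bsub>R\<^esub> \<ominus>\<^bsub>R\<^esub> i) \<in> B"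
    proof -
      have "?q (\<one>\<^bsub>R\<^esub> \<ominus>\<^bsub>R\<^esub> i) = ?q \<one>\<^bsub>R\<^esub> \<ominus>\<^bsub>?Q\<^esub> ?q i"
        using i by (simp add: a_minus_def del: q.hom_one)
      also have "\<dots> = b"
        unfolding ib(3) by (rule q.S.add_minus_cancel(3)[OF q.hom_closed[OF i] BD(1)[OF ib(2)]])
      finally show ?thesis using ib(2) by simp
    qed
    moreover have "\<one>\<^bsub>R\<^esub> = i \<oplus>\<^bsub>R\<^esub> (\<one>\<^bsub>R\<^esub> \<ominus>\<^bsub>R\<^esub> i)"
      using add_minus_cancel(1)[OF i one_closed] by (rule sym)
    ultimately show ?thesis
      using i ib(1) by (intro bexI[of _ i] bexI[of _ "\<one>\<^bsub>R\<^esub> \<ominus>\<^bsub>R\<^esub> i"]) (simp_all only: mem_Collect_eq minus_closed one_closed simp_thms)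
  qed
  ultimately show ?thesis by blast
qed

lemma (in right_module) rsubmodule_Union_chain:
  assumes "C \<noteq> {}" "\<And>X. X \<in> C \<Longrightarrow> rsubmodule X R M" "\<And>X Y. X \<in> C \<Longrightarrow> Y \<in> C \<Longrightarrow> X \<subseteq> Y \<or> Y \<subseteq> X"
  shows "rsubmodule (\<Union>C) R M"
  unfolding rsubmodule_iff
proof (intro conjI ballI)
  fix x y assume "x \<in> \<Union>C" "y \<in> \<Union>C"
  then obtain X where "X \<in> C" "x \<in> X" "y \<in> X" using assms(3) by (meson UnionE subsetD)
  then show "x \<oplus>\<^bsub>M\<^esub> y \<in> \<Union>C" using rsubmoduleD(3)[OF assms(2)] by blast
next
  show "\<Union>C \<subseteq> carrier M" using rsubmoduleD(1)[OF assms(2)] by blast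
  show "\<zero>\<^bsub>M\<^esub> \<in> \<Union>C" using rsubmoduleD(2)[OF assms(2)] assms(1) by blast
  show "x \<cdot>\<^bsub>M\<^esub> r \<in> \<Union>C" if "x \<in> \<Union>C" "r \<in> carrier R" for x r
    using rsubmoduleD(4)[OF assms(2)] that by blast
qed

text \<open>This expresses that \<open>M/MJ(R)\<close> is semisimple. By Zorn's lemma
  \<open>B\<close> is chosen maximal with \<open>N \<inter> B = MJ(R)\<close>. An element
  \<open>y\<close> outside \<open>N + B\<close> would produce a cyclic submodule by which
  \<open>B\<close> can be enlarged.\<close>

lemma (in right_module) complement_mod_radical:
  assumes ss: "semisimple_ring (R Quot jacobson R)"
    and N: "rsubmodule N R M" and JN: "times_jacobson R M \<subseteq> N"
  shows "\<exists>B. rsubmodule B R M \<and> N \<inter> B = times_jacobson R M \<and> N <+>\<^bsub>M\<^esub> B = carrier M"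
proof -
  let ?J = "times_jacobson R M"
  interpret reg: right_module R "regular_rmod R" by (rule regular_rmod_module) (rule R.ring_axioms)
  have reg_simps: "carrier (regular_rmod R) = carrier R" "x \<cdot>\<^bsub>regular_rmod R\<^esub> y = x \<otimes>\<^bsub>R\<^esub> y"
    "x \<oplus>\<^bsub>regular_rmod R\<^esub> y = x \<oplus>\<^bsub>R\<^esub> y" "\<zero>\<^bsub>regular_rmod R\<^esub> = \<zero>\<^bsub>R\<^esub>" for x y
    by (simp_all add: regular_rmod_def)
  note Js = times_jacobson_rsubmodule
  note JD = rsubmoduleD[OF Js] and ND = rsubmoduleD[OF N]
  let ?A = "{B. rsubmodule B R M \<and> N \<inter> B = ?J}"
  have "\<exists>B\<in>?A. \<forall>X\<in>?A. B \<subseteq> X \<longrightarrow> X = B"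
  proof (rule subset_Zorn_nonempty)
    show "?A \<noteq> {}" using Js JN by blast
    fix C assume C: "C \<noteq> {}" "subset.chain ?A C"
    then have 1: "\<And>X. X \<in> C \<Longrightarrow> X \<in> ?A" "\<And>X Y. X \<in> C \<Longrightarrow> Y \<in> C \<Longrightarrow> X \<subseteq> Y \<or> Y \<subseteq> X"
      by (auto simp: subset_chain_def)
    have "rsubmodule (\<Union>C) R M"
      by (rule rsubmodule_Union_chain) (use 1 C(1) in blast)+
    moreover have "N \<inter> \<Union>C = ?J" using 1(1) C(1) by blast
    ultimately show "\<Union>C \<in> ?A" by simp
  qed
  then obtain B where B: "rsubmodule B R M" "N \<inter> B = ?J"
    and max: "\<And>X. rsubmodule X R M \<Longrightarrow> N \<inter> X = ?J \<Longrightarrow> B \<subseteq> X \<Longrightarrow> X = B" by auto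
  note BD = rsubmoduleD[OF B(1)]
  let ?S = "N <+>\<^bsub>M\<^esub> B"
  note S = rsubmodule_sum[OF N B(1)] and SU = rsubmodule_sum_upper[OF N B(1)]
  note SD = rsubmoduleD[OF S]
  have "y \<in> ?S" if y: "y \<in> carrier M" for y
  proof (rule ccontr)
    assume yS: "y \<notin> ?S"
    \<comment> \<open>This right ideal contains \<open>J(R)\<close>. A complement \<open>L\<close>
      of it splits 1 as \<open>i + l\<close>; since \<open>y i\<close> lies in \<open>N + B\<close>,
      the element \<open>y l\<close> does not, while its multiples that fall into
      \<open>N + B\<close> are already in \<open>MJ(R)\<close>.\<close>
    let ?I = "{r \<in> carrier R. y \<cdot>\<^bsub>M\<^esub> r \<in> ?S}"
    have I: "rsubmodule ?I R (regular_rmod R)"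
      unfolding reg.rsubmodule_iff reg_simps
      using y SD(2-4) by (auto simp: ract_add_right ract_mult)
    have "jacobson R \<subseteq> ?I"
      using ract_jacobson_mem[OF y] JN SU(1) jacobson_closed(1) by blast
    then obtain L i l where L: "rsubmodule L R (regular_rmod R)" "?I \<inter> L = jacobson R"
      and il: "i \<in> ?I" "l \<in> L" "\<one>\<^bsub>R\<^esub> = i \<oplus>\<^bsub>R\<^esub> l"
      using semisimple_quotient_complement[OF R.ring_axioms ss I] by blast
    note LD = reg.rsubmoduleD[OF L(1), unfolded reg_simps]
    let ?z = "y \<cdot>\<^bsub>M\<^esub> l"
    have l: "l \<in> carrier R" using LD(1) il by simp
    have z: "?z \<in> carrier M" using y l by simp
    have "y = y \<cdot>\<^bsub>M\<^esub> i \<oplus>\<^bsub>M\<^esub> ?z"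
      using il l y ract_add_right[of y i l] ract_one[OF y] by simp
    then have zS: "?z \<notin> ?S" using yS il SD(3) by (metis (no_types, lifting) mem_Collect_eq)
    have zr: "?z \<cdot>\<^bsub>M\<^esub> r \<in> ?J" if r: "r \<in> carrier R" "?z \<cdot>\<^bsub>M\<^esub> r \<in> ?S" for r
    proof -
      have eq: "?z \<cdot>\<^bsub>M\<^esub> r = y \<cdot>\<^bsub>M\<^esub> (l \<otimes>\<^bsub>R\<^esub> r)" using y l r by (simp add: ract_mult)
      then have "l \<otimes>\<^bsub>R\<^esub> r \<in> ?I \<inter> L" using r l LD(4) il by simp
      then show ?thesis unfolding L(2) eq using ract_jacobson_mem y by blast
    qed
    let ?C = "{?z \<cdot>\<^bsub>M\<^esub> r |r. r \<in> carrier R}"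
    note C = rsubmodule_cyclic[OF z]
    let ?B = "B <+>\<^bsub>M\<^esub> ?C"
    note B' = rsubmodule_sum[OF B(1) C] and BU = rsubmodule_sum_upper[OF B(1) C]
    have "N \<inter> ?B = ?J"
    proof (intro equalityI subsetI)
      fix x assume x: "x \<in> N \<inter> ?B"
      then obtain b r where br: "b \<in> B" "r \<in> carrier R" "x = b \<oplus>\<^bsub>M\<^esub> ?z \<cdot>\<^bsub>M\<^esub> r"
        by (auto simp: set_add_def')
      have bc: "b \<in> carrier M" using BD(1) br by simp
      have "?z \<cdot>\<^bsub>M\<^esub> r = x \<oplus>\<^bsub>M\<^esub> (\<ominus>\<^bsub>M\<^esub> b)"
        using br bc z M.add_minus_cancel(3)[of b "?z \<cdot>\<^bsub>M\<^esub> r"] by (simp add: a_minus_def)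
      then have "?z \<cdot>\<^bsub>M\<^esub> r \<in> ?S"
        using SD(3)[of x "\<ominus>\<^bsub>M\<^esub> b"] SU x BD(5)[OF br(1)] by (simp add: subset_iff)
      then have "?z \<cdot>\<^bsub>M\<^esub> r \<in> ?J" using zr br by blast
      then have "x \<in> B" using B(2) br BD(3) by blast
      then show "x \<in> ?J" using B(2) x by blast
    next
      fix x assume "x \<in> ?J" then show "x \<in> N \<inter> ?B" using B(2) BU by blast
    qed
    then have "?B = B" using max[OF B'] BU by blast
    then have "?z \<in> B" using BU(2) mem_cyclic[OF z] by blast
    then show False using zS SU(2) by blast
  qed
  then have "?S = carrier M" using SD(1) by blast
  then show ?thesis using B by blast
qed

section \<open>Lifting along a sum of two submodules\<close>

text \<open>
  The lifting problem along \<open>N \<rightarrow> P/B\<close> is solved in the pullback of \<open>N\<close> and \<open>P\<close> over \<open>P/B\<close>, which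
  avoids quotient modules.
\<close>

lemma projective_lift_sum:
  fixes P :: "('r, 'p) rmod"
  assumes P: "projective R P" and N: "rsubmodule N R P" and B: "rsubmodule B R P"
    and sum: "N <+>\<^bsub>P\<^esub> B = carrier P"
  shows "\<exists>l\<in>rmod_hom R P P. \<forall>x\<in>carrier P. l x \<in> N \<and> l x \<ominus>\<^bsub>P\<^esub> x \<in> B"
proof -
  interpret right_module R P using P by (simp add: projective_def)
  note ND = rsubmoduleD[OF N] and BD = rsubmoduleD[OF B]
  define X :: "('r, 'p \<times> 'p) rmod" where "X = \<lparr>
     carrier = {(n, x). n \<in> N \<and> x \<in> carrier P \<and> n \<ominus>\<^bsub>P\<^esub> x \<in> B},
     monoid.mult = (\<lambda>x y. x), one = (\<zero>\<^bsub>P\<^esub>, \<zero>\<^bsub>P\<^esub>), zero = (\<zero>\<^bsub>P\<^esub>, \<zero>\<^bsub>P\<^esub>),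
     add = (\<lambda>x y. (fst x \<oplus>\<^bsub>P\<^esub> fst y, snd x \<oplus>\<^bsub>P\<^esub> snd y)),
     ract = (\<lambda>x r. (fst x \<cdot>\<^bsub>P\<^esub> r, snd x \<cdot>\<^bsub>P\<^esub> r))\<rparr>"
  have carr: "x \<in> carrier X \<longleftrightarrow> fst x \<in> N \<and> snd x \<in> carrier P \<and> fst x \<ominus>\<^bsub>P\<^esub> snd x \<in> B"
    and ops: "\<zero>\<^bsub>X\<^esub> = (\<zero>\<^bsub>P\<^esub>, \<zero>\<^bsub>P\<^esub>)" "x \<oplus>\<^bsub>X\<^esub> y = (fst x \<oplus>\<^bsub>P\<^esub> fst y, snd x \<oplus>\<^bsub>P\<^esub> snd y)"
      "x \<cdot>\<^bsub>X\<^esub> r = (fst x \<cdot>\<^bsub>P\<^esub> r, snd x \<cdot>\<^bsub>P\<^esub> r)" for x y r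
    by (auto simp: X_def case_prod_beta)
  have fst_carr: "fst x \<in> carrier P" if "x \<in> carrier X" for x using that ND(1) by (simp add: carr)
  have add_closed: "x \<oplus>\<^bsub>X\<^esub> y \<in> carrier X" if x: "x \<in> carrier X" and y: "y \<in> carrier X" for x y
  proof -
    have "(fst x \<oplus>\<^bsub>P\<^esub> fst y) \<ominus>\<^bsub>P\<^esub> (snd x \<oplus>\<^bsub>P\<^esub> snd y) = (fst x \<ominus>\<^bsub>P\<^esub> snd x) \<oplus>\<^bsub>P\<^esub> (fst y \<ominus>\<^bsub>P\<^esub> snd y)"
      using x y fst_carr[OF x] fst_carr[OF y] by (simp add: a_minus_def carr M.minus_add M.a_ac)
    then show ?thesis using x y ND(3) BD(3) by (simp add: carr ops)
  qed
  have ract_X: "x \<cdot>\<^bsub>X\<^esub> r \<in> carrier X" if x: "x \<in> carrier X" and r: "r \<in> carrier R" for x r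
  proof -
    have "fst x \<cdot>\<^bsub>P\<^esub> r \<ominus>\<^bsub>P\<^esub> snd x \<cdot>\<^bsub>P\<^esub> r = (fst x \<ominus>\<^bsub>P\<^esub> snd x) \<cdot>\<^bsub>P\<^esub> r"
      using x r fst_carr[OF x] by (simp add: a_minus_def carr ract_add_left ract_uminus)
    then show ?thesis using x r ND(4) BD(4) by (simp add: carr ops)
  qed
  have zero_X: "\<zero>\<^bsub>X\<^esub> \<in> carrier X" using ND(2) BD(2) BD(6)[of "\<zero>\<^bsub>P\<^esub>" "\<zero>\<^bsub>P\<^esub>"] by (simp add: carr ops)
  have "abelian_group X"
  proof (rule abelian_groupI)
    fix x assume x: "x \<in> carrier X"
    have "x \<cdot>\<^bsub>X\<^esub> (\<ominus>\<^bsub>R\<^esub> \<one>\<^bsub>R\<^esub>) \<in> carrier X" using ract_X[OF x] by simp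
    moreover have "x \<cdot>\<^bsub>X\<^esub> (\<ominus>\<^bsub>R\<^esub> \<one>\<^bsub>R\<^esub>) \<oplus>\<^bsub>X\<^esub> x = \<zero>\<^bsub>X\<^esub>"
      using x fst_carr[OF x] by (simp add: ops carr ract_uminus M.l_neg)
    ultimately show "\<exists>y\<in>carrier X. y \<oplus>\<^bsub>X\<^esub> x = \<zero>\<^bsub>X\<^esub>" by blast
  qed (simp_all add: add_closed zero_X, (simp_all add: ops carr M.a_ac ND(1))?)
  then have X: "right_module R X"
    by (intro right_module.intro right_module_axioms.intro R.ring_axioms)
      (simp_all add: ract_X, (simp_all add: ops carr ract_add_left ract_add_right ract_mult ND(1))?)
  have snd: "snd \<in> rmod_hom R X P"
    by (rule rmod_homI) (simp_all add: ops carr)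
  \<comment> \<open>This is where \<open>N + B = P\<close> enters: for \<open>x = n + b\<close> the
    pair \<open>(n, x)\<close> is in the pullback, because \<open>n - x = - b\<close> is in
    \<open>B\<close>.\<close>
  have onto: "snd ` carrier X = carrier P"
  proof (intro equalityI subsetI)
    fix x assume x: "x \<in> carrier P"
    then obtain n b where nb: "n \<in> N" "b \<in> B" "x = n \<oplus>\<^bsub>P\<^esub> b"
      unfolding sum[symmetric] by (auto simp: set_add_def')
    have "n \<ominus>\<^bsub>P\<^esub> x = \<ominus>\<^bsub>P\<^esub> b"
      using nb ND(1) BD(1) by (simp add: M.add_minus_cancel)
    then have "(n, x) \<in> carrier X" using nb x BD(5) by (simp add: carr)
    then show "x \<in> snd ` carrier X" by force
  qed (auto simp: carr)
  have "(\<lambda>x. x) \<in> rmod_hom R P P" by (rule rmod_homI) auto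
  then obtain l where l: "l \<in> rmod_hom R P X" "\<And>x. x \<in> carrier P \<Longrightarrow> snd (l x) = x"
    using projective_lift[OF P X right_module_axioms snd onto] by blast
  have "(\<lambda>x. fst (l x)) \<in> rmod_hom R P P"
    by (rule rmod_homI) (simp_all add: rmod_homD[OF l(1)] fst_carr ops)
  moreover have "fst (l x) \<in> N \<and> fst (l x) \<ominus>\<^bsub>P\<^esub> x \<in> B" if "x \<in> carrier P" for x
    using rmod_homD(1)[OF l(1) that] l(2)[OF that] by (simp add: carr)
  ultimately show ?thesis by (intro bexI[of _ "\<lambda>x. fst (l x)"] ballI)
qed

section \<open>Indecomposable projective modules are local\<close>

context right_module
begin

lemma End_ring_additive:
  assumes "f \<in> carrier (End_ring R M)" "x \<in> carrier M" "y \<in> carrier M"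
  shows "f (x \<ominus>\<^bsub>M\<^esub> y) = f x \<ominus>\<^bsub>M\<^esub> f y" "f (x \<oplus>\<^bsub>M\<^esub> y) = f x \<oplus>\<^bsub>M\<^esub> f y" "f \<zero>\<^bsub>M\<^esub> = \<zero>\<^bsub>M\<^esub>"
  using rmod_hom_uminus(2)[OF right_module_axioms right_module_axioms End_ring_hom[OF assms(1)] assms(2,3)]
    rmod_homD(2)[OF End_ring_hom[OF assms(1)] assms(2,3)]
    rmod_hom_zero[OF right_module_axioms right_module_axioms End_ring_hom[OF assms(1)]]
  by blast+

text \<open>The set is the increasing union of the kernels of the powers of \<open>f\<close>. A sum
  of elements killed by the powers \<open>n\<close> and \<open>m\<close> is killed by the power
  \<open>n + m\<close>.\<close>

lemma nilpotent_part_rsubmodule: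
  assumes f: "f \<in> carrier (End_ring R M)"
  shows "rsubmodule {x \<in> carrier M. \<exists>n::nat. (f [^]\<^bsub>End_ring R M\<^esub> n) x = \<zero>\<^bsub>M\<^esub>} R M"
proof -
  interpret E: ring "End_ring R M" by (rule End_ring_ring) (rule right_module_axioms)
  let ?p = "\<lambda>n::nat. f [^]\<^bsub>End_ring R M\<^esub> n"
  have p: "?p n \<in> carrier (End_ring R M)" for n using f by simp
  have mono: "?p (n + m) x = \<zero>\<^bsub>M\<^esub>" if x: "x \<in> carrier M" and 0: "?p n x = \<zero>\<^bsub>M\<^esub>" for n m x
  proof -
    have "?p (n + m) = ?p m \<otimes>\<^bsub>End_ring R M\<^esub> ?p n"
      using E.nat_pow_mult[OF f, of m n] by (simp add: add.commute)
    then show ?thesis using x 0 End_ring_additive(3)[OF p x x] by simp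
  qed
  show ?thesis unfolding rsubmodule_iff
  proof (intro conjI ballI)
    show "\<zero>\<^bsub>M\<^esub> \<in> {x \<in> carrier M. \<exists>n. ?p n x = \<zero>\<^bsub>M\<^esub>}"
      using End_ring_additive(3)[OF p M.zero_closed M.zero_closed] by simp
  next
    fix x y assume "x \<in> {x \<in> carrier M. \<exists>n. ?p n x = \<zero>\<^bsub>M\<^esub>}" "y \<in> {x \<in> carrier M. \<exists>n. ?p n x = \<zero>\<^bsub>M\<^esub>}"
    then obtain n m where x: "x \<in> carrier M" "?p n x = \<zero>\<^bsub>M\<^esub>" and y: "y \<in> carrier M" "?p m y = \<zero>\<^bsub>M\<^esub>"
      by blast
    have "?p (n + m) (x \<oplus>\<^bsub>M\<^esub> y) = \<zero>\<^bsub>M\<^esub>"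
      using mono[OF x, of m] mono[OF y, of n] x y End_ring_additive(2)[OF p x(1) y(1)]
      by (simp add: add.commute)
    then show "x \<oplus>\<^bsub>M\<^esub> y \<in> {x \<in> carrier M. \<exists>n. ?p n x = \<zero>\<^bsub>M\<^esub>}" using x y by blast
  next
    fix x r assume "x \<in> {x \<in> carrier M. \<exists>n. ?p n x = \<zero>\<^bsub>M\<^esub>}" and r: "r \<in> carrier R"
    then obtain n where x: "x \<in> carrier M" "?p n x = \<zero>\<^bsub>M\<^esub>" by blast
    have "?p n (x \<cdot>\<^bsub>M\<^esub> r) = \<zero>\<^bsub>M\<^esub>" using rmod_homD(3)[OF End_ring_hom[OF p] x(1) r] x(2) r by simp
    then show "x \<cdot>\<^bsub>M\<^esub> r \<in> {x \<in> carrier M. \<exists>n. ?p n x = \<zero>\<^bsub>M\<^esub>}" using x r by blast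
  qed blast
qed

text \<open>A form of Fitting's lemma; it replaces the lifting of idempotents modulo the radical.\<close>

lemma fitting_decomposition:
  assumes f: "f \<in> carrier (End_ring R M)"
    and g: "g = \<one>\<^bsub>End_ring R M\<^esub> \<ominus>\<^bsub>End_ring R M\<^esub> f"
    and nil: "\<And>x. x \<in> carrier M \<Longrightarrow>
      \<exists>n::nat. ((f \<otimes>\<^bsub>End_ring R M\<^esub> g) [^]\<^bsub>End_ring R M\<^esub> n) x = \<zero>\<^bsub>M\<^esub>"
  defines "P0 \<equiv> {x \<in> carrier M. \<exists>n::nat. (f [^]\<^bsub>End_ring R M\<^esub> n) x = \<zero>\<^bsub>M\<^esub>}"
    and "P1 \<equiv> {x \<in> carrier M. \<exists>n::nat. (g [^]\<^bsub>End_ring R M\<^esub> n) x = \<zero>\<^bsub>M\<^esub>}"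
  shows "P0 <+>\<^bsub>M\<^esub> P1 = carrier M" "P0 \<inter> P1 = {\<zero>\<^bsub>M\<^esub>}"
proof -
  interpret E: ring "End_ring R M" by (rule End_ring_ring) (rule right_module_axioms)
  let ?p = "\<lambda>f (n::nat). f [^]\<^bsub>End_ring R M\<^esub> n"
  have gc: "g \<in> carrier (End_ring R M)" using f g by simp
  have pc: "?p f n \<in> carrier (End_ring R M)" "?p g n \<in> carrier (End_ring R M)" for n
    using f gc by simp_all
  have gx: "g x = x \<ominus>\<^bsub>M\<^esub> f x" if "x \<in> carrier M" for x using that f g by simp
  have split: "x = f x \<oplus>\<^bsub>M\<^esub> g x" if "x \<in> carrier M" for x
    using that f by (simp add: gx M.add_minus_cancel)
  have fg: "f \<otimes>\<^bsub>End_ring R M\<^esub> g = g \<otimes>\<^bsub>End_ring R M\<^esub> f"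
    unfolding g using f by (simp add: a_minus_def E.l_distr E.r_distr E.l_minus E.r_minus)
  have Suc_pow: "?p h (Suc n) x = ?p h n (h x)" if "x \<in> carrier M" for h n x
    using that by (simp add: E.nat_pow_Suc)
  have comm: "?p g n (f x) = f (?p g n x)" if "x \<in> carrier M" for n x
  proof -
    have "?p g n \<otimes>\<^bsub>End_ring R M\<^esub> f = f \<otimes>\<^bsub>End_ring R M\<^esub> ?p g n"
      by (rule E.group_commutes_pow[OF fg[symmetric] gc f])
    then show ?thesis using that by (metis End_ring_apply(3))
  qed
  have comm': "?p f n (g x) = g (?p f n x)" if "x \<in> carrier M" for n x
  proof -
    have "?p f n \<otimes>\<^bsub>End_ring R M\<^esub> g = g \<otimes>\<^bsub>End_ring R M\<^esub> ?p f n"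
      by (rule E.group_commutes_pow[OF fg f gc])
    then show ?thesis using that by (metis End_ring_apply(3))
  qed
  have cl: "f x \<in> carrier M" "g x \<in> carrier M" if "x \<in> carrier M" for x using that f gc by simp_all
  have z: "f \<zero>\<^bsub>M\<^esub> = \<zero>\<^bsub>M\<^esub>" "g \<zero>\<^bsub>M\<^esub> = \<zero>\<^bsub>M\<^esub>"
    using End_ring_additive(3)[OF f] End_ring_additive(3)[OF gc] M.zero_closed by blast+
  have P0: "rsubmodule P0 R M" and P1: "rsubmodule P1 R M"
    unfolding P0_def P1_def using nilpotent_part_rsubmodule f gc by blast+
  note S = rsubmodule_sum[OF P0 P1] and SU = rsubmodule_sum_upper[OF P0 P1]
  \<comment> \<open>Induction on \<open>i + j\<close>: in the splitting
    \<open>x = f x + g x\<close>, the part \<open>f x\<close> needs one factor \<open>f\<close> less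
    and \<open>g x\<close> one factor \<open>g\<close> less. When either exponent is 0,
    \<open>x\<close> itself lies in \<open>P1\<close> or \<open>P0\<close>.\<close>
  have in_sum: "x \<in> P0 <+>\<^bsub>M\<^esub> P1"
    if "x \<in> carrier M" "?p f i (?p g j x) = \<zero>\<^bsub>M\<^esub>" "i + j = k" for i j k x
    using that
  proof (induction k arbitrary: i j x)
    case 0
    then have "x = \<zero>\<^bsub>M\<^esub>" by simp
    then have "x \<in> P0" using rsubmoduleD(2)[OF P0] by simp
    then show ?case using SU by blast
  next
    case (Suc k)
    show ?case
    proof (cases i)
      case 0
      have "\<one>\<^bsub>End_ring R M\<^esub> (?p g j x) = \<zero>\<^bsub>M\<^esub>" using Suc.prems(2) 0 by (simp only: E.nat_pow_0)
      then have "?p g j x = \<zero>\<^bsub>M\<^esub>" by (simp only: End_ring_apply(1)[OF End_ring_closed[OF pc(2) Suc.prems(1)]])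
      then have "x \<in> P1" using Suc.prems(1) unfolding P1_def by blast
      then show ?thesis using SU by blast
    next
      case i: (Suc i')
      show ?thesis
      proof (cases j)
        case 0
        have "?p f i x = \<zero>\<^bsub>M\<^esub>" using Suc.prems(1,2) 0 by simp
        then have "x \<in> P0" using Suc.prems(1) unfolding P0_def by blast
        then show ?thesis using SU by blast
      next
        case j: (Suc j')
        have "f x \<in> P0 <+>\<^bsub>M\<^esub> P1"
        proof (rule Suc.IH)
          show "?p f i' (?p g j (f x)) = \<zero>\<^bsub>M\<^esub>"
            using Suc.prems i comm[of x j] Suc_pow[of "?p g j x" f i'] pc(2)[of j] by simp
        qed (use Suc.prems cl i in auto)
        moreover have "g x \<in> P0 <+>\<^bsub>M\<^esub> P1"
        proof (rule Suc.IH)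
          show "?p f i (?p g j' (g x)) = \<zero>\<^bsub>M\<^esub>"
            using Suc.prems j Suc_pow[of x g j'] by simp
        qed (use Suc.prems cl j in auto)
        ultimately show ?thesis using split Suc.prems(1) rsubmoduleD(3)[OF S] by metis
      qed
    qed
  qed
  have "x \<in> P0 <+>\<^bsub>M\<^esub> P1" if x: "x \<in> carrier M" for x
  proof -
    obtain n where "?p (f \<otimes>\<^bsub>End_ring R M\<^esub> g) n x = \<zero>\<^bsub>M\<^esub>" using nil x by blast
    \<comment> \<open>As \<open>f\<close> and \<open>g\<close> commute, the power of the product
      splits into a power of \<open>f\<close> and a power of \<open>g\<close>.\<close>
    then have "?p f n (?p g n x) = \<zero>\<^bsub>M\<^esub>"
      using x E.pow_mult_distrib[OF fg f gc, of n] by simp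
    then show ?thesis using in_sum x by blast
  qed
  then show "P0 <+>\<^bsub>M\<^esub> P1 = carrier M" using rsubmoduleD(1)[OF S] by blast
  \<comment> \<open>The same induction shows that \<open>f x\<close> and \<open>g x\<close> both
    vanish, and \<open>x\<close> is their sum.\<close>
  have triv: "x = \<zero>\<^bsub>M\<^esub>" if "x \<in> carrier M" "?p f i x = \<zero>\<^bsub>M\<^esub>" "?p g j x = \<zero>\<^bsub>M\<^esub>" "i + j = k" for i j k x
    using that
  proof (induction k arbitrary: i j x)
    case 0 then show ?case by simp
  next
    case (Suc k)
    show ?case
    proof (cases "i = 0 \<or> j = 0")
      case True then show ?thesis using Suc.prems by auto
    next
      case False
      then obtain i' j' where ij: "i = Suc i'" "j = Suc j'" by (metis not0_implies_Suc)
      have "f x = \<zero>\<^bsub>M\<^esub>"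
        by (rule Suc.IH[of "f x" i' j]) (use Suc.prems cl ij comm[of x j] Suc_pow[of x f i'] z in auto)
      moreover have "g x = \<zero>\<^bsub>M\<^esub>"
        by (rule Suc.IH[of "g x" i j']) (use Suc.prems cl ij comm'[of x i] Suc_pow[of x g j'] z in auto)
      ultimately show ?thesis using split[OF Suc.prems(1)] by simp
    qed
  qed
  show "P0 \<inter> P1 = {\<zero>\<^bsub>M\<^esub>}"
    using triv rsubmoduleD(2)[OF P0] rsubmoduleD(2)[OF P1] unfolding P0_def P1_def by blast
qed

lemma End_ring_pow_apply:
  fixes n :: nat
  assumes "f \<in> carrier (End_ring R M)" "x \<in> carrier M"
  shows "(f [^]\<^bsub>End_ring R M\<^esub> n) x = (f ^^ n) x"
  using assms
proof (induction n arbitrary: x)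
  case (Suc n)
  then show ?case by (simp add: funpow_swap1)
qed simp

lemma right_perfect_D:
  assumes "right_perfect R"
  shows "semisimple_ring (R Quot jacobson R)" "right_T_nilpotent R (jacobson R)"
  using assms by (auto simp: right_perfect_def)

text \<open>So \<open>MJ(R)\<close> contains every proper submodule. With
  \<open>N = yR + MJ(R)\<close> and a complement \<open>B\<close> modulo \<open>MJ(R)\<close>,
  projectivity yields an endomorphism \<open>f\<close> that is, modulo \<open>MJ(R)\<close>, the
  projection onto \<open>N\<close> along \<open>B\<close>. Then \<open>f (1 - f)\<close> is locally
  nilpotent, and the Fitting decomposition leaves only two possibilities for an indecomposable
  \<open>M\<close>.\<close>

lemma indecomposable_projective_local:
  assumes perf: "right_perfect R" and proj: "projective R M" and ind: "indecomposable R M"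
    and y: "y \<in> carrier M" "y \<notin> times_jacobson R M"
  shows "{y \<cdot>\<^bsub>M\<^esub> r |r. r \<in> carrier R} = carrier M"
proof -
  interpret E: ring "End_ring R M" by (rule End_ring_ring) (rule right_module_axioms)
  let ?J = "times_jacobson R M" and ?C = "{y \<cdot>\<^bsub>M\<^esub> r |r. r \<in> carrier R}"
  note Js = times_jacobson_rsubmodule and C = rsubmodule_cyclic[OF y(1)]
  let ?N = "?C <+>\<^bsub>M\<^esub> ?J"
  note N = rsubmodule_sum[OF C Js] and NU = rsubmodule_sum_upper[OF C Js]
  obtain B where B: "rsubmodule B R M" "?N \<inter> B = ?J" "?N <+>\<^bsub>M\<^esub> B = carrier M"
    using complement_mod_radical[OF right_perfect_D(1)[OF perf] N NU(2)] by blast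
  obtain l where l: "l \<in> rmod_hom R M M" "\<And>x. x \<in> carrier M \<Longrightarrow> l x \<in> ?N \<and> l x \<ominus>\<^bsub>M\<^esub> x \<in> B"
    using projective_lift_sum[OF proj N B(1,3)] by blast
  define f where "f = restrict l (carrier M)"
  define g where "g = \<one>\<^bsub>End_ring R M\<^esub> \<ominus>\<^bsub>End_ring R M\<^esub> f"
  have f: "f \<in> carrier (End_ring R M)"
    unfolding f_def by (rule restrict_in_End_ring[OF right_module_axioms l(1)])
  have fN: "f x \<in> ?N" and fB: "f x \<ominus>\<^bsub>M\<^esub> x \<in> B" if "x \<in> carrier M" for x
    using l(2)[OF that] that by (simp_all add: f_def)
  have g: "g \<in> carrier (End_ring R M)" using f by (simp add: g_def)
  have gx: "g x = x \<ominus>\<^bsub>M\<^esub> f x" if "x \<in> carrier M" for x using that f by (simp add: g_def)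
  have fJ: "f x \<in> ?J" if "x \<in> ?J" for x
    using rmod_hom_times_jacobson[OF right_module_axioms right_module_axioms End_ring_hom[OF f] that] .
  \<comment> \<open>For \<open>x\<close> in \<open>N\<close> the difference \<open>f x - x\<close>
    lies in \<open>N\<close> as well as in \<open>B\<close>, and their intersection is
    \<open>MJ(R)\<close>.\<close>
  have id_mod_J: "f x \<ominus>\<^bsub>M\<^esub> x \<in> ?J" if x: "x \<in> ?N" for x
  proof -
    have "x \<in> carrier M" using x rsubmoduleD(1)[OF N] by simp
    then show ?thesis using x fN fB rsubmoduleD(6)[OF N] B(2) by blast
  qed
  have fg: "(f \<otimes>\<^bsub>End_ring R M\<^esub> g) x \<in> ?J" if x: "x \<in> carrier M" for x
  proof -
    have "(f \<otimes>\<^bsub>End_ring R M\<^esub> g) x = f x \<ominus>\<^bsub>M\<^esub> f (f x)"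
      using x f by (simp add: gx End_ring_additive)
    also have "\<dots> = \<ominus>\<^bsub>M\<^esub> (f (f x) \<ominus>\<^bsub>M\<^esub> f x)"
      using x f by (simp add: a_minus_def M.minus_add M.a_comm)
    finally show ?thesis using id_mod_J[OF fN[OF x]] rsubmoduleD(5)[OF Js] by simp
  qed
  have nil: "\<exists>n::nat. ((f \<otimes>\<^bsub>End_ring R M\<^esub> g) [^]\<^bsub>End_ring R M\<^esub> n) x = \<zero>\<^bsub>M\<^esub>" if x: "x \<in> carrier M" for x
    using locally_nilpotent[OF right_perfect_D(2)[OF perf] _ fg x] f g x by (simp add: End_ring_pow_apply)
  let ?P0 = "{x \<in> carrier M. \<exists>n::nat. (f [^]\<^bsub>End_ring R M\<^esub> n) x = \<zero>\<^bsub>M\<^esub>}"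
  let ?P1 = "{x \<in> carrier M. \<exists>n::nat. (g [^]\<^bsub>End_ring R M\<^esub> n) x = \<zero>\<^bsub>M\<^esub>}"
  have sum: "?P0 <+>\<^bsub>M\<^esub> ?P1 = carrier M" "?P0 \<inter> ?P1 = {\<zero>\<^bsub>M\<^esub>}"
    using fitting_decomposition[OF f g_def nil] by blast+
  note P0 = nilpotent_part_rsubmodule[OF f] and P1 = nilpotent_part_rsubmodule[OF g]
  have "?P0 = {\<zero>\<^bsub>M\<^esub>} \<or> ?P1 = {\<zero>\<^bsub>M\<^esub>}"
    using ind P0 P1 sum unfolding indecomposable_def by blast
  \<comment> \<open>Here some power of \<open>f\<close> kills \<open>y\<close>. But \<open>f\<close>
    fixes elements of \<open>N\<close> modulo \<open>MJ(R)\<close>, so every power sends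
    \<open>y\<close> to \<open>y\<close> modulo \<open>MJ(R)\<close>, and \<open>y\<close> would lie
    in \<open>MJ(R)\<close>.\<close>
  moreover have False if P1_0: "?P1 = {\<zero>\<^bsub>M\<^esub>}"
  proof -
    have "y \<in> ?P0"
    proof -
      have "y \<in> ?P0 <+>\<^bsub>M\<^esub> ?P1" using sum(1) y(1) by simp
      then obtain a where "a \<in> ?P0" "y = a \<oplus>\<^bsub>M\<^esub> \<zero>\<^bsub>M\<^esub>" unfolding P1_0 by (auto simp: set_add_def')
      then show ?thesis by simp
    qed
    then obtain n where n: "(f ^^ n) y = \<zero>\<^bsub>M\<^esub>" using f by (auto simp: End_ring_pow_apply)
    have yN: "y \<in> ?N" using mem_cyclic[OF y(1)] NU by blast
    have "(f ^^ k) y \<in> ?N \<and> (f ^^ k) y \<ominus>\<^bsub>M\<^esub> y \<in> ?J" for k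
    proof (induction k)
      case 0
      then show ?case using yN y(1) rsubmoduleD(2)[OF Js] by (simp add: a_minus_def M.r_neg)
    next
      case (Suc k)
      let ?w = "(f ^^ k) y"
      have w: "?w \<in> ?N" "?w \<in> carrier M" "?w \<ominus>\<^bsub>M\<^esub> y \<in> ?J" using Suc rsubmoduleD(1)[OF N] by auto
      have "f ?w \<ominus>\<^bsub>M\<^esub> y = (f ?w \<ominus>\<^bsub>M\<^esub> ?w) \<oplus>\<^bsub>M\<^esub> (?w \<ominus>\<^bsub>M\<^esub> y)"
        using w y(1) End_ring_closed[OF f w(2)] by (simp add: a_minus_def M.a_assoc M.r_neg1)
      then show ?case using id_mod_J[OF w(1)] w fN rsubmoduleD(3)[OF Js] by simp
    qed
    from this[of n] have "\<ominus>\<^bsub>M\<^esub> y \<in> ?J" using n y(1) by (simp add: a_minus_def)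
    then have "y \<in> ?J" using rsubmoduleD(5)[OF Js] y(1) M.minus_minus by metis
    then show False using y(2) by simp
  qed
  \<comment> \<open>Here some power of \<open>g = 1 - f\<close> kills \<open>x\<close>. Each
    application of \<open>g\<close> changes an element by a member of \<open>N\<close>, so
    \<open>x\<close> is in \<open>N = yR + MJ(R)\<close>, and Nakayama's lemma removes
    \<open>MJ(R)\<close>.\<close>
  moreover have "?C = carrier M" if P0_0: "?P0 = {\<zero>\<^bsub>M\<^esub>}"
  proof (rule nakayama[OF right_perfect_D(2)[OF perf] C])
    fix x assume x: "x \<in> carrier M"
    have "x \<in> ?P0 <+>\<^bsub>M\<^esub> ?P1" using sum(1) x by simp
    then obtain a where "a \<in> ?P1" "x = \<zero>\<^bsub>M\<^esub> \<oplus>\<^bsub>M\<^esub> a" unfolding P0_0 by (auto simp: set_add_def')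
    then have "x \<in> ?P1" by simp
    then obtain n where n: "(g ^^ n) x = \<zero>\<^bsub>M\<^esub>" using g by (auto simp: End_ring_pow_apply)
    have "(g ^^ k) x \<in> carrier M \<and> x \<ominus>\<^bsub>M\<^esub> (g ^^ k) x \<in> ?N" for k
    proof (induction k)
      case 0
      then show ?case using x rsubmoduleD(2)[OF N] by (simp add: a_minus_def M.r_neg)
    next
      case (Suc k)
      let ?w = "(g ^^ k) x"
      have w: "?w \<in> carrier M" "x \<ominus>\<^bsub>M\<^esub> ?w \<in> ?N" using Suc by auto
      have "x \<ominus>\<^bsub>M\<^esub> g ?w = (x \<ominus>\<^bsub>M\<^esub> ?w) \<oplus>\<^bsub>M\<^esub> f ?w"
        using w x End_ring_closed[OF f w(1)] by (simp add: gx a_minus_def M.minus_add M.a_assoc)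
      then show ?case using w fN rsubmoduleD(3)[OF N] g by simp
    qed
    from this[of n] have "x \<in> ?N" using n x M.add_minus_cancel(2)[of "\<zero>\<^bsub>M\<^esub>" x] by simp
    then show "\<exists>n\<in>?C. \<exists>y\<in>?J. x = n \<oplus>\<^bsub>M\<^esub> y" by (auto simp: set_add_def')
  qed
  ultimately show ?thesis by blast
qed

end

section \<open>Rings whose radical quotient has two elements\<close>

text \<open>A right ideal strictly above \<open>I\<close> contains some \<open>x\<close> together
  with \<open>1 - x\<close>, so \<open>I\<close> is maximal. It lies in every maximal right ideal
  \<open>N\<close>, since otherwise \<open>1 = n + i\<close> would make \<open>n = 1 - i\<close> a
  unit in \<open>N\<close>. Hence \<open>I\<close> is the radical, and membership in
  \<open>I\<close> decides the residue.\<close>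

lemma two_element_quotient:
  assumes E: "ring E" and I: "ideal I E" and one: "\<one>\<^bsub>E\<^esub> \<notin> I"
    and two: "\<And>x. x \<in> carrier E \<Longrightarrow> x \<in> I \<or> \<one>\<^bsub>E\<^esub> \<ominus>\<^bsub>E\<^esub> x \<in> I"
    and unit: "\<And>x. x \<in> I \<Longrightarrow> \<one>\<^bsub>E\<^esub> \<ominus>\<^bsub>E\<^esub> x \<in> Units E"
  shows "E Quot jacobson E \<simeq> residue_ring 2"
proof -
  interpret ring E by fact
  interpret I: ideal I E by fact
  interpret reg: right_module E "regular_rmod E" by (rule regular_rmod_module) fact
  have reg_simps: "carrier (regular_rmod E) = carrier E" "x \<cdot>\<^bsub>regular_rmod E\<^esub> y = x \<otimes>\<^bsub>E\<^esub> y"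
    "x \<oplus>\<^bsub>regular_rmod E\<^esub> y = x \<oplus>\<^bsub>E\<^esub> y" "\<zero>\<^bsub>regular_rmod E\<^esub> = \<zero>\<^bsub>E\<^esub>" for x y
    by (simp_all add: regular_rmod_def)
  have Is: "rsubmodule I E (regular_rmod E)"
    unfolding reg.rsubmodule_iff reg_simps using I.a_subset I.zero_closed I.a_closed I.I_r_closed by blast
  have whole: "N = carrier E" if N: "rsubmodule N E (regular_rmod E)" and u: "u \<in> N" "u \<in> Units E" for N u
  proof -
    note ND = reg.rsubmoduleD[OF N, unfolded reg_simps]
    have "u \<otimes>\<^bsub>E\<^esub> inv\<^bsub>E\<^esub> u \<in> N" by (rule ND(4)[OF u(1) Units_inv_closed[OF u(2)]])
    then have "\<one>\<^bsub>E\<^esub> \<in> N" using u(2) by simp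
    then have "x \<in> N" if "x \<in> carrier E" for x using ND(4)[of "\<one>\<^bsub>E\<^esub>" x] that by simp
    then show ?thesis using ND(1) by blast
  qed
  have max: "maximal_rsubmodule I E (regular_rmod E)"
    unfolding maximal_rsubmodule_def reg_simps
  proof (intro conjI allI impI Is)
    show "I \<noteq> carrier E" using one by blast
    fix L assume L: "rsubmodule L E (regular_rmod E) \<and> I \<subseteq> L"
    note LD = reg.rsubmoduleD[OF conjunct1[OF L], unfolded reg_simps]
    show "L = I \<or> L = carrier E"
    proof (rule disjCI)
      assume "L \<noteq> carrier E"
      have "x \<in> I" if x: "x \<in> L" for x
      proof (rule ccontr)
        assume "x \<notin> I"
        then have "\<one>\<^bsub>E\<^esub> \<ominus>\<^bsub>E\<^esub> x \<in> L" using two[of x] LD(1)[OF x] L by blast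
        then have "x \<oplus>\<^bsub>E\<^esub> (\<one>\<^bsub>E\<^esub> \<ominus>\<^bsub>E\<^esub> x) \<in> L" using x LD(3) by blast
        then have "\<one>\<^bsub>E\<^esub> \<in> L" using LD(1)[OF x] by (simp add: add_minus_cancel)
        then show False using whole[of L "\<one>\<^bsub>E\<^esub>"] L \<open>L \<noteq> carrier E\<close> by simp
      qed
      then show "L = I" using L by blast
    qed
  qed
  have "I \<subseteq> N" if N: "maximal_rsubmodule N E (regular_rmod E)" for N
  proof
    fix x assume x: "x \<in> I"
    have Ns: "rsubmodule N E (regular_rmod E)" and N1: "N \<noteq> carrier E"
      using N by (auto simp: maximal_rsubmodule_def reg_simps)
    note S = reg.rsubmodule_sum[OF Ns Is] and U = reg.rsubmodule_sum_upper[OF Ns Is]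
    show "x \<in> N"
    proof (rule ccontr)
      assume "x \<notin> N"
      then have "N <+>\<^bsub>regular_rmod E\<^esub> I = carrier E"
        using N S U x unfolding maximal_rsubmodule_def reg_simps by blast
      then have "\<one>\<^bsub>E\<^esub> \<in> N <+>\<^bsub>regular_rmod E\<^esub> I" by simp
      then obtain n i where ni: "n \<in> N" "i \<in> I" "\<one>\<^bsub>E\<^esub> = n \<oplus>\<^bsub>E\<^esub> i" by (auto simp: set_add_def' reg_simps)
      have "n \<in> carrier E" using reg.rsubmoduleD(1)[OF Ns ni(1)] by (simp add: reg_simps)
      then have "\<one>\<^bsub>E\<^esub> \<ominus>\<^bsub>E\<^esub> i = n" using ni by (simp add: add_minus_cancel)
      then show False using whole[OF Ns ni(1)] unit[OF ni(2)] N1 by simp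
    qed
  qed
  then have jac: "jacobson E = I"
    unfolding jacobson_def using max I.a_subset by blast
  interpret Z: residues 2 "residue_ring 2" by unfold_locales simp
  have sub1: "x \<ominus>\<^bsub>E\<^esub> \<one>\<^bsub>E\<^esub> \<in> I" if x: "x \<in> carrier E" "x \<notin> I" for x
  proof -
    have "\<ominus>\<^bsub>E\<^esub> (\<one>\<^bsub>E\<^esub> \<ominus>\<^bsub>E\<^esub> x) \<in> I" using two[OF x(1)] x(2) I.a_inv_closed by blast
    then show ?thesis using x by (simp add: a_minus_def minus_add a_comm)
  qed
  define h :: "_ \<Rightarrow> int" where "h x = (if x \<in> I then 0 else 1)" for x
  have zero_h: "x \<in> I \<longleftrightarrow> h x = 0" for x by (simp add: h_def)
  have hh: "ring_hom_ring E (residue_ring 2) h"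
  proof (rule ring_hom_ringI2[OF E Z.ring_axioms], rule ring_hom_memI)
    fix x y assume x: "x \<in> carrier E" and y: "y \<in> carrier E"
    show "h x \<in> carrier (residue_ring 2)" by (simp add: h_def Z.res_carrier_eq)
    have xy: "x \<in> I" if "x \<oplus>\<^bsub>E\<^esub> y \<in> I" "y \<in> I" "x \<in> carrier E" "y \<in> carrier E" for x y
    proof -
      have "(x \<oplus>\<^bsub>E\<^esub> y) \<ominus>\<^bsub>E\<^esub> y \<in> I" using that I.a_closed I.a_inv_closed by (simp add: a_minus_def)
      then show ?thesis using that by (simp add: add_minus_cancel)
    qed
    \<comment> \<open>Otherwise \<open>x + (y - 1) = (x + y) - 1\<close> is in \<open>I\<close>. As
      \<open>y - 1\<close> is in \<open>I\<close>, this would put \<open>x\<close> into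
      \<open>I\<close>.\<close>
    have both: "x \<oplus>\<^bsub>E\<^esub> y \<in> I" if "x \<notin> I" "y \<notin> I"
    proof (rule ccontr)
      assume "x \<oplus>\<^bsub>E\<^esub> y \<notin> I"
      then have "(x \<oplus>\<^bsub>E\<^esub> y) \<ominus>\<^bsub>E\<^esub> \<one>\<^bsub>E\<^esub> \<in> I" using sub1 x y by simp
      moreover have "(x \<oplus>\<^bsub>E\<^esub> y) \<ominus>\<^bsub>E\<^esub> \<one>\<^bsub>E\<^esub> = x \<oplus>\<^bsub>E\<^esub> (y \<ominus>\<^bsub>E\<^esub> \<one>\<^bsub>E\<^esub>)" using x y by (simp add: a_minus_def a_assoc)
      ultimately have "x \<in> I" using xy[of x "y \<ominus>\<^bsub>E\<^esub> \<one>\<^bsub>E\<^esub>"] sub1[OF y that(2)] x y by simp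
      then show False using that by simp
    qed
    have "x \<oplus>\<^bsub>E\<^esub> y \<in> I \<longleftrightarrow> (x \<in> I \<longleftrightarrow> y \<in> I)"
      using both xy[of x y] xy[of y x] x y I.a_closed[of x y] a_comm[OF x y] by metis
    then show "h (x \<oplus>\<^bsub>E\<^esub> y) = h x \<oplus>\<^bsub>residue_ring 2\<^esub> h y"
      unfolding Z.res_add_eq h_def by simp
    \<comment> \<open>An \<open>x\<close> outside \<open>I\<close> acts as 1 modulo
      \<open>I\<close>: \<open>x y = y + (x - 1) y\<close>.\<close>
    have "y \<in> I" if "x \<otimes>\<^bsub>E\<^esub> y \<in> I" "x \<notin> I"
    proof -
      have "(x \<ominus>\<^bsub>E\<^esub> \<one>\<^bsub>E\<^esub>) \<otimes>\<^bsub>E\<^esub> y \<in> I" using sub1[OF x that(2)] y I.I_r_closed by simp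
      moreover have "x \<otimes>\<^bsub>E\<^esub> y = y \<oplus>\<^bsub>E\<^esub> (x \<ominus>\<^bsub>E\<^esub> \<one>\<^bsub>E\<^esub>) \<otimes>\<^bsub>E\<^esub> y"
        using x y by (simp add: a_minus_def l_distr l_minus a_ac r_neg2 r_neg1 r_neg)
      ultimately show ?thesis using xy[of y "(x \<ominus>\<^bsub>E\<^esub> \<one>\<^bsub>E\<^esub>) \<otimes>\<^bsub>E\<^esub> y"] that x y by simp
    qed
    then show "h (x \<otimes>\<^bsub>E\<^esub> y) = h x \<otimes>\<^bsub>residue_ring 2\<^esub> h y"
      unfolding Z.res_mult_eq h_def using I.I_l_closed[of y x] I.I_r_closed[of x y] x y by auto
  next
    show "h \<one>\<^bsub>E\<^esub> = \<one>\<^bsub>residue_ring 2\<^esub>" using one by (simp add: h_def Z.res_one_eq)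
  qed
  interpret h: ring_hom_ring E "residue_ring 2" h by (rule hh)
  have "h ` carrier E = carrier (residue_ring 2)"
  proof -
    have "h \<zero>\<^bsub>E\<^esub> = 0" "h \<one>\<^bsub>E\<^esub> = 1" using one by (simp_all add: h_def)
    then have "{0, 1} \<subseteq> h ` carrier E" by (metis empty_subsetI image_eqI insert_subset one_closed zero_closed)
    moreover have "carrier (residue_ring 2) = {0, 1}" by (auto simp: Z.res_carrier_eq)
    moreover have "h ` carrier E \<subseteq> {0, 1}" by (auto simp: h_def)
    ultimately show ?thesis by (metis subset_antisym)
  qed
  moreover have "a_kernel E (residue_ring 2) h = I"
    unfolding a_kernel_def' using I.a_subset by (auto simp: zero_h[symmetric] Z.res_zero_eq)
  ultimately show ?thesis using h.FactRing_iso jac by simp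
qed

section \<open>Primitive idempotents\<close>

definition ring_idempotent :: "('a, 'b) ring_scheme \<Rightarrow> 'a \<Rightarrow> bool" where
  "ring_idempotent E e \<longleftrightarrow> e \<in> carrier E \<and> e \<otimes>\<^bsub>E\<^esub> e = e"

definition primitive_idempotent :: "('a, 'b) ring_scheme \<Rightarrow> 'a \<Rightarrow> bool" where
  "primitive_idempotent E e \<longleftrightarrow> ring_idempotent E e \<and> e \<noteq> \<zero>\<^bsub>E\<^esub> \<and>
     (\<forall>d. ring_idempotent E d \<and> d \<otimes>\<^bsub>E\<^esub> e = d \<and> e \<otimes>\<^bsub>E\<^esub> d = d \<longrightarrow> d = \<zero>\<^bsub>E\<^esub> \<or> d = e)"

text \<open>The strict order on idempotents: \<open>d\<close> is below \<open>e\<close> if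
  \<open>e\<close> is the orthogonal sum of \<open>d\<close> and \<open>e - d\<close>. As a set of
  pairs it serves \<open>wf\<close> both for minimal elements and for induction.\<close>

definition idempotent_less :: "('a, 'b) ring_scheme \<Rightarrow> ('a \<times> 'a) set" where
  "idempotent_less E = {(d, e). ring_idempotent E d \<and> ring_idempotent E e \<and>
     d \<otimes>\<^bsub>E\<^esub> e = d \<and> e \<otimes>\<^bsub>E\<^esub> d = d \<and> d \<noteq> e}"

context ring
begin

lemma idempotent_diff:
  assumes "ring_idempotent R d" "ring_idempotent R e" "d \<otimes> e = d" "e \<otimes> d = d"
  shows "ring_idempotent R (e \<ominus> d)" "(e \<ominus> d) \<otimes> d = \<zero>" "d \<otimes> (e \<ominus> d) = \<zero>"
    "(e \<ominus> d) \<otimes> e = e \<ominus> d" "e \<otimes> (e \<ominus> d) = e \<ominus> d"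
  using assms by (simp_all add: ring_idempotent_def a_minus_def l_distr r_distr l_minus r_minus r_neg
      minus_add a_assoc)

text \<open>The successive differences along a strictly descending chain of idempotents are nonzero,
  idempotent and pairwise orthogonal.\<close>

lemma wf_idempotent_less:
  assumes no: "\<And>d :: nat \<Rightarrow> 'a. (\<And>i. ring_idempotent R (d i) \<and> d i \<noteq> \<zero>) \<Longrightarrow>
    (\<And>i j. i \<noteq> j \<Longrightarrow> d i \<otimes> d j = \<zero>) \<Longrightarrow> False"
  shows "wf (idempotent_less R)"
  unfolding wf_iff_no_infinite_down_chain
proof
  assume "\<exists>f. \<forall>i. (f (Suc i), f i) \<in> idempotent_less R"
  then obtain e where e: "\<And>i. (e (Suc i), e i) \<in> idempotent_less R" by blast
  have idem: "ring_idempotent R (e i)" for i using e[of i] by (simp add: idempotent_less_def)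
  have ec: "e i \<in> carrier R" "e i \<otimes> e i = e i" for i using idem[of i] by (simp_all add: ring_idempotent_def)
  have suc: "e (Suc i) \<otimes> e i = e (Suc i)" "e i \<otimes> e (Suc i) = e (Suc i)" "e (Suc i) \<noteq> e i" for i
    using e[of i] by (simp_all add: idempotent_less_def)
  have le: "e j \<otimes> e i = e j \<and> e i \<otimes> e j = e j" if "i \<le> j" for i j
    using that
  proof (induction j rule: dec_induct)
    case base then show ?case using ec by simp
  next
    case (step j)
    have "e (Suc j) \<otimes> e i = e (Suc j) \<otimes> (e j \<otimes> e i)" using suc(1)[of j] ec by (simp add: m_assoc[symmetric])
    moreover have "e i \<otimes> e (Suc j) = (e i \<otimes> e j) \<otimes> e (Suc j)" using suc(2)[of j] ec by (simp add: m_assoc)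
    ultimately show ?case using step suc by simp
  qed
  define d where "d i = e i \<ominus> e (Suc i)" for i
  have dc: "d i \<in> carrier R" for i using ec by (simp add: d_def)
  note D = idempotent_diff[OF idem idem suc(1) suc(2), folded d_def]
  \<comment> \<open>For \<open>i < j\<close> the idempotent \<open>d j\<close> is absorbed by
    \<open>e (Suc i)\<close> on both sides, and \<open>e (Suc i)\<close> annihilates
    \<open>d i\<close>.\<close>
  have lt: "d i \<otimes> d j = \<zero> \<and> d j \<otimes> d i = \<zero>" if "i < j" for i j
  proof -
    have sj: "e (Suc i) \<otimes> d j = d j" "d j \<otimes> e (Suc i) = d j"
    proof -
      have "e (Suc i) \<otimes> d j = e (Suc i) \<otimes> (e j \<otimes> d j)" using D(5)[of j] by simp
      also have "\<dots> = d j" using le[of "Suc i" j] that D(5)[of j]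
          m_assoc[OF ec(1)[of "Suc i"] ec(1)[of j] dc[of j]] by simp
      finally show "e (Suc i) \<otimes> d j = d j" .
      have "d j \<otimes> e (Suc i) = (d j \<otimes> e j) \<otimes> e (Suc i)" using D(4)[of j] by simp
      also have "\<dots> = d j" using le[of "Suc i" j] that D(4)[of j]
          m_assoc[OF dc[of j] ec(1)[of j] ec(1)[of "Suc i"]] by simp
      finally show "d j \<otimes> e (Suc i) = d j" .
    qed
    have "d i \<otimes> d j = (d i \<otimes> e (Suc i)) \<otimes> d j" using sj m_assoc[OF dc[of i] ec(1)[of "Suc i"] dc[of j]] by simp
    moreover have "d j \<otimes> d i = d j \<otimes> (e (Suc i) \<otimes> d i)" using sj m_assoc[OF dc[of j] ec(1)[of "Suc i"] dc[of i]] by simp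
    ultimately show ?thesis using D(2,3)[of i] dc by simp
  qed
  show False
  proof (rule no[of d])
    show "ring_idempotent R (d i) \<and> d i \<noteq> \<zero>" for i
      using D(1) suc(3)[of i] ec by (auto simp: d_def minus_eq_zero_iff)
    show "d i \<otimes> d j = \<zero>" if "i \<noteq> j" for i j
      using lt[of i j] lt[of j i] that by (cases "i < j") auto
  qed
qed

text \<open>Well-foundedness is used twice. A minimal nonzero idempotent \<open>z\<close> below
  \<open>e\<close> is primitive, and the induction hypothesis applies to \<open>e - z\<close>, which
  is strictly below \<open>e\<close>.\<close>

lemma primitive_decomposition:
  assumes wf: "wf (idempotent_less R)" and e: "ring_idempotent R e"
  shows "\<exists>(n::nat) p. (\<forall>i\<in>{1..n}. primitive_idempotent R (p i) \<and> e \<otimes> p i = p i \<and> p i \<otimes> e = p i) \<and>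
    (\<forall>i\<in>{1..n}. \<forall>j\<in>{1..n}. i \<noteq> j \<longrightarrow> p i \<otimes> p j = \<zero>) \<and> (\<Oplus>i\<in>{1..n}. p i) = e"
  using wf e
proof (induction e rule: wf_induct_rule)
  case (less e)
  have ec: "e \<in> carrier R" "e \<otimes> e = e" using less.prems by (simp_all add: ring_idempotent_def)
  show ?case
  proof (cases "e = \<zero>")
    case True
    then show ?thesis by (intro exI[of _ 0]) simp
  next
    case False
    let ?Q = "{d. ring_idempotent R d \<and> d \<noteq> \<zero> \<and> d \<otimes> e = d \<and> e \<otimes> d = d}"
    have "e \<in> ?Q" using False less.prems ec by simp
    then obtain z where z: "z \<in> ?Q" and min: "\<And>d. (d, z) \<in> idempotent_less R \<Longrightarrow> d \<notin> ?Q"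
      by (rule wfE_min[OF wf]) blast
    have zc: "z \<in> carrier R" "z \<otimes> z = z" using z by (simp_all add: ring_idempotent_def)
    have prim: "primitive_idempotent R z"
      unfolding primitive_idempotent_def
    proof (intro conjI allI impI)
      fix d assume d: "ring_idempotent R d \<and> d \<otimes> z = d \<and> z \<otimes> d = d"
      then have dc: "d \<in> carrier R" by (simp add: ring_idempotent_def)
      have "d \<otimes> e = d" using m_assoc[OF dc zc(1) ec(1)] d z by simp
      moreover have "e \<otimes> d = d" using m_assoc[OF ec(1) zc(1) dc] d z by simp
      ultimately show "d = \<zero> \<or> d = z" using min[of d] d z by (auto simp: idempotent_less_def)
    qed (use z in auto)
    let ?q = "e \<ominus> z"
    have zi: "ring_idempotent R z" "z \<otimes> e = z" "e \<otimes> z = z" using z by simp_all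
    note q = idempotent_diff[OF zi(1) less.prems zi(2,3)]
    have qc: "?q \<in> carrier R" using ec zc by simp
    have "?q \<noteq> e"
    proof
      assume "?q = e"
      then have "e \<otimes> z = \<zero>" using q(2) by simp
      then have "z = \<zero>" by (simp only: zi(3))
      then show False using z by blast
    qed
    then have "(?q, e) \<in> idempotent_less R" using q less.prems by (simp add: idempotent_less_def)
    then obtain n and p :: "nat \<Rightarrow> 'a" where
      p: "\<And>i. i \<in> {1..n} \<Longrightarrow> primitive_idempotent R (p i) \<and> ?q \<otimes> p i = p i \<and> p i \<otimes> ?q = p i"
      and orth: "\<And>i j. i \<in> {1..n} \<Longrightarrow> j \<in> {1..n} \<Longrightarrow> i \<noteq> j \<Longrightarrow> p i \<otimes> p j = \<zero>"
      and sum: "(\<Oplus>i\<in>{1..n}. p i) = ?q"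
      using less.IH[OF _ q(1)] by blast
    have pc: "p i \<in> carrier R" if "i \<in> {1..n}" for i
      using p[OF that] by (simp add: primitive_idempotent_def ring_idempotent_def)
    have pe: "e \<otimes> p i = p i \<and> p i \<otimes> e = p i \<and> z \<otimes> p i = \<zero> \<and> p i \<otimes> z = \<zero>" if i: "i \<in> {1..n}" for i
    proof -
      have 1: "x \<otimes> p i = (x \<otimes> ?q) \<otimes> p i" "p i \<otimes> x = p i \<otimes> (?q \<otimes> x)" if "x \<in> carrier R" for x
        using p[OF i] m_assoc[OF that qc pc[OF i]] m_assoc[OF pc[OF i] qc that] by simp_all
      show ?thesis using 1[OF ec(1)] 1[OF zc(1)] q p[OF i] pc[OF i] by simp
    qed
    let ?p = "p(Suc n := z)"
    have set: "{1..Suc n} = insert (Suc n) {1..n}" by auto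
    have "(\<Oplus>i\<in>{1..Suc n}. ?p i) = z \<oplus> (\<Oplus>i\<in>{1..n}. ?p i)"
      unfolding set using pc zc by (subst finsum_insert) auto
    also have "(\<Oplus>i\<in>{1..n}. ?p i) = (\<Oplus>i\<in>{1..n}. p i)"
      by (rule finsum_cong') (use pc in auto)
    finally have "(\<Oplus>i\<in>{1..Suc n}. ?p i) = e" using sum ec zc by (simp add: add_minus_cancel)
    moreover have "\<forall>i\<in>{1..Suc n}. primitive_idempotent R (?p i) \<and> e \<otimes> ?p i = ?p i \<and> ?p i \<otimes> e = ?p i"
      unfolding set using prim zi p pe by auto
    moreover have "\<forall>i\<in>{1..Suc n}. \<forall>j\<in>{1..Suc n}. i \<noteq> j \<longrightarrow> ?p i \<otimes> ?p j = \<zero>"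
      unfolding set using orth pe by auto
    ultimately show ?thesis by blast
  qed
qed

end

section \<open>Subrings containing all units\<close>

text \<open>
  \<open>S\<close> plays the role of the endomorphism ring of the projective cover, \<open>L\<close> that of its radical, and
  \<open>T\<close> that of the endomorphisms preserving the kernel of the cover.
\<close>

locale unit_subring = ring S for S (structure) +
  fixes T L :: "'a set" and n :: nat and p :: "nat \<Rightarrow> 'a"
  assumes L_ideal: "ideal L S"
    and L_unit: "x \<in> L \<Longrightarrow> \<one> \<ominus> x \<in> Units S"
    and T_subset: "T \<subseteq> carrier S"
    and T_add: "x \<in> T \<Longrightarrow> y \<in> T \<Longrightarrow> x \<oplus> y \<in> T"
    and T_mult: "x \<in> T \<Longrightarrow> y \<in> T \<Longrightarrow> x \<otimes> y \<in> T"
    and Units_T: "Units S \<subseteq> T"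
    and T_idempotent: "e \<in> T \<Longrightarrow> e \<otimes> e = e \<Longrightarrow> e = \<zero> \<or> e = \<one>"
    and T_proper: "T \<noteq> carrier S"
    and p_closed: "i \<in> {1..n} \<Longrightarrow> p i \<in> carrier S"
    and p_idem: "i \<in> {1..n} \<Longrightarrow> p i \<otimes> p i = p i"
    and p_nonzero: "i \<in> {1..n} \<Longrightarrow> p i \<noteq> \<zero>"
    and p_orth: "i \<in> {1..n} \<Longrightarrow> j \<in> {1..n} \<Longrightarrow> i \<noteq> j \<Longrightarrow> p i \<otimes> p j = \<zero>"
    and p_sum: "(\<Oplus>i\<in>{1..n}. p i) = \<one>"
    and p_local: "i \<in> {1..n} \<Longrightarrow> j \<in> {1..n} \<Longrightarrow> g \<in> carrier S \<Longrightarrow>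
      p i \<otimes> g \<otimes> p j \<in> L \<or> (\<exists>h\<in>carrier S. p i \<otimes> g \<otimes> p j \<otimes> h \<otimes> p i = p i)"
begin

sublocale L: ideal L S by (rule L_ideal)

lemma T_closed: "x \<in> T \<Longrightarrow> x \<in> carrier S"
  using T_subset by blast

lemma T_one: "\<one> \<in> T"
  using Units_T Units_one_closed by blast

lemma T_uminus:
  assumes "x \<in> T" shows "\<ominus> x \<in> T"
proof -
  have "\<ominus> \<one> \<in> Units S"
    unfolding Units_def by (auto intro!: bexI[of _ "\<ominus> \<one>"] simp: l_minus r_minus)
  then have "\<ominus> \<one> \<otimes> x \<in> T" using T_mult Units_T assms by blast
  then show ?thesis using T_closed[OF assms] by (simp add: l_minus)
qed

lemma T_diff: "x \<in> T \<Longrightarrow> y \<in> T \<Longrightarrow> x \<ominus> y \<in> T"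
  by (simp add: a_minus_def T_add T_uminus)

lemma L_T:
  assumes "x \<in> L" shows "x \<in> T"
proof -
  have "\<one> \<ominus> (\<one> \<ominus> x) \<in> T" using T_diff[OF T_one] Units_T L_unit[OF assms] by blast
  moreover have "\<one> \<ominus> (\<one> \<ominus> x) = x"
    using assms L.Icarr by (simp add: a_minus_def minus_add a_assoc[symmetric] r_neg)
  ultimately show ?thesis by simp
qed

text \<open>The element \<open>1 + x\<close> is a unit with inverse \<open>1 - x\<close>, so it lies
  in \<open>T\<close>, and so does its difference from 1.\<close>

lemma square_zero_T:
  assumes x: "x \<in> carrier S" "x \<otimes> x = \<zero>" shows "x \<in> T"
proof -
  have "(\<one> \<oplus> x) \<otimes> (\<one> \<ominus> x) = \<one>" "(\<one> \<ominus> x) \<otimes> (\<one> \<oplus> x) = \<one>"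
    using x by (simp_all add: a_minus_def l_distr r_distr l_minus r_minus a_assoc l_neg r_neg)
  then have "\<one> \<oplus> x \<in> T"
    using x Units_T unfolding Units_def by (auto intro!: subsetD[OF Units_T[unfolded Units_def]] bexI[of _ "\<one> \<ominus> x"])
  then have "\<one> \<oplus> x \<ominus> \<one> \<in> T" using T_diff T_one by blast
  then show ?thesis using x by (simp add: add_minus_cancel)
qed

text \<open>The unit \<open>1 - e\<close> annihilates \<open>e\<close>.\<close>

lemma idempotent_L:
  assumes "e \<in> L" "e \<otimes> e = e" shows "e = \<zero>"
proof -
  have ec: "e \<in> carrier S" using assms L.Icarr by simp
  have u: "\<one> \<ominus> e \<in> Units S" using L_unit assms by simp
  have "(\<one> \<ominus> e) \<otimes> e = \<zero>" using ec assms by (simp add: a_minus_def l_distr l_minus r_neg)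
  then have "inv (\<one> \<ominus> e) \<otimes> ((\<one> \<ominus> e) \<otimes> e) = \<zero>" using u by simp
  then show ?thesis using u ec by (simp add: m_assoc[symmetric])
qed

lemma p_notin_L: "i \<in> {1..n} \<Longrightarrow> p i \<notin> L"
  using idempotent_L p_idem p_nonzero by blast

text \<open>The assumption \<open>p_local\<close> supplies only a right inverse \<open>h\<close>. If
  \<open>h\<close> were in \<open>L\<close>, so would be \<open>p i\<close>; hence \<open>h\<close>
  has a right inverse \<open>k\<close> in turn, and associativity gives
  \<open>k = p i g p i\<close>. Thus \<open>h\<close> is a two-sided inverse, and the corner ring of
  \<open>p i\<close> is local.\<close>

lemma corner_unit:
  assumes i: "i \<in> {1..n}" and g: "g \<in> carrier S" and non: "p i \<otimes> g \<otimes> p i \<notin> L"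
  shows "\<exists>h\<in>carrier S. p i \<otimes> h \<otimes> p i = h \<and> p i \<otimes> g \<otimes> p i \<otimes> h = p i \<and> h \<otimes> (p i \<otimes> g \<otimes> p i) = p i"
proof -
  note P = p_closed[OF i] p_idem[OF i]
  have PP: "p i \<otimes> (p i \<otimes> x) = p i \<otimes> x" if "x \<in> carrier S" for x
    using P that by (simp add: m_assoc[symmetric])
  have right: "\<exists>h\<in>carrier S. p i \<otimes> h \<otimes> p i = h \<and> p i \<otimes> g \<otimes> p i \<otimes> h = p i"
    if g: "g \<in> carrier S" and non: "p i \<otimes> g \<otimes> p i \<notin> L" for g
  proof -
    obtain h where h: "h \<in> carrier S" "p i \<otimes> g \<otimes> p i \<otimes> h \<otimes> p i = p i" using p_local[OF i i g] non by blast
    show ?thesis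
      by (rule bexI[of _ "p i \<otimes> h \<otimes> p i"]) (use h g P PP in \<open>simp_all add: m_assoc\<close>)
  qed
  let ?v = "p i \<otimes> g \<otimes> p i"
  have v: "?v \<in> carrier S" using P g by simp
  obtain h where h: "h \<in> carrier S" "p i \<otimes> h \<otimes> p i = h" "?v \<otimes> h = p i" using right[OF g non] by blast
  have "h \<notin> L" using L.I_l_closed[of h ?v] v h p_notin_L[OF i] by metis
  then obtain k where k: "k \<in> carrier S" "p i \<otimes> k \<otimes> p i = k" "h \<otimes> k = p i"
    using right[OF h(1)] h(2) by auto
  have "?v = ?v \<otimes> (h \<otimes> k)" using k P g by (simp add: m_assoc)
  also have "\<dots> = (?v \<otimes> h) \<otimes> k" using m_assoc[OF v h(1) k(1)] by simp
  also have "\<dots> = p i \<otimes> (p i \<otimes> k \<otimes> p i)" using h(3) k(2) by simp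
  also have "\<dots> = p i \<otimes> k \<otimes> p i" using P k(1) PP by (simp add: m_assoc)
  also have "\<dots> = k" by (rule k(2))
  finally have "h \<otimes> ?v = p i" using k(3) by simp
  then show ?thesis using h by blast
qed

lemma one_neq_zero: "\<one> \<noteq> \<zero>"
proof
  assume "\<one> = \<zero>"
  then have "x = \<one>" if "x \<in> carrier S" for x using that by (metis l_one l_null)
  then have "carrier S \<subseteq> T" using T_one by blast
  then show False using T_proper T_subset by blast
qed

text \<open>With \<open>n = 1\<close> the only idempotent is \<open>p 1 = 1\<close>, so every
  element outside \<open>L\<close> is a unit of \<open>S\<close>. As \<open>T\<close> contains
  \<open>L\<close> and all units, it would be the whole of \<open>S\<close>.\<close>

lemma two_le_n: "2 \<le> n"
proof (rule ccontr)
  assume "\<not> 2 \<le> n"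
  then consider "n = 0" | "n = 1" by linarith
  then show False
  proof cases
    case 1 then show False using p_sum one_neq_zero by simp
  next
    case 2
    then have 1: "1 \<in> {1..n}" by simp
    have p1: "p 1 = \<one>" using p_sum p_closed[OF 1] 2 by simp
    obtain g where g: "g \<in> carrier S" "g \<notin> T" using T_proper T_subset by blast
    then have "g \<notin> L" using L_T by blast
    then obtain h where "h \<in> carrier S" "g \<otimes> h = \<one>" "h \<otimes> g = \<one>"
      using corner_unit[OF 1 g(1), unfolded p1] g(1) by auto
    then have "g \<in> Units S" using g unfolding Units_def by blast
    then show False using Units_T g by blast
  qed
qed

lemma p_notin_T:
  assumes i: "i \<in> {1..n}" shows "p i \<notin> T"
proof
  assume "p i \<in> T"
  then have "p i = \<one>" using T_idempotent p_idem[OF i] p_nonzero[OF i] by blast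
  moreover obtain j where j: "j \<in> {1..n}" "j \<noteq> i"
    using two_le_n by (cases "i = 1") (auto intro: that[of 1] that[of 2])
  ultimately show False using p_orth[OF j(1) i j(2)] p_nonzero[OF j(1)] p_closed[OF j(1)] by simp
qed

lemma offdiagonal_T:
  assumes "i \<in> {1..n}" "j \<in> {1..n}" "i \<noteq> j" "g \<in> carrier S"
  shows "p i \<otimes> g \<otimes> p j \<in> T"
proof (rule square_zero_T)
  have "p i \<otimes> g \<otimes> p j \<otimes> (p i \<otimes> g \<otimes> p j) = p i \<otimes> g \<otimes> (p j \<otimes> p i) \<otimes> g \<otimes> p j"
    using assms p_closed by (simp add: m_assoc)
  then show "p i \<otimes> g \<otimes> p j \<otimes> (p i \<otimes> g \<otimes> p j) = \<zero>"
    using assms p_closed p_orth[of j i] by simp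
qed (use assms p_closed in simp)

text \<open>The excluded equation says that \<open>p i\<close> factors through \<open>p j\<close>.
  An isomorphism between the two summands, extended by zero, would give such a factorization, and by
  \<open>p_local\<close> so would an off-diagonal entry outside \<open>L\<close>.\<close>

lemma no_isomorphism:
  assumes ij: "i \<in> {1..n}" "j \<in> {1..n}" "i \<noteq> j" and g: "g \<in> carrier S" and h: "h \<in> carrier S"
  shows "p i \<otimes> g \<otimes> p j \<otimes> h \<otimes> p i \<noteq> p i"
proof
  assume eq: "p i \<otimes> g \<otimes> p j \<otimes> h \<otimes> p i = p i"
  have "(p i \<otimes> g \<otimes> p j) \<otimes> (p j \<otimes> h \<otimes> p i) \<in> T"
    using offdiagonal_T[OF ij g] offdiagonal_T[OF ij(2,1) not_sym[OF ij(3)] h] T_mult by blast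
  moreover have "(p i \<otimes> g \<otimes> p j) \<otimes> (p j \<otimes> h \<otimes> p i) = p i \<otimes> g \<otimes> (p j \<otimes> p j) \<otimes> h \<otimes> p i"
    using ij g h p_closed by (simp add: m_assoc)
  ultimately show False using p_notin_T[OF ij(1)] eq p_idem[OF ij(2)] by simp
qed

lemma offdiagonal_L:
  assumes "i \<in> {1..n}" "j \<in> {1..n}" "i \<noteq> j" "g \<in> carrier S"
  shows "p i \<otimes> g \<otimes> p j \<in> L"
  using p_local[OF assms(1,2,4)] no_isomorphism[OF assms] by blast

text \<open>A unit of the corner of \<open>p i\<close> becomes a unit of \<open>S\<close> when it is
  continued by the identity on the complementary summand; the inverse is
  \<open>w + (1 - p i)\<close>.\<close>

lemma corner_T:
  assumes i: "i \<in> {1..n}" and v: "v \<in> carrier S" "p i \<otimes> v \<otimes> p i = v"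
    and w: "w \<in> carrier S" "p i \<otimes> w \<otimes> p i = w" and vw: "v \<otimes> w = p i" "w \<otimes> v = p i"
  shows "v \<oplus> (\<one> \<ominus> p i) \<in> T"
proof -
  note P = p_closed[OF i] p_idem[OF i]
  let ?q = "\<one> \<ominus> p i"
  have q: "?q \<in> carrier S" "?q \<otimes> ?q = ?q" "p i \<otimes> ?q = \<zero>" "?q \<otimes> p i = \<zero>"
    using P by (simp_all add: a_minus_def l_distr r_distr l_minus r_minus r_neg l_neg)
  have qx: "?q \<otimes> x = \<zero>" "x \<otimes> ?q = \<zero>" if x: "x \<in> carrier S" "p i \<otimes> x \<otimes> p i = x" for x
  proof -
    have xp: "x \<otimes> p i \<in> carrier S" "p i \<otimes> x \<in> carrier S" using x(1) P by simp_all
    have "x = p i \<otimes> (x \<otimes> p i)" using x P by (simp add: m_assoc)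
    then have "?q \<otimes> x = ?q \<otimes> (p i \<otimes> (x \<otimes> p i))" by (rule arg_cong)
    also have "\<dots> = ?q \<otimes> p i \<otimes> (x \<otimes> p i)" using m_assoc[OF q(1) P(1) xp(1)] by simp
    finally show "?q \<otimes> x = \<zero>" using q(4) xp by simp
    have "x \<otimes> ?q = p i \<otimes> x \<otimes> p i \<otimes> ?q" using x(2) by simp
    also have "\<dots> = p i \<otimes> x \<otimes> (p i \<otimes> ?q)" by (rule m_assoc[OF xp(2) P(1) q(1)])
    finally show "x \<otimes> ?q = \<zero>" using q(3) xp by simp
  qed
  have "(x \<oplus> ?q) \<otimes> (y \<oplus> ?q) = \<one>"
    if "x \<in> carrier S" "p i \<otimes> x \<otimes> p i = x" "y \<in> carrier S" "p i \<otimes> y \<otimes> p i = y" "x \<otimes> y = p i" for x y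
  proof -
    have "(x \<oplus> ?q) \<otimes> (y \<oplus> ?q) = x \<otimes> y \<oplus> x \<otimes> ?q \<oplus> (?q \<otimes> y \<oplus> ?q \<otimes> ?q)"
      using that(1,3) q(1) by (simp add: l_distr r_distr a_ac)
    also have "\<dots> = p i \<oplus> ?q"
      unfolding that(5) qx(2)[OF that(1,2)] qx(1)[OF that(3,4)] q(2) using q(1) P by simp
    finally show ?thesis using P by (simp add: add_minus_cancel)
  qed
  from this[OF v w vw(1)] this[OF w v vw(2)] have "v \<oplus> ?q \<in> Units S"
    using v w q(1) unfolding Units_def by blast
  then show ?thesis using Units_T by blast
qed

text \<open>
  If \<open>v\<close> and \<open>w = v - p i\<close> are both invertible in the corner of \<open>p i\<close>, with \<open>w'\<close> inverse to \<open>w\<close>, then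
  \<open>w = (v + (1 - p i)) - 1\<close> and \<open>w' + (1 - p i)\<close> lie in \<open>T\<close>, hence so does their product \<open>p i\<close>.
\<close>

lemma corner_two_elements:
  assumes i: "i \<in> {1..n}" and g: "g \<in> carrier S"
  shows "p i \<otimes> g \<otimes> p i \<in> L \<or> p i \<otimes> g \<otimes> p i \<ominus> p i \<in> L"
proof (rule ccontr)
  assume non: "\<not> ?thesis"
  note P = p_closed[OF i] p_idem[OF i]
  have PP: "p i \<otimes> (p i \<otimes> x) = p i \<otimes> x" if "x \<in> carrier S" for x
    using P that by (simp add: m_assoc[symmetric])
  let ?v = "p i \<otimes> g \<otimes> p i"
  let ?w = "?v \<ominus> p i"
  have v: "?v \<in> carrier S" "p i \<otimes> ?v \<otimes> p i = ?v" using P g PP by (simp_all add: m_assoc)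
  have w: "?w \<in> carrier S" using v P by simp
  have wp: "p i \<otimes> ?w \<otimes> p i = ?w"
    using v P by (simp add: a_minus_def l_distr r_distr l_minus r_minus)
  obtain v' where v': "v' \<in> carrier S" "p i \<otimes> v' \<otimes> p i = v'" "?v \<otimes> v' = p i" "v' \<otimes> ?v = p i"
    using corner_unit[OF i g] non by blast
  obtain w' where w': "w' \<in> carrier S" "p i \<otimes> w' \<otimes> p i = w'" "?w \<otimes> w' = p i" "w' \<otimes> ?w = p i"
    using corner_unit[OF i w] non unfolding wp by blast
  let ?q = "\<one> \<ominus> p i"
  have q: "?q \<in> carrier S" using P by simp
  have "?v \<oplus> ?q \<ominus> \<one> \<in> T"
    using corner_T[OF i v v'(1,2,3,4)] T_diff T_one by blast
  moreover have "?v \<oplus> ?q \<ominus> \<one> = ?w"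
    using v(1) P by (simp add: a_minus_def a_ac r_neg r_neg1 r_neg2)
  ultimately have wT: "?w \<in> T" by simp
  have "w' \<oplus> ?q \<in> T" by (rule corner_T[OF i w'(1,2) w wp w'(4,3)])
  then have "(w' \<oplus> ?q) \<otimes> ?w \<in> T" using wT T_mult by blast
  moreover have "(w' \<oplus> ?q) \<otimes> ?w = p i"
  proof -
    have "?q \<otimes> ?w = ?w \<ominus> p i \<otimes> ?w" using w P by (simp add: a_minus_def l_distr l_minus)
    also have "p i \<otimes> ?w = ?w" using wp w P PP by (metis m_assoc m_closed)
    finally have "?q \<otimes> ?w = \<zero>" using w by (simp add: a_minus_def r_neg)
    then show ?thesis using w'(1,4) q w P by (simp add: l_distr)
  qed
  ultimately show False using p_notin_T[OF i] by simp
qed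

lemma finsum_L:
  assumes "finite A" "f \<in> A \<rightarrow> L" shows "(\<Oplus>i\<in>A. f i) \<in> L"
  using assms
proof (induction A rule: finite_induct)
  case (insert a A)
  then have "f \<in> A \<rightarrow> carrier S" "f a \<in> carrier S" using L.a_subset by blast+
  then show ?case using insert by (simp add: L.a_closed)
qed simp

text \<open>As the \<open>p i\<close> add up to 1, \<open>x\<close> is the sum of its entries
  \<open>p i x p j\<close> (the Peirce decomposition).\<close>

lemma corners_L:
  assumes x: "x \<in> carrier S" and L: "\<And>i j. i \<in> {1..n} \<Longrightarrow> j \<in> {1..n} \<Longrightarrow> p i \<otimes> x \<otimes> p j \<in> L"
  shows "x \<in> L"
proof -
  have pc: "p \<in> {1..n} \<rightarrow> carrier S" using p_closed by blast
  have col: "x \<otimes> p j \<in> L" if j: "j \<in> {1..n}" for j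
  proof -
    have xp: "x \<otimes> p j \<in> carrier S" using x p_closed[OF j] by simp
    have "x \<otimes> p j = (\<Oplus>i\<in>{1..n}. p i) \<otimes> (x \<otimes> p j)" using p_sum xp by simp
    also have "\<dots> = (\<Oplus>i\<in>{1..n}. p i \<otimes> (x \<otimes> p j))"
      using finsum_ldistr[OF _ xp pc] by simp
    also have "\<dots> \<in> L" by (rule finsum_L) (use L[OF _ j] x p_closed j in \<open>auto simp: m_assoc\<close>)
    finally show ?thesis .
  qed
  have "x = x \<otimes> (\<Oplus>i\<in>{1..n}. p i)" using p_sum x by simp
  also have "\<dots> = (\<Oplus>i\<in>{1..n}. x \<otimes> p i)" using finsum_rdistr[OF _ x pc] by simp
  also have "\<dots> \<in> L" by (rule finsum_L) (use col in auto)
  finally show ?thesis .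
qed

lemma T_two_elements:
  assumes g: "g \<in> T" shows "g \<in> L \<or> g \<ominus> \<one> \<in> L"
proof -
  have gc: "g \<in> carrier S" using T_closed g .
  define A where "A = {i \<in> {1..n}. p i \<otimes> g \<otimes> p i \<notin> L}"
  define e where "e = (\<Oplus>i\<in>A. p i)"
  have A: "finite A" "A \<subseteq> {1..n}" by (auto simp: A_def)
  have pc: "p \<in> A \<rightarrow> carrier S" using A p_closed by blast
  have e: "e \<in> carrier S" unfolding e_def by (rule finsum_closed[OF pc])
  have ep: "e \<otimes> p j = (if j \<in> A then p j else \<zero>)" if j: "j \<in> {1..n}" for j
  proof -
    have "e \<otimes> p j = (\<Oplus>i\<in>A. p i \<otimes> p j)"
      unfolding e_def using finsum_ldistr[OF A(1) p_closed[OF j] pc] .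
    also have "\<dots> = (\<Oplus>i\<in>A. if j = i then p i else \<zero>)"
      by (rule finsum_cong') (use A p_closed p_idem p_orth j in auto)
    also have "\<dots> = (if j \<in> A then p j else \<zero>)"
    proof (cases "j \<in> A")
      case True
      then show ?thesis using finsum_singleton[OF True A(1) pc] by simp
    next
      case False
      then have "(\<Oplus>i\<in>A. if j = i then p i else \<zero>) = (\<Oplus>i\<in>A. \<zero>)"
        by (intro finsum_cong') auto
      then show ?thesis using False by simp
    qed
    finally show ?thesis .
  qed
  have ee: "e \<otimes> e = e"
  proof -
    have "e \<otimes> e = (\<Oplus>i\<in>A. e \<otimes> p i)" unfolding e_def[symmetric]
      using finsum_rdistr[OF A(1) e pc] by (simp add: e_def)
    also have "\<dots> = (\<Oplus>i\<in>A. p i)" by (rule finsum_cong') (use ep A pc in auto)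
    finally show ?thesis by (simp add: e_def)
  qed
  \<comment> \<open>Compare entries. Off the diagonal those of \<open>g\<close> are in
    \<open>L\<close> and those of \<open>e\<close> vanish. On the diagonal \<open>e\<close>
    contributes \<open>p i\<close> exactly where the entry of \<open>g\<close> is not in
    \<open>L\<close>, and there it is \<open>p i\<close> modulo \<open>L\<close>.\<close>
  have "g \<ominus> e \<in> L"
  proof (rule corners_L)
    show "g \<ominus> e \<in> carrier S" using gc e by simp
    fix i j assume i: "i \<in> {1..n}" and j: "j \<in> {1..n}"
    note P = p_closed[OF i] p_closed[OF j]
    have eq: "p i \<otimes> (g \<ominus> e) \<otimes> p j = p i \<otimes> g \<otimes> p j \<ominus> p i \<otimes> (e \<otimes> p j)"
      using P gc e by (simp add: a_minus_def l_distr r_distr l_minus r_minus m_assoc)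
    show "p i \<otimes> (g \<ominus> e) \<otimes> p j \<in> L"
    proof (cases "i = j")
      case True
      then show ?thesis
      proof (cases "i \<in> A")
        case iA: True
        then have "p i \<otimes> g \<otimes> p i \<notin> L" by (simp add: A_def)
        then have "p i \<otimes> g \<otimes> p i \<ominus> p i \<in> L" using corner_two_elements[OF i gc] by blast
        then show ?thesis using eq True iA ep[OF j] p_idem[OF i] by simp
      next
        case iA: False
        then have "p i \<otimes> g \<otimes> p i \<in> L" using i by (simp add: A_def)
        then show ?thesis using eq True iA ep[OF j] P gc by (simp add: a_minus_def)
      qed
    next
      case False
      then have "p i \<otimes> (e \<otimes> p j) = \<zero>" using ep[OF j] p_orth[OF i j] P by simp
      then show ?thesis using eq offdiagonal_L[OF i j False gc] P gc by (simp add: a_minus_def)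
    qed
  qed
  moreover have "e = \<zero> \<or> e = \<one>"
  proof -
    \<comment> \<open>Passing to \<open>e\<close> modulo \<open>L\<close> does not leave
      \<open>T\<close>, because \<open>L\<close> is contained in \<open>T\<close>.\<close>
    have "g \<ominus> (g \<ominus> e) \<in> T" using T_diff[OF g L_T] \<open>g \<ominus> e \<in> L\<close> by blast
    moreover have "g \<ominus> (g \<ominus> e) = e"
      using gc e by (simp add: a_minus_def minus_add a_assoc[symmetric] r_neg)
    ultimately show ?thesis using T_idempotent ee by simp
  qed
  ultimately show ?thesis using gc by (auto simp: a_minus_def)
qed

end

section \<open>Endomorphism rings modulo their radical\<close>

text \<open>When \<open>J(R)\<close> is right T-nilpotent, this ideal lies in the radical of the
  endomorphism ring. Equality is obtained from \<open>two_element_quotient\<close>, once its two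
  cosets of 0 and 1 exhaust the ring.\<close>

definition End_radical :: "[('r, 'k) ring_scheme, ('r, 'm) rmod] \<Rightarrow> ('m \<Rightarrow> 'm) set" where
  "End_radical R M = {f \<in> carrier (End_ring R M). \<forall>x\<in>carrier M. f x \<in> times_jacobson R M}"

context right_module
begin

lemma End_radical_ideal: "ideal (End_radical R M) (End_ring R M)"
proof -
  interpret E: ring "End_ring R M" by (rule End_ring_ring) (rule right_module_axioms)
  note D = rsubmoduleD[OF times_jacobson_rsubmodule]
  show ?thesis
  proof (rule idealI[OF E.ring_axioms])
    show "subgroup (End_radical R M) (add_monoid (End_ring R M))"
    proof (rule E.add.subgroupI)
      have "\<zero>\<^bsub>End_ring R M\<^esub> \<in> End_radical R M" using D(2) by (simp add: End_radical_def)
      then show "End_radical R M \<noteq> {}" by blast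
    qed (auto simp: End_radical_def D a_inv_def[symmetric])
    show "x \<otimes>\<^bsub>End_ring R M\<^esub> f \<in> End_radical R M"
      if "f \<in> End_radical R M" "x \<in> carrier (End_ring R M)" for f x
      using that rmod_hom_times_jacobson[OF right_module_axioms right_module_axioms End_ring_hom[OF that(2)]]
      by (simp add: End_radical_def)
    show "f \<otimes>\<^bsub>End_ring R M\<^esub> x \<in> End_radical R M"
      if "f \<in> End_radical R M" "x \<in> carrier (End_ring R M)" for f x
      using that by (simp add: End_radical_def)
  qed
qed

lemma End_radical_Units:
  assumes "right_T_nilpotent R (jacobson R)" "f \<in> End_radical R M"
  shows "\<one>\<^bsub>End_ring R M\<^esub> \<ominus>\<^bsub>End_ring R M\<^esub> f \<in> Units (End_ring R M)"
  by (rule one_minus_Units[OF assms(1)]) (use assms(2) in \<open>simp_all add: End_radical_def\<close>)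

text \<open>The dichotomy is stated on elements so that one lemma serves both \<open>M\<close>,
  which is reached through \<pi>, and the summands of \<open>P\<close>.\<close>

lemma End_ring_two_elements:
  assumes T: "right_T_nilpotent R (jacobson R)" and nz: "carrier M \<noteq> {\<zero>\<^bsub>M\<^esub>}"
    and two: "\<And>f. f \<in> carrier (End_ring R M) \<Longrightarrow>
      (\<forall>x\<in>carrier M. f x \<in> times_jacobson R M) \<or> (\<forall>x\<in>carrier M. f x \<ominus>\<^bsub>M\<^esub> x \<in> times_jacobson R M)"
  shows "End_ring R M Quot jacobson (End_ring R M) \<simeq> residue_ring 2"
proof -
  interpret E: ring "End_ring R M" by (rule End_ring_ring) (rule right_module_axioms)
  note D = rsubmoduleD[OF times_jacobson_rsubmodule]
  show ?thesis
  proof (rule two_element_quotient[OF E.ring_axioms End_radical_ideal])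
    show "\<one>\<^bsub>End_ring R M\<^esub> \<notin> End_radical R M"
      using times_jacobson_proper[OF T nz] D(1) by (auto simp: End_radical_def)
    fix f assume f: "f \<in> carrier (End_ring R M)"
    have "x \<ominus>\<^bsub>M\<^esub> f x = \<ominus>\<^bsub>M\<^esub> (f x \<ominus>\<^bsub>M\<^esub> x)" if "x \<in> carrier M" for x
      using that f by (simp add: a_minus_def M.minus_add M.a_comm)
    then show "f \<in> End_radical R M \<or> \<one>\<^bsub>End_ring R M\<^esub> \<ominus>\<^bsub>End_ring R M\<^esub> f \<in> End_radical R M"
      using two[OF f] f D(5) by (auto simp: End_radical_def)
  qed (rule End_radical_Units[OF T])
qed

lemma End_ring_finsum_apply:
  assumes "finite A" "f \<in> A \<rightarrow> carrier (End_ring R M)" "x \<in> carrier M"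
  shows "(\<Oplus>\<^bsub>End_ring R M\<^esub>i\<in>A. f i) x = (\<Oplus>\<^bsub>M\<^esub>i\<in>A. f i x)"
proof -
  interpret E: ring "End_ring R M" by (rule End_ring_ring) (rule right_module_axioms)
  show ?thesis using assms(1,2)
  proof (induction A rule: finite_induct)
    case (insert a A)
    have "f a \<in> carrier (End_ring R M)" "f \<in> A \<rightarrow> carrier (End_ring R M)" using insert by auto
    moreover have "(\<lambda>i. f i x) \<in> A \<rightarrow> carrier M"
      using insert.prems End_ring_closed[OF _ assms(3)] by blast
    ultimately show ?case using insert assms(3) by simp
  qed (use assms(3) in simp)
qed

section \<open>Direct summands and idempotents\<close>

text \<open>The value \<open>e x\<close> is the only \<open>a\<close> in \<open>A\<close> with
  \<open>x - a\<close> in \<open>B\<close>, since two candidates differ by an element of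
  \<open>A \<inter> B\<close>. Linearity follows from this uniqueness.\<close>

lemma direct_sum_projection:
  assumes A: "rsubmodule A R M" and B: "rsubmodule B R M"
    and sum: "A <+>\<^bsub>M\<^esub> B = carrier M" and int: "A \<inter> B = {\<zero>\<^bsub>M\<^esub>}"
  shows "\<exists>e\<in>rmod_hom R M M. (\<forall>a\<in>A. e a = a) \<and> (\<forall>b\<in>B. e b = \<zero>\<^bsub>M\<^esub>) \<and> (\<forall>x\<in>carrier M. e x \<in> A)"
proof -
  note AD = rsubmoduleD[OF A] and BD = rsubmoduleD[OF B]
  have "\<forall>x\<in>carrier M. \<exists>a. a \<in> A \<and> x \<ominus>\<^bsub>M\<^esub> a \<in> B"
  proof
    fix x assume "x \<in> carrier M"
    then have "x \<in> A <+>\<^bsub>M\<^esub> B" using sum by simp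
    then obtain a b where "a \<in> A" "b \<in> B" "x = a \<oplus>\<^bsub>M\<^esub> b" by (auto simp: set_add_def')
    then show "\<exists>a. a \<in> A \<and> x \<ominus>\<^bsub>M\<^esub> a \<in> B" using AD(1) BD(1) by (auto simp: M.add_minus_cancel)
  qed
  then obtain e where e: "\<And>x. x \<in> carrier M \<Longrightarrow> e x \<in> A \<and> x \<ominus>\<^bsub>M\<^esub> e x \<in> B" by metis
  have ec: "e x \<in> carrier M" if "x \<in> carrier M" for x using e[OF that] AD(1) by blast
  have uniq: "e x = a" if "x \<in> carrier M" "a \<in> A" "x \<ominus>\<^bsub>M\<^esub> a \<in> B" for x a
  proof -
    have ac: "a \<in> carrier M" using that AD(1) by simp
    have "e x \<ominus>\<^bsub>M\<^esub> a = (x \<ominus>\<^bsub>M\<^esub> a) \<ominus>\<^bsub>M\<^esub> (x \<ominus>\<^bsub>M\<^esub> e x)"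
      using that(1) ac ec[OF that(1)] M.add_minus_cancel(3)[of x "e x \<ominus>\<^bsub>M\<^esub> a"]
      by (simp add: a_minus_def M.minus_add M.a_ac)
    then have "e x \<ominus>\<^bsub>M\<^esub> a \<in> B" using BD(6)[OF that(3)] e[OF that(1)] by simp
    moreover have "e x \<ominus>\<^bsub>M\<^esub> a \<in> A" using AD(6) that(2) e[OF that(1)] by blast
    ultimately have "e x \<ominus>\<^bsub>M\<^esub> a \<in> A \<inter> B" by simp
    then show ?thesis using int ac ec[OF that(1)] by (simp add: M.minus_eq_zero_iff)
  qed
  have "e \<in> rmod_hom R M M"
  proof (rule rmod_homI)
    fix x y assume x: "x \<in> carrier M" and y: "y \<in> carrier M"
    have "(x \<oplus>\<^bsub>M\<^esub> y) \<ominus>\<^bsub>M\<^esub> (e x \<oplus>\<^bsub>M\<^esub> e y) = (x \<ominus>\<^bsub>M\<^esub> e x) \<oplus>\<^bsub>M\<^esub> (y \<ominus>\<^bsub>M\<^esub> e y)"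
      using x y ec by (simp add: a_minus_def M.minus_add M.a_ac)
    then show "e (x \<oplus>\<^bsub>M\<^esub> y) = e x \<oplus>\<^bsub>M\<^esub> e y"
      using x y e AD(3) BD(3) by (intro uniq) auto
  next
    fix x r assume x: "x \<in> carrier M" and r: "r \<in> carrier R"
    have "x \<cdot>\<^bsub>M\<^esub> r \<ominus>\<^bsub>M\<^esub> e x \<cdot>\<^bsub>M\<^esub> r = (x \<ominus>\<^bsub>M\<^esub> e x) \<cdot>\<^bsub>M\<^esub> r"
      using x r ec by (simp add: a_minus_def ract_add_left ract_uminus)
    then show "e (x \<cdot>\<^bsub>M\<^esub> r) = e x \<cdot>\<^bsub>M\<^esub> r"
      using x r e AD(4) BD(4) by (intro uniq) auto
  qed (use ec in simp)
  moreover have "e a = a" if "a \<in> A" for a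
    using that AD(1,2) BD(2) by (intro uniq) (auto simp: a_minus_def M.r_neg)
  moreover have "e b = \<zero>\<^bsub>M\<^esub>" if "b \<in> B" for b
    using that AD(2) BD(1) M.add_minus_cancel(2)[of "\<zero>\<^bsub>M\<^esub>" b] by (intro uniq) auto
  ultimately show ?thesis using e by blast
qed

end

locale summand = right_module R M for R (structure) and M (structure) +
  fixes p
  assumes p: "p \<in> carrier (End_ring R M)" and pp: "p \<otimes>\<^bsub>End_ring R M\<^esub> p = p"
begin

abbreviation "N \<equiv> p ` carrier M"
abbreviation "Q \<equiv> M\<lparr>carrier := N\<rparr>"

lemma N_rsubmodule: "rsubmodule N R M"
  by (rule rmod_hom_image[OF right_module_axioms right_module_axioms End_ring_hom[OF p] rsubmodule_carrier])

sublocale Q: right_module R Q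
  by (rule right_module_rsubmodule[OF N_rsubmodule])

lemma p_apply: "x \<in> carrier M \<Longrightarrow> p (p x) = p x"
  using fun_cong[OF pp, of x] by simp

lemma p_fix: "x \<in> N \<Longrightarrow> p x = x"
  using p_apply by (elim imageE) simp

lemma N_iff: "x \<in> N \<longleftrightarrow> x \<in> carrier M \<and> p x = x"
proof
  show "x \<in> N \<Longrightarrow> x \<in> carrier M \<and> p x = x"
    using p_fix rsubmoduleD(1)[OF N_rsubmodule] by blast
  show "x \<in> carrier M \<and> p x = x \<Longrightarrow> x \<in> N"
    by (rule image_eqI[of _ _ x]) simp_all
qed

lemma N_closed: "x \<in> N \<Longrightarrow> x \<in> carrier M"
  by (simp add: N_iff)

lemma inclusion_hom: "(\<lambda>x. x) \<in> rmod_hom R Q M"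
  using N_closed by (auto simp: rmod_hom_def)

lemma projection_hom: "p \<in> rmod_hom R M Q"
  using End_ring_hom[OF p] by (auto simp: rmod_hom_def)

lemma Q_uminus: "x \<in> N \<Longrightarrow> y \<in> N \<Longrightarrow> x \<ominus>\<^bsub>Q\<^esub> y = x \<ominus>\<^bsub>M\<^esub> y"
  using rmod_hom_uminus(2)[OF Q.right_module_axioms right_module_axioms inclusion_hom, of x y] by simp

text \<open>Homomorphisms respect the products with \<open>J(R)\<close>: one inclusion comes from
  the embedding of the summand, the other from the projection, which fixes it.\<close>

lemma times_jacobson_summand: "times_jacobson R Q = N \<inter> times_jacobson R M"
proof (intro equalityI subsetI)
  fix x assume x: "x \<in> times_jacobson R Q"
  then show "x \<in> N \<inter> times_jacobson R M"
    using rmod_hom_times_jacobson[OF Q.right_module_axioms right_module_axioms inclusion_hom x]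
      Q.rsubmoduleD(1)[OF Q.times_jacobson_rsubmodule x] by simp
next
  fix x assume x: "x \<in> N \<inter> times_jacobson R M"
  then have "p x \<in> times_jacobson R Q"
    using rmod_hom_times_jacobson[OF right_module_axioms Q.right_module_axioms projection_hom] by blast
  moreover have "p x = x" using x p_fix by blast
  ultimately show "x \<in> times_jacobson R Q" by (simp only:)
qed

lemma projective_summand:
  assumes "projective R M" shows "projective R Q"
  unfolding projective_def
proof (intro conjI allI impI)
  fix A :: "('a, 'c \<Rightarrow> 'a) rmod" and B :: "('a, 'c) rmod" and g h
  assume as: "right_module R A \<and> right_module R B \<and> g \<in> rmod_hom R A B \<and>
    g ` carrier A = carrier B \<and> h \<in> rmod_hom R Q B"
  then have hp: "(\<lambda>x. h (p x)) \<in> rmod_hom R M B"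
    using rmod_hom_compose[OF _ projection_hom] by blast
  have "\<exists>l\<in>rmod_hom R M A. \<forall>x\<in>carrier M. g (l x) = h (p x)"
    by (rule projective_lift[OF assms _ _ _ _ hp]) (use as in blast)+
  then obtain l where l: "l \<in> rmod_hom R M A" "\<And>x. x \<in> carrier M \<Longrightarrow> g (l x) = h (p x)" by blast
  have "l \<in> rmod_hom R Q A" using rmod_hom_compose[OF l(1) inclusion_hom] by simp
  moreover have "g (l x) = h x" if "x \<in> carrier Q" for x
    using that l(2)[of x] N_closed[of x] p_fix[of x] by simp
  ultimately show "\<exists>l\<in>rmod_hom R Q A. \<forall>x\<in>carrier Q. g (l x) = h x" by blast
qed (rule Q.right_module_axioms)

text \<open>A decomposition of the summand into \<open>A\<close> and \<open>B\<close> gives an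
  idempotent \<open>?d\<close> below \<open>p\<close>, namely \<open>p\<close> followed by the
  projection onto \<open>A\<close> along \<open>B\<close>. By primitivity \<open>?d\<close> is zero,
  and then \<open>A\<close> is trivial, or it is \<open>p\<close>, and then \<open>B\<close> is
  trivial.\<close>

lemma indecomposable_summand:
  assumes prim: "primitive_idempotent (End_ring R M) p"
  shows "indecomposable R Q"
  unfolding indecomposable_def
proof (intro conjI allI impI)
  interpret E: ring "End_ring R M" by (rule End_ring_ring) (rule right_module_axioms)
  show "carrier Q \<noteq> {\<zero>\<^bsub>Q\<^esub>}"
  proof
    assume "carrier Q = {\<zero>\<^bsub>Q\<^esub>}"
    then have "p x = \<zero>\<^bsub>M\<^esub>" if "x \<in> carrier M" for x using that by auto
    then have "p = \<zero>\<^bsub>End_ring R M\<^esub>" by (intro End_ring_eqI[OF p E.zero_closed]) simp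
    then show False using prim by (simp add: primitive_idempotent_def)
  qed
  fix A B assume AB: "rsubmodule A R Q \<and> rsubmodule B R Q \<and>
    A <+>\<^bsub>Q\<^esub> B = carrier Q \<and> A \<inter> B = {\<zero>\<^bsub>Q\<^esub>}"
  then obtain e where e: "e \<in> rmod_hom R Q Q" "\<And>a. a \<in> A \<Longrightarrow> e a = a" "\<And>b. b \<in> B \<Longrightarrow> e b = \<zero>\<^bsub>Q\<^esub>"
    "\<And>x. x \<in> carrier Q \<Longrightarrow> e x \<in> A"
    using Q.direct_sum_projection[of A B] by blast
  have AN: "A \<subseteq> N" and BN: "B \<subseteq> N"
    using AB Q.rsubmoduleD(1) by auto
  have zero: "\<zero>\<^bsub>Q\<^esub> = \<zero>\<^bsub>M\<^esub>" "\<zero>\<^bsub>M\<^esub> \<in> A" "\<zero>\<^bsub>M\<^esub> \<in> B" using AB Q.rsubmoduleD(2) by auto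
  let ?d = "restrict (\<lambda>x. e (p x)) (carrier M)"
  have "(\<lambda>x. e (p x)) \<in> rmod_hom R M M"
    using rmod_hom_compose[OF inclusion_hom rmod_hom_compose[OF e(1) projection_hom]] .
  then have d: "?d \<in> carrier (End_ring R M)" by (rule restrict_in_End_ring[OF right_module_axioms])
  have eN: "e (p x) \<in> A" "e (p x) \<in> N" "e (p x) \<in> carrier M" if "x \<in> carrier M" for x
    using e(4)[of "p x"] AN that N_closed[of "e (p x)"] by auto
  have pe: "p (e (p x)) = e (p x)" if "x \<in> carrier M" for x using p_fix[OF eN(2)[OF that]] .
  have "?d \<otimes>\<^bsub>End_ring R M\<^esub> ?d = ?d" "?d \<otimes>\<^bsub>End_ring R M\<^esub> p = ?d" "p \<otimes>\<^bsub>End_ring R M\<^esub> ?d = ?d"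
  proof -
    have dx: "?d x = e (p x)" if "x \<in> carrier M" for x using that by simp
    have eq: "(?d \<otimes>\<^bsub>End_ring R M\<^esub> ?d) x = ?d x" "(?d \<otimes>\<^bsub>End_ring R M\<^esub> p) x = ?d x"
      "(p \<otimes>\<^bsub>End_ring R M\<^esub> ?d) x = ?d x" if x: "x \<in> carrier M" for x
    proof -
      have px: "p x \<in> carrier M" using p x by simp
      show "(?d \<otimes>\<^bsub>End_ring R M\<^esub> ?d) x = ?d x"
        by (simp only: End_ring_apply(3)[OF x] dx[OF x] dx[OF eN(3)[OF x]] pe[OF x] e(2)[OF eN(1)[OF x]])
      show "(?d \<otimes>\<^bsub>End_ring R M\<^esub> p) x = ?d x"
        by (simp only: End_ring_apply(3)[OF x] dx[OF x] dx[OF px] p_apply[OF x])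
      show "(p \<otimes>\<^bsub>End_ring R M\<^esub> ?d) x = ?d x"
        by (simp only: End_ring_apply(3)[OF x] dx[OF x] pe[OF x])
    qed
    show "?d \<otimes>\<^bsub>End_ring R M\<^esub> ?d = ?d" by (rule End_ring_eqI[OF E.m_closed[OF d d] d eq(1)])
    show "?d \<otimes>\<^bsub>End_ring R M\<^esub> p = ?d" by (rule End_ring_eqI[OF E.m_closed[OF d p] d eq(2)])
    show "p \<otimes>\<^bsub>End_ring R M\<^esub> ?d = ?d" by (rule End_ring_eqI[OF E.m_closed[OF p d] d eq(3)])
  qed
  then have "?d = \<zero>\<^bsub>End_ring R M\<^esub> \<or> ?d = p"
    using prim d unfolding primitive_idempotent_def ring_idempotent_def by blast
  then show "A = {\<zero>\<^bsub>Q\<^esub>} \<or> B = {\<zero>\<^bsub>Q\<^esub>}"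
  proof
    assume d0: "?d = \<zero>\<^bsub>End_ring R M\<^esub>"
    have "a = \<zero>\<^bsub>M\<^esub>" if "a \<in> A" for a
      using fun_cong[OF d0, of a] N_closed[of a] p_fix[of a] e(2)[OF that] subsetD[OF AN that] by simp
    then show ?thesis unfolding zero(1) using zero(2) by blast
  next
    assume dp: "?d = p"
    have "b = \<zero>\<^bsub>M\<^esub>" if "b \<in> B" for b
      using fun_cong[OF dp, of b] N_closed[of b] p_fix[of b] e(3)[OF that] subsetD[OF BN that] zero(1)
      by simp
    then show ?thesis unfolding zero(1) using zero(3) by blast
  qed
qed

end

text \<open>If \<open>v = p g q\<close> has a value outside \<open>MJ(R)\<close>, this value
  generates the local summand \<open>pM\<close>, so \<open>v\<close> maps onto it. Lifting
  \<open>p\<close> along \<open>v\<close> by projectivity gives \<open>h\<close>.\<close>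

lemma (in right_module) primitive_corner_local:
  assumes perf: "right_perfect R" and proj: "projective R M"
    and prim: "primitive_idempotent (End_ring R M) p"
    and g: "g \<in> carrier (End_ring R M)" and q: "q \<in> carrier (End_ring R M)"
  shows "p \<otimes>\<^bsub>End_ring R M\<^esub> g \<otimes>\<^bsub>End_ring R M\<^esub> q \<in> End_radical R M \<or>
    (\<exists>h\<in>carrier (End_ring R M).
      p \<otimes>\<^bsub>End_ring R M\<^esub> g \<otimes>\<^bsub>End_ring R M\<^esub> q \<otimes>\<^bsub>End_ring R M\<^esub> h \<otimes>\<^bsub>End_ring R M\<^esub> p = p)"
proof -
  interpret E: ring "End_ring R M" by (rule End_ring_ring) (rule right_module_axioms)
  interpret summand R M p
    using prim by unfold_locales (simp_all add: primitive_idempotent_def ring_idempotent_def)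
  let ?v = "p \<otimes>\<^bsub>End_ring R M\<^esub> g \<otimes>\<^bsub>End_ring R M\<^esub> q"
  have v: "?v \<in> carrier (End_ring R M)" using p g q by simp
  have vx: "?v x = p (g (q x))" if "x \<in> carrier M" for x using that q by simp
  have vN: "?v x \<in> N" if "x \<in> carrier M" for x using that g q by (simp add: vx)
  have vh: "?v \<in> rmod_hom R M Q"
    using End_ring_hom[OF v] vN by (auto simp: rmod_hom_def)
  show ?thesis
  proof (rule disjCI)
    assume no: "\<not> (\<exists>h\<in>carrier (End_ring R M). ?v \<otimes>\<^bsub>End_ring R M\<^esub> h \<otimes>\<^bsub>End_ring R M\<^esub> p = p)"
    show "?v \<in> End_radical R M"
    proof (rule ccontr)
      assume "?v \<notin> End_radical R M"
      then obtain x where x: "x \<in> carrier M" "?v x \<notin> times_jacobson R M"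
        using v by (auto simp: End_radical_def)
      have "?v x \<in> carrier Q" "?v x \<notin> times_jacobson R Q"
        using x vN[OF x(1)] by (auto simp: times_jacobson_summand)
      then have gen: "{?v x \<cdot>\<^bsub>Q\<^esub> r |r. r \<in> carrier R} = carrier Q"
        using Q.indecomposable_projective_local[OF perf projective_summand[OF proj] indecomposable_summand[OF prim]]
        by blast
      have onto: "?v ` carrier M = carrier Q"
      proof (intro equalityI subsetI)
        fix y assume "y \<in> carrier Q"
        then obtain r where r: "r \<in> carrier R" "y = ?v x \<cdot>\<^bsub>Q\<^esub> r" using gen by blast
        then have "y = ?v (x \<cdot>\<^bsub>M\<^esub> r)" using rmod_homD(3)[OF vh x(1) r(1)] by simp
        then show "y \<in> ?v ` carrier M" using x(1) r(1) by blast
      qed (use vN in auto)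
      obtain l where l: "l \<in> rmod_hom R M M" "\<And>x. x \<in> carrier M \<Longrightarrow> ?v (l x) = p x"
        using projective_lift[OF proj right_module_axioms Q.right_module_axioms vh onto projection_hom] by blast
      let ?h = "restrict l (carrier M)"
      have h: "?h \<in> carrier (End_ring R M)" by (rule restrict_in_End_ring[OF right_module_axioms l(1)])
      have "?v \<otimes>\<^bsub>End_ring R M\<^esub> ?h \<otimes>\<^bsub>End_ring R M\<^esub> p = p"
      proof (rule End_ring_eqI)
        fix x assume x: "x \<in> carrier M"
        have "(?v \<otimes>\<^bsub>End_ring R M\<^esub> ?h \<otimes>\<^bsub>End_ring R M\<^esub> p) x = (?v \<otimes>\<^bsub>End_ring R M\<^esub> ?h) (p x)"
          using x by (rule End_ring_apply(3))
        also have "\<dots> = ?v (?h (p x))" by (rule End_ring_apply(3)) (use x p in simp)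
        also have "\<dots> = p x" using x p l(2)[of "p x"] p_apply by (simp del: End_ring_apply)
        finally show "(?v \<otimes>\<^bsub>End_ring R M\<^esub> ?h \<otimes>\<^bsub>End_ring R M\<^esub> p) x = p x" .
      qed (use v h p in simp_all)
      then show False using no h by blast
    qed
  qed
qed

section \<open>Projective covers\<close>

locale cover =
  fixes R :: "('r, 'k) ring_scheme" and P :: "('r, 'p) rmod" and \<pi> :: "'p \<Rightarrow> 'm" and M :: "('r, 'm) rmod"
  assumes cover: "projective_cover R P \<pi> M"
begin

sublocale M: right_module R M using cover by (simp add: projective_cover_def)
sublocale P: right_module R P using cover by (simp add: projective_cover_def projective_def)
sublocale S: ring "End_ring R P" by (rule End_ring_ring) (rule P.right_module_axioms)

abbreviation "S \<equiv> End_ring R P"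

definition K where "K = {x \<in> carrier P. \<pi> x = \<zero>\<^bsub>M\<^esub>}"

lemma P_projective: "projective R P" using cover by (simp add: projective_cover_def)
lemma \<pi>_hom: "\<pi> \<in> rmod_hom R P M" using cover by (simp add: projective_cover_def)
lemma \<pi>_onto: "\<pi> ` carrier P = carrier M" using cover by (simp add: projective_cover_def)

lemmas \<pi>D = rmod_homD[OF \<pi>_hom]
lemmas \<pi>_minus = rmod_hom_uminus(2)[OF P.right_module_axioms M.right_module_axioms \<pi>_hom]

lemma \<pi>_surj:
  assumes "m \<in> carrier M" obtains x where "x \<in> carrier P" "m = \<pi> x"
  using assms \<pi>_onto by blast

lemma K_superfluous:
  assumes N: "rsubmodule N R P" and sum: "\<And>x. x \<in> carrier P \<Longrightarrow> \<exists>n\<in>N. x \<ominus>\<^bsub>P\<^esub> n \<in> K"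
  shows "N = carrier P"
proof -
  have K: "superfluous K R P" using cover by (simp add: projective_cover_def K_def)
  then have Ks: "rsubmodule K R P" by (simp add: superfluous_def)
  have "x \<in> K <+>\<^bsub>P\<^esub> N" if x: "x \<in> carrier P" for x
  proof -
    obtain n where n: "n \<in> N" "x \<ominus>\<^bsub>P\<^esub> n \<in> K" using sum[OF x] by blast
    have "x = (x \<ominus>\<^bsub>P\<^esub> n) \<oplus>\<^bsub>P\<^esub> n" using x P.rsubmoduleD(1)[OF N n(1)] by (simp add: P.M.add_minus_cancel)
    then show ?thesis using n unfolding set_add_def' by blast
  qed
  then have "K <+>\<^bsub>P\<^esub> N = carrier P"
    using P.rsubmoduleD(1)[OF P.rsubmodule_sum[OF Ks N]] by blast
  then show ?thesis using K N by (simp add: superfluous_def)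
qed

lemma eq_iff_K:
  assumes "x \<in> carrier P" "y \<in> carrier P" shows "x \<ominus>\<^bsub>P\<^esub> y \<in> K \<longleftrightarrow> \<pi> x = \<pi> y"
  using assms \<pi>D(1) by (simp add: K_def \<pi>_minus M.M.minus_eq_zero_iff)

lemma kernel_rsubmodule: "d \<in> carrier S \<Longrightarrow> rsubmodule {x \<in> carrier P. d x = \<zero>\<^bsub>P\<^esub>} R P"
  by (rule rmod_hom_kernel[OF P.right_module_axioms P.right_module_axioms End_ring_hom])

lemma idempotent_split:
  assumes "d \<in> carrier S" "d \<otimes>\<^bsub>S\<^esub> d = d" "x \<in> carrier P"
  shows "d (d x) = d x" "d (x \<ominus>\<^bsub>P\<^esub> d x) = \<zero>\<^bsub>P\<^esub>" "\<pi> x = \<pi> (d x) \<oplus>\<^bsub>M\<^esub> \<pi> (x \<ominus>\<^bsub>P\<^esub> d x)"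
proof -
  show 1: "d (d x) = d x" using fun_cong[OF assms(2), of x] assms(3) by simp
  have dx: "d x \<in> carrier P" using assms by simp
  show "d (x \<ominus>\<^bsub>P\<^esub> d x) = \<zero>\<^bsub>P\<^esub>"
    using P.End_ring_additive(1)[OF assms(1,3) dx] 1 dx by (simp add: P.M.minus_eq_zero_iff)
  show "\<pi> x = \<pi> (d x) \<oplus>\<^bsub>M\<^esub> \<pi> (x \<ominus>\<^bsub>P\<^esub> d x)"
    using \<pi>D(2)[OF dx, of "x \<ominus>\<^bsub>P\<^esub> d x"] assms(3) dx by (simp add: P.M.add_minus_cancel)
qed

text \<open>The images in \<open>M\<close> of the kernels of orthogonal idempotents of \<open>P\<close> are coindependent.\<close>

lemma no_orthogonal_sequence:
  assumes fin: "finite_dual_goldie_dim R M"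
    and d: "\<And>i :: nat. ring_idempotent S (d i) \<and> d i \<noteq> \<zero>\<^bsub>S\<^esub>"
    and orth: "\<And>i j. i \<noteq> j \<Longrightarrow> d i \<otimes>\<^bsub>S\<^esub> d j = \<zero>\<^bsub>S\<^esub>"
  shows False
proof -
  have dc: "d i \<in> carrier S" "d i \<otimes>\<^bsub>S\<^esub> d i = d i" for i using d[of i] by (simp_all add: ring_idempotent_def)
  define N where "N k = \<pi> ` {x \<in> carrier P. d k x = \<zero>\<^bsub>P\<^esub>}" for k
  have Ns: "rsubmodule (N k) R M" for k
    unfolding N_def by (rule rmod_hom_image[OF P.right_module_axioms M.right_module_axioms \<pi>_hom
          kernel_rsubmodule[OF dc(1)]])
  have proper: "N k \<noteq> carrier M" for k
  proof
    assume eq: "N k = carrier M"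
    have "{x \<in> carrier P. d k x = \<zero>\<^bsub>P\<^esub>} = carrier P"
    proof (rule K_superfluous[OF kernel_rsubmodule[OF dc(1)]])
      fix x assume x: "x \<in> carrier P"
      then have "\<pi> x \<in> N k" using eq \<pi>D(1) by simp
      then obtain y where "y \<in> {x \<in> carrier P. d k x = \<zero>\<^bsub>P\<^esub>}" "\<pi> x = \<pi> y" unfolding N_def by blast
      then show "\<exists>n\<in>{x \<in> carrier P. d k x = \<zero>\<^bsub>P\<^esub>}. x \<ominus>\<^bsub>P\<^esub> n \<in> K"
        using x eq_iff_K by auto
    qed
    then have "d k x = \<zero>\<^bsub>P\<^esub>" if "x \<in> carrier P" for x using that by blast
    then have "d k = \<zero>\<^bsub>S\<^esub>" by (intro End_ring_eqI[OF dc(1) S.zero_closed]) simp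
    then show False using d by blast
  qed
  have other: "\<pi> (d k x) \<in> N j" if "j \<noteq> k" "x \<in> carrier P" for j k x
  proof -
    have "d j (d k x) = \<zero>\<^bsub>P\<^esub>" using fun_cong[OF orth[OF that(1)], of x] that(2) by simp
    moreover have "d k x \<in> carrier P" by (rule End_ring_closed[OF dc(1) that(2)])
    ultimately show ?thesis unfolding N_def by blast
  qed
  have own: "\<pi> (x \<ominus>\<^bsub>P\<^esub> d k x) \<in> N k" if "x \<in> carrier P" for k x
  proof -
    have "x \<ominus>\<^bsub>P\<^esub> d k x \<in> carrier P" using dc(1)[of k] that by simp
    then show ?thesis using idempotent_split(2)[OF dc that] unfolding N_def by blast
  qed
  \<comment> \<open>If \<open>N j = N k\<close> with \<open>j \<noteq> k\<close>, this submodule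
    contains the images of both parts of \<open>x = d k x + (x - d k x)\<close>, hence all of
    \<open>M\<close>.\<close>
  have "inj N"
  proof (rule injI, rule ccontr)
    fix j k assume eq: "N j = N k" "j \<noteq> k"
    have "m \<in> N k" if "m \<in> carrier M" for m
    proof -
      obtain x where x: "x \<in> carrier P" "m = \<pi> x" using \<pi>_surj[OF \<open>m \<in> carrier M\<close>] .
      show ?thesis
        using idempotent_split(3)[OF dc x(1)] other[OF eq(2) x(1)] own[OF x(1)] eq(1) x(2)
          M.rsubmoduleD(3)[OF Ns, of "\<pi> (d k x)" k "\<pi> (x \<ominus>\<^bsub>P\<^esub> d k x)"] by simp
    qed
    then show False using proper M.rsubmoduleD(1)[OF Ns] by blast
  qed
  then have "infinite (range N)" by (simp add: range_inj_infinite)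
  moreover have "coindependent R M (range N)"
    unfolding coindependent_def
  proof (intro conjI ballI allI impI)
    fix X F assume "X \<in> range N" and F: "finite F \<and> F \<subseteq> range N - {X}"
    then obtain k where k: "X = N k" by blast
    have "m \<in> X <+>\<^bsub>M\<^esub> (carrier M \<inter> \<Inter>F)" if "m \<in> carrier M" for m
    proof -
      obtain x where x: "x \<in> carrier P" "m = \<pi> x" using \<pi>_surj[OF \<open>m \<in> carrier M\<close>] .
      have dx: "d k x \<in> carrier P" using dc(1)[of k] x(1) by simp
      have 1: "m = \<pi> (x \<ominus>\<^bsub>P\<^esub> d k x) \<oplus>\<^bsub>M\<^esub> \<pi> (d k x)"
        using idempotent_split(3)[OF dc x(1)] x(2) M.M.a_comm \<pi>D(1) dx x(1) by simp
      \<comment> \<open>Orthogonality puts the image of \<open>d k x\<close> into all the other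
        members at once, so finite subfamilies need no separate treatment.\<close>
      have 2: "\<pi> (d k x) \<in> carrier M \<inter> \<Inter>F"
      proof (intro IntI InterI)
        fix Y assume "Y \<in> F"
        then obtain j where "Y = N j" "N j \<noteq> N k" using F k by blast
        then show "\<pi> (d k x) \<in> Y" using other[of j k x] x(1) by blast
      qed (rule \<pi>D(1)[OF dx])
      show ?thesis unfolding set_add_def' k using 1 2 own[OF x(1)] by blast
    qed
    moreover have "X <+>\<^bsub>M\<^esub> (carrier M \<inter> \<Inter>F) \<subseteq> carrier M"
      using M.rsubmoduleD(1)[OF Ns] unfolding k set_add_def' by blast
    ultimately show "X <+>\<^bsub>M\<^esub> (carrier M \<inter> \<Inter>F) = carrier M" by blast
  qed (use Ns proper in auto)
  ultimately show False using fin unfolding finite_dual_goldie_dim_def by blast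
qed

section \<open>Endomorphisms of the cover and endomorphisms of the module\<close>

text \<open>As \<pi> is onto, these are the endomorphisms of \<open>P\<close> that induce one of
  \<open>M\<close>. Stated through \<open>K\<close>, the closure properties are immediate.\<close>

definition T where "T = {g \<in> carrier S. \<forall>x\<in>K. g x \<in> K}"

lemma K_rsubmodule: "rsubmodule K R P"
  unfolding K_def by (rule rmod_hom_kernel[OF P.right_module_axioms M.right_module_axioms \<pi>_hom])

lemma Units_T:
  assumes "automorphism_coinvariant R P \<pi> M"
  shows "Units S \<subseteq> T"
proof
  fix u assume u: "u \<in> Units S"
  then have uc: "u \<in> carrier S" by (simp add: Units_def)
  obtain f where f: "f \<in> rmod_hom R M M" "\<And>x. x \<in> carrier P \<Longrightarrow> \<pi> (u x) = f (\<pi> x)"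
    using assms P.Units_End_ring_iso[OF u] unfolding automorphism_coinvariant_def by blast
  have "f \<zero>\<^bsub>M\<^esub> = \<zero>\<^bsub>M\<^esub>" by (rule rmod_hom_zero[OF M.right_module_axioms M.right_module_axioms f(1)])
  then show "u \<in> T" using uc f(2) by (auto simp: T_def K_def)
qed

text \<open>Since \<open>e\<close> preserves \<open>K\<close>, the splitting of \<open>P\<close> by
  \<open>e\<close> descends to \<open>M\<close>: if \<open>x\<close> in \<open>eP\<close> and
  \<open>y\<close> in the kernel of \<open>e\<close> have the same image, then
  \<open>x = e (x - y)\<close> lies in \<open>K\<close>. Indecomposability makes one of the two
  images zero, and superfluity of \<open>K\<close> lifts this back to \<open>P\<close>.\<close>

lemma T_idempotent:
  assumes ind: "indecomposable R M" and e: "e \<in> T" "e \<otimes>\<^bsub>S\<^esub> e = e"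
  shows "e = \<zero>\<^bsub>S\<^esub> \<or> e = \<one>\<^bsub>S\<^esub>"
proof -
  have ec: "e \<in> carrier S" and eK: "\<And>x. x \<in> K \<Longrightarrow> e x \<in> K" using e(1) by (auto simp: T_def)
  interpret summand R P e using ec e(2) by unfold_locales
  let ?A = "\<pi> ` N" and ?B = "\<pi> ` {x \<in> carrier P. e x = \<zero>\<^bsub>P\<^esub>}"
  note split = idempotent_split[OF ec e(2)]
  note im = rmod_hom_image[OF P.right_module_axioms M.right_module_axioms \<pi>_hom]
  have A: "rsubmodule ?A R M" and B: "rsubmodule ?B R M"
    using im[OF N_rsubmodule] im[OF kernel_rsubmodule[OF ec]] .
  have "?A <+>\<^bsub>M\<^esub> ?B = carrier M"
  proof (rule equalityI)
    show "?A <+>\<^bsub>M\<^esub> ?B \<subseteq> carrier M" using M.rsubmoduleD(1)[OF M.rsubmodule_sum[OF A B]] by blast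
    show "carrier M \<subseteq> ?A <+>\<^bsub>M\<^esub> ?B"
    proof
      fix m assume "m \<in> carrier M"
      then obtain x where x: "x \<in> carrier P" "m = \<pi> x" by (rule \<pi>_surj)
      have "\<pi> (e x) \<in> ?A" "\<pi> (x \<ominus>\<^bsub>P\<^esub> e x) \<in> ?B" using x(1) ec split(2)[OF x(1)] by auto
      then show "m \<in> ?A <+>\<^bsub>M\<^esub> ?B" unfolding set_add_def' x(2) using split(3)[OF x(1)] by blast
    qed
  qed
  moreover have "?A \<inter> ?B = {\<zero>\<^bsub>M\<^esub>}"
  proof (rule equalityI)
    show "{\<zero>\<^bsub>M\<^esub>} \<subseteq> ?A \<inter> ?B" using M.rsubmoduleD(2)[OF A] M.rsubmoduleD(2)[OF B] by simp
    show "?A \<inter> ?B \<subseteq> {\<zero>\<^bsub>M\<^esub>}"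
    proof
      fix m assume m: "m \<in> ?A \<inter> ?B"
      obtain x where x: "x \<in> N" "m = \<pi> x" using m by blast
      obtain y where y: "y \<in> carrier P" "e y = \<zero>\<^bsub>P\<^esub>" "m = \<pi> y" using m by blast
      have xc: "x \<in> carrier P" using x(1) by (rule N_closed)
      have "x \<ominus>\<^bsub>P\<^esub> y \<in> K" using eq_iff_K[OF xc y(1)] x(2) y(3) by simp
      then have "e (x \<ominus>\<^bsub>P\<^esub> y) \<in> K" by (rule eK)
      moreover have "e (x \<ominus>\<^bsub>P\<^esub> y) = x"
        using P.End_ring_additive(1)[OF ec xc y(1)] p_fix[OF x(1)] y(2)
          P.M.add_minus_cancel(2)[of "\<zero>\<^bsub>P\<^esub>" x] xc by simp
      ultimately show "m \<in> {\<zero>\<^bsub>M\<^esub>}" using x(2) by (simp add: K_def)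
    qed
  qed
  ultimately have "?A = {\<zero>\<^bsub>M\<^esub>} \<or> ?B = {\<zero>\<^bsub>M\<^esub>}" using ind A B unfolding indecomposable_def by blast
  then show ?thesis
  proof
    assume A0: "?A = {\<zero>\<^bsub>M\<^esub>}"
    have "{x \<in> carrier P. e x = \<zero>\<^bsub>P\<^esub>} = carrier P"
    proof (rule K_superfluous[OF kernel_rsubmodule[OF ec]])
      fix x assume x: "x \<in> carrier P"
      then have ex: "e x \<in> carrier P" "e x \<in> K" using ec A0 by (auto simp: K_def)
      have n: "x \<ominus>\<^bsub>P\<^esub> e x \<in> {x \<in> carrier P. e x = \<zero>\<^bsub>P\<^esub>}" using split(2)[OF x] x ex by simp
      have "\<pi> x = \<pi> (x \<ominus>\<^bsub>P\<^esub> e x)" using split(3)[OF x] ex \<pi>D(1)[of "x \<ominus>\<^bsub>P\<^esub> e x"] x by (simp add: K_def)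
      then have "x \<ominus>\<^bsub>P\<^esub> (x \<ominus>\<^bsub>P\<^esub> e x) \<in> K" using eq_iff_K x ex by simp
      then show "\<exists>n\<in>{x \<in> carrier P. e x = \<zero>\<^bsub>P\<^esub>}. x \<ominus>\<^bsub>P\<^esub> n \<in> K" using n by blast
    qed
    then have "e x = \<zero>\<^bsub>P\<^esub>" if "x \<in> carrier P" for x using that by blast
    then have "e = \<zero>\<^bsub>S\<^esub>" by (intro End_ring_eqI[OF ec S.zero_closed]) simp
    then show ?thesis ..
  next
    assume B0: "?B = {\<zero>\<^bsub>M\<^esub>}"
    have "N = carrier P"
    proof (rule K_superfluous[OF N_rsubmodule])
      fix x assume x: "x \<in> carrier P"
      then have "x \<ominus>\<^bsub>P\<^esub> e x \<in> K" using split(2)[OF x] B0 ec by (auto simp: K_def)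
      then show "\<exists>n\<in>N. x \<ominus>\<^bsub>P\<^esub> n \<in> K" using x by blast
    qed
    then have "e x = x" if "x \<in> carrier P" for x using that p_fix[of x] by simp
    then have "e = \<one>\<^bsub>S\<^esub>" by (intro End_ring_eqI[OF ec S.one_closed]) simp
    then show ?thesis ..
  qed
qed

lemma T_proper:
  assumes "\<not> quasi_projective R P \<pi> M"
  shows "T \<noteq> carrier S"
proof
  assume eq: "T = carrier S"
  have "quasi_projective R P \<pi> M"
    unfolding quasi_projective_def
  proof
    fix g assume g: "g \<in> rmod_hom R P P"
    note gD = rmod_homD[OF g]
    have "restrict g (carrier P) \<in> T" using restrict_in_End_ring[OF P.right_module_axioms g] eq by simp
    then have gK: "g x \<in> K" if "x \<in> K" for x using that by (auto simp: T_def K_def)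
    \<comment> \<open>A chosen preimage suffices, since \<open>g\<close> preserves \<open>K\<close>
      and so the value does not depend on the choice.\<close>
    define f where "f m = \<pi> (g (inv_into (carrier P) \<pi> m))" for m
    have f: "\<pi> (g x) = f (\<pi> x)" if x: "x \<in> carrier P" for x
    proof -
      let ?y = "inv_into (carrier P) \<pi> (\<pi> x)"
      have y: "?y \<in> carrier P" "\<pi> ?y = \<pi> x" using x by (simp_all add: inv_into_into f_inv_into_f)
      then have "x \<ominus>\<^bsub>P\<^esub> ?y \<in> K" using eq_iff_K x by simp
      then have "g x \<ominus>\<^bsub>P\<^esub> g ?y \<in> K"
        using gK[of "x \<ominus>\<^bsub>P\<^esub> ?y"] rmod_hom_uminus(2)[OF P.right_module_axioms P.right_module_axioms g x y(1)]
        by simp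
      then show ?thesis using eq_iff_K gD(1) x y(1) by (simp add: f_def)
    qed
    have "f \<in> rmod_hom R M M"
    proof (rule rmod_homI)
      fix m assume "m \<in> carrier M"
      then obtain x where x: "x \<in> carrier P" "m = \<pi> x" by (rule \<pi>_surj)
      then show "f m \<in> carrier M" using f[of x] gD(1)[of x] \<pi>D(1)[of "g x"] by simp
      fix r assume "r \<in> carrier R"
      then show "f (m \<cdot>\<^bsub>M\<^esub> r) = f m \<cdot>\<^bsub>M\<^esub> r"
        using x f[of x] f[of "x \<cdot>\<^bsub>P\<^esub> r"] \<pi>D gD by simp
    next
      fix m m' assume m: "m \<in> carrier M" and m': "m' \<in> carrier M"
      obtain x where x: "x \<in> carrier P" "m = \<pi> x" using m by (rule \<pi>_surj)
      obtain y where y: "y \<in> carrier P" "m' = \<pi> y" using m' by (rule \<pi>_surj)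
      show "f (m \<oplus>\<^bsub>M\<^esub> m') = f m \<oplus>\<^bsub>M\<^esub> f m'"
        using x y f[of x] f[of y] f[of "x \<oplus>\<^bsub>P\<^esub> y"] \<pi>D gD by simp
    qed
    then show "\<exists>f\<in>rmod_hom R M M. \<forall>x\<in>carrier P. \<pi> (g x) = f (\<pi> x)" using f by blast
  qed
  then show False using assms by blast
qed

text \<open>Projectivity lifts \<open>f\<close> after \<pi> along \<pi>. Every such lift preserves
  \<open>K\<close>, because \<open>f\<close> fixes zero.\<close>

lemma lift_endomorphism:
  assumes f: "f \<in> carrier (End_ring R M)"
  shows "\<exists>g\<in>T. \<forall>x\<in>carrier P. \<pi> (g x) = f (\<pi> x)"
proof -
  have "(\<lambda>x. f (\<pi> x)) \<in> rmod_hom R P M" by (rule rmod_hom_compose[OF End_ring_hom[OF f] \<pi>_hom])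
  then obtain l where l: "l \<in> rmod_hom R P P" "\<And>x. x \<in> carrier P \<Longrightarrow> \<pi> (l x) = f (\<pi> x)"
    using projective_lift[OF P_projective P.right_module_axioms M.right_module_axioms \<pi>_hom \<pi>_onto] by blast
  let ?g = "restrict l (carrier P)"
  have "?g \<in> carrier S" by (rule restrict_in_End_ring[OF P.right_module_axioms l(1)])
  moreover have "?g x \<in> K" if "x \<in> K" for x
    using that l(2) rmod_homD(1)[OF l(1)] M.End_ring_additive(3)[OF f M.M.zero_closed M.M.zero_closed]
    by (auto simp: K_def)
  ultimately show ?thesis using l(2) by (intro bexI[of _ ?g]) (auto simp: T_def)
qed

lemma T_closed:
  shows "T \<subseteq> carrier S"
    and "g \<in> T \<Longrightarrow> h \<in> T \<Longrightarrow> g \<oplus>\<^bsub>S\<^esub> h \<in> T"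
    and "g \<in> T \<Longrightarrow> h \<in> T \<Longrightarrow> g \<otimes>\<^bsub>S\<^esub> h \<in> T"
  using P.rsubmoduleD(1,3)[OF K_rsubmodule] by (auto simp: T_def)

end

theorem theorem5p5:
  fixes R :: "('r, 'k) ring_scheme"
    and M :: "('r, 'm) rmod" and P :: "('r, 'p) rmod" and \<pi> :: "'p \<Rightarrow> 'm"
  assumes "right_perfect R"
    and "projective_cover R P \<pi> M"
    and "automorphism_coinvariant R P \<pi> M"
    and "\<not> quasi_projective R P \<pi> M"
    and "indecomposable R M"
    and "finite_dual_goldie_dim R M"
  shows "(End_ring R M Quot jacobson (End_ring R M) \<simeq> residue_ring 2) \<and>
    (\<exists>(n::nat) (Q :: nat \<Rightarrow> 'p set). 2 \<le> n \<and>
       internal_direct_sum R P {1..n} Q \<and>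
       (\<forall>i\<in>{1..n}. indecomposable R (P\<lparr>carrier := Q i\<rparr>) \<and> projective R (P\<lparr>carrier := Q i\<rparr>)) \<and>
       (\<forall>i\<in>{1..n}. \<forall>j\<in>{1..n}. i \<noteq> j \<longrightarrow>
          rmod_iso R (P\<lparr>carrier := Q i\<rparr>) (P\<lparr>carrier := Q j\<rparr>) = {}) \<and>
       (\<forall>i\<in>{1..n}. End_ring R (P\<lparr>carrier := Q i\<rparr>) Quot jacobson (End_ring R (P\<lparr>carrier := Q i\<rparr>))
          \<simeq> residue_ring 2))"
proof -
  interpret cover R P \<pi> M by unfold_locales (rule assms(2))
  note Tnil = P.right_perfect_D(2)[OF assms(1)]
  \<comment> \<open>The finiteness assumption on \<open>M\<close> enters \<open>S\<close> here: an
    infinite orthogonal sequence of nonzero idempotents would give an infinite coindependent family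
    in \<open>M\<close>.\<close>
  have "wf (idempotent_less S)"
    by (rule S.wf_idempotent_less) (rule no_orthogonal_sequence[OF assms(6)])
  moreover have "ring_idempotent S \<one>\<^bsub>S\<^esub>" by (simp add: ring_idempotent_def)
  ultimately obtain n :: nat and p where
    prim: "\<And>i. i \<in> {1..n} \<Longrightarrow> primitive_idempotent S (p i)"
    and orth: "\<And>i j. i \<in> {1..n} \<Longrightarrow> j \<in> {1..n} \<Longrightarrow> i \<noteq> j \<Longrightarrow> p i \<otimes>\<^bsub>S\<^esub> p j = \<zero>\<^bsub>S\<^esub>"
    and sum: "(\<Oplus>\<^bsub>S\<^esub>i\<in>{1..n}. p i) = \<one>\<^bsub>S\<^esub>"
    using S.primitive_decomposition by meson
  have pc: "p i \<in> carrier S" "p i \<otimes>\<^bsub>S\<^esub> p i = p i" "p i \<noteq> \<zero>\<^bsub>S\<^esub>" if "i \<in> {1..n}" for i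
    using prim[OF that] by (simp_all add: primitive_idempotent_def ring_idempotent_def)
  interpret U: unit_subring S T "End_radical R P" n p
  proof (intro unit_subring.intro unit_subring_axioms.intro)
    show "ring S" by (rule S.ring_axioms)
    show "ideal (End_radical R P) S" by (rule P.End_radical_ideal)
    show "Units S \<subseteq> T" by (rule Units_T[OF assms(3)])
    show "p i \<otimes>\<^bsub>S\<^esub> g \<otimes>\<^bsub>S\<^esub> p j \<in> End_radical R P \<or>
        (\<exists>h\<in>carrier S. p i \<otimes>\<^bsub>S\<^esub> g \<otimes>\<^bsub>S\<^esub> p j \<otimes>\<^bsub>S\<^esub> h \<otimes>\<^bsub>S\<^esub> p i = p i)"
      if "i \<in> {1..n}" "j \<in> {1..n}" "g \<in> carrier S" for i j g
      by (rule P.primitive_corner_local[OF assms(1) P_projective prim[OF that(1)] that(3) pc(1)[OF that(2)]])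
  qed (use P.End_radical_Units[OF Tnil] T_closed T_idempotent[OF assms(5)] T_proper[OF assms(4)]
      pc orth sum in auto)
  have summ: "summand R P (p i)" if "i \<in> {1..n}" for i
    by (intro summand.intro summand_axioms.intro P.right_module_axioms pc[OF that])
  define Q where "Q i = p i ` carrier P" for i
  have Q_fix: "p i x = x" "x \<in> carrier P" if "i \<in> {1..n}" "x \<in> Q i" for i x
    using summand.p_fix[OF summ[OF that(1)]] summand.N_closed[OF summ[OF that(1)]] that(2)
    unfolding Q_def by blast+
  have p_closed: "p i x \<in> carrier P" if "i \<in> {1..n}" "x \<in> carrier P" for i x
    using End_ring_closed[OF pc(1)] that .
  have p_Q: "p i x \<in> Q i" if "x \<in> carrier P" for i x using that by (simp add: Q_def)
  have indec: "indecomposable R (P\<lparr>carrier := Q i\<rparr>)" if "i \<in> {1..n}" for i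
    unfolding Q_def by (rule summand.indecomposable_summand[OF summ[OF that] prim[OF that]])
  have proj: "projective R (P\<lparr>carrier := Q i\<rparr>)" if "i \<in> {1..n}" for i
    unfolding Q_def by (rule summand.projective_summand[OF summ[OF that] P_projective])
  have "internal_direct_sum R P {1..n} Q"
    unfolding internal_direct_sum_def
  proof (intro conjI ballI)
    show "rsubmodule (Q i) R P" if "i \<in> {1..n}" for i
      unfolding Q_def by (rule summand.N_rsubmodule[OF summ[OF that]])
    fix x assume x: "x \<in> carrier P"
    let ?f = "\<lambda>i\<in>{1..n}. p i x"
    show "\<exists>!f. f \<in> (\<Pi>\<^sub>E i\<in>{1..n}. Q i) \<and> x = (\<Oplus>\<^bsub>P\<^esub>i\<in>{1..n}. f i)"
    proof (rule ex1I[of _ ?f], intro conjI)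
      show "?f \<in> (\<Pi>\<^sub>E i\<in>{1..n}. Q i)" using x p_Q by auto
      have "x = (\<Oplus>\<^bsub>S\<^esub>i\<in>{1..n}. p i) x" using sum x by simp
      also have "\<dots> = (\<Oplus>\<^bsub>P\<^esub>i\<in>{1..n}. p i x)"
        by (rule P.End_ring_finsum_apply) (use pc x in auto)
      also have "\<dots> = (\<Oplus>\<^bsub>P\<^esub>i\<in>{1..n}. ?f i)"
        by (rule P.M.finsum_cong') (use p_closed x in auto)
      finally show "x = (\<Oplus>\<^bsub>P\<^esub>i\<in>{1..n}. ?f i)" .
    next
      fix f assume f: "f \<in> (\<Pi>\<^sub>E i\<in>{1..n}. Q i) \<and> x = (\<Oplus>\<^bsub>P\<^esub>i\<in>{1..n}. f i)"
      have fQ: "f i \<in> Q i" if "i \<in> {1..n}" for i using f that by blast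
      have fc: "f \<in> {1..n} \<rightarrow> carrier P" using fQ Q_fix(2) by blast
      have "f j = p j x" if j: "j \<in> {1..n}" for j
      proof -
        \<comment> \<open>Uniqueness of the components: applying \<open>p j\<close> to any
          representation of \<open>x\<close> erases every term except the one with index
          \<open>j\<close>.\<close>
        have "p j x = (\<Oplus>\<^bsub>P\<^esub>i\<in>{1..n}. p j (f i))"
          using f rmod_hom_finsum[OF P.right_module_axioms P.right_module_axioms End_ring_hom[OF pc(1)[OF j]] _ fc]
          by simp
        also have "\<dots> = (\<Oplus>\<^bsub>P\<^esub>i\<in>{1..n}. if j = i then f i else \<zero>\<^bsub>P\<^esub>)"
        proof (rule P.M.finsum_cong'[OF refl])
          show "(\<lambda>i. if j = i then f i else \<zero>\<^bsub>P\<^esub>) \<in> {1..n} \<rightarrow> carrier P" using fc by auto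
          fix i assume i: "i \<in> {1..n}"
          have "p j (p i (f i)) = \<zero>\<^bsub>P\<^esub>" if "j \<noteq> i"
            using fun_cong[OF orth[OF j i that], of "f i"] Q_fix(2)[OF i fQ[OF i]] by simp
          then show "p j (f i) = (if j = i then f i else \<zero>\<^bsub>P\<^esub>)"
            using Q_fix(1)[OF i fQ[OF i]] by auto
        qed
        also have "\<dots> = f j" using P.M.finsum_singleton[OF j _ fc] by simp
        finally show ?thesis by simp
      qed
      then show "f = ?f" using f by (intro extensionalityI[of f "{1..n}"]) (auto simp: PiE_def)
    qed
  qed simp
  moreover have "rmod_iso R (P\<lparr>carrier := Q i\<rparr>) (P\<lparr>carrier := Q j\<rparr>) = {}"
    if ij: "i \<in> {1..n}" "j \<in> {1..n}" "i \<noteq> j" for i j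
  proof (rule ccontr)
    interpret i: summand R P "p i" by (rule summ[OF ij(1)])
    interpret j: summand R P "p j" by (rule summ[OF ij(2)])
    assume "\<not> ?thesis"
    then obtain \<phi> where \<phi>: "\<phi> \<in> rmod_iso R i.Q j.Q" unfolding Q_def by blast
    let ?\<psi> = "inv_into (carrier i.Q) \<phi>"
    have \<phi>_hom: "\<phi> \<in> rmod_hom R i.Q j.Q" and inj: "inj_on \<phi> (carrier i.Q)"
      using \<phi> by (auto simp: rmod_iso_def bij_betw_def)
    have \<psi>_hom: "?\<psi> \<in> rmod_hom R j.Q i.Q"
      by (rule rmod_iso_inverse[OF i.Q.right_module_axioms j.Q.right_module_axioms \<phi>])
    \<comment> \<open>The isomorphism and its inverse are extended by zero on the complements. This
      turns them into a factorization of \<open>p i\<close> through \<open>p j\<close>.\<close>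
    let ?h = "restrict (\<lambda>x. \<phi> (p i x)) (carrier P)" and ?g = "restrict (\<lambda>x. ?\<psi> (p j x)) (carrier P)"
    have h: "?h \<in> carrier S" and g: "?g \<in> carrier S"
      using restrict_in_End_ring[OF P.right_module_axioms
          rmod_hom_compose[OF j.inclusion_hom rmod_hom_compose[OF \<phi>_hom i.projection_hom]]]
        restrict_in_End_ring[OF P.right_module_axioms
          rmod_hom_compose[OF i.inclusion_hom rmod_hom_compose[OF \<psi>_hom j.projection_hom]]] .
    have "p i \<otimes>\<^bsub>S\<^esub> ?g \<otimes>\<^bsub>S\<^esub> p j \<otimes>\<^bsub>S\<^esub> ?h \<otimes>\<^bsub>S\<^esub> p i = p i"
    proof (rule End_ring_eqI)
      fix x assume x: "x \<in> carrier P"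
      have px: "p i x \<in> carrier i.Q" "p i x \<in> carrier P" using x pc(1)[OF ij(1)] by simp_all
      have \<phi>x: "\<phi> (p i x) \<in> carrier j.Q" by (rule rmod_homD(1)[OF \<phi>_hom px(1)])
      then have \<phi>c: "\<phi> (p i x) \<in> carrier P" "p j (\<phi> (p i x)) = \<phi> (p i x)" using j.N_iff by simp_all
      have "?\<psi> (\<phi> (p i x)) = p i x" by (rule inv_into_f_f[OF inj px(1)])
      then show "(p i \<otimes>\<^bsub>S\<^esub> ?g \<otimes>\<^bsub>S\<^esub> p j \<otimes>\<^bsub>S\<^esub> ?h \<otimes>\<^bsub>S\<^esub> p i) x = p i x"
        using x px \<phi>c i.p_apply[OF x] by simp
    qed (use h g pc(1)[OF ij(1)] pc(1)[OF ij(2)] in simp_all)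
    then show False using U.no_isomorphism[OF ij g h] by blast
  qed
  moreover have "End_ring R (P\<lparr>carrier := Q i\<rparr>) Quot jacobson (End_ring R (P\<lparr>carrier := Q i\<rparr>)) \<simeq> residue_ring 2"
    if i: "i \<in> {1..n}" for i
  proof -
    interpret i: summand R P "p i" by (rule summ[OF i])
    have "End_ring R i.Q Quot jacobson (End_ring R i.Q) \<simeq> residue_ring 2"
    proof (rule i.Q.End_ring_two_elements[OF Tnil])
      show "carrier i.Q \<noteq> {\<zero>\<^bsub>i.Q\<^esub>}" using indec[OF i] unfolding indecomposable_def Q_def by blast
      fix f assume f: "f \<in> carrier (End_ring R i.Q)"
      \<comment> \<open>Extended by zero on the complement, \<open>f\<close> becomes an element of
        the corner of \<open>p i\<close> that acts as \<open>f\<close> on the summand.\<close>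
      let ?g = "restrict (\<lambda>x. f (p i x)) (carrier P)"
      have g: "?g \<in> carrier S"
        using restrict_in_End_ring[OF P.right_module_axioms
            rmod_hom_compose[OF i.inclusion_hom rmod_hom_compose[OF End_ring_hom[OF f] i.projection_hom]]] .
      have fx: "f x \<in> p i ` carrier P" if "x \<in> p i ` carrier P" for x
        using End_ring_closed[OF f] that by simp
      have gx: "(p i \<otimes>\<^bsub>S\<^esub> ?g \<otimes>\<^bsub>S\<^esub> p i) x = f x" if x: "x \<in> p i ` carrier P" for x
        using i.N_closed[OF x] i.p_fix[OF x] i.p_fix[OF fx[OF x]] by simp
      have gx': "(p i \<otimes>\<^bsub>S\<^esub> ?g \<otimes>\<^bsub>S\<^esub> p i \<ominus>\<^bsub>S\<^esub> p i) x = f x \<ominus>\<^bsub>i.Q\<^esub> x" if x: "x \<in> p i ` carrier P" for x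
        using gx[OF x] i.N_closed[OF x] i.p_fix[OF x] g pc(1)[OF i] i.Q_uminus[OF fx[OF x] x]
        by (subst P.End_ring_minus(2)) simp_all
      have fx': "f x \<ominus>\<^bsub>i.Q\<^esub> x \<in> p i ` carrier P" if "x \<in> p i ` carrier P" for x
        using i.Q.M.minus_closed[of "f x" x] fx[OF that] that by simp
      show "(\<forall>x\<in>carrier i.Q. f x \<in> times_jacobson R i.Q) \<or>
          (\<forall>x\<in>carrier i.Q. f x \<ominus>\<^bsub>i.Q\<^esub> x \<in> times_jacobson R i.Q)"
        using U.corner_two_elements[OF i g]
      proof
        assume r: "p i \<otimes>\<^bsub>S\<^esub> ?g \<otimes>\<^bsub>S\<^esub> p i \<in> End_radical R P"
        have "f x \<in> times_jacobson R i.Q" if x: "x \<in> p i ` carrier P" for x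
        proof -
          have "(p i \<otimes>\<^bsub>S\<^esub> ?g \<otimes>\<^bsub>S\<^esub> p i) x \<in> times_jacobson R P"
            using r i.N_closed[OF x] unfolding End_radical_def by blast
          then show ?thesis unfolding gx[OF x] i.times_jacobson_summand using fx[OF x] by blast
        qed
        then show ?thesis by simp
      next
        assume r: "p i \<otimes>\<^bsub>S\<^esub> ?g \<otimes>\<^bsub>S\<^esub> p i \<ominus>\<^bsub>S\<^esub> p i \<in> End_radical R P"
        have "f x \<ominus>\<^bsub>i.Q\<^esub> x \<in> times_jacobson R i.Q" if x: "x \<in> p i ` carrier P" for x
        proof -
          have "(p i \<otimes>\<^bsub>S\<^esub> ?g \<otimes>\<^bsub>S\<^esub> p i \<ominus>\<^bsub>S\<^esub> p i) x \<in> times_jacobson R P"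
            using r i.N_closed[OF x] unfolding End_radical_def by blast
          then show ?thesis unfolding gx'[OF x] i.times_jacobson_summand using fx'[OF x] by blast
        qed
        then show ?thesis by simp
      qed
    qed
    then show ?thesis unfolding Q_def .
  qed
  moreover have "End_ring R M Quot jacobson (End_ring R M) \<simeq> residue_ring 2"
  proof (rule M.End_ring_two_elements[OF Tnil])
    show "carrier M \<noteq> {\<zero>\<^bsub>M\<^esub>}" using assms(5) by (simp add: indecomposable_def)
    fix f assume f: "f \<in> carrier (End_ring R M)"
    obtain g where g: "g \<in> T" "\<And>x. x \<in> carrier P \<Longrightarrow> \<pi> (g x) = f (\<pi> x)"
      using lift_endomorphism[OF f] by blast
    have gc: "g \<in> carrier S" using g(1) T_closed(1) by blast
    \<comment> \<open>The map \<pi> sends \<open>PJ(R)\<close> into \<open>MJ(R)\<close>. Hence the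
      alternative for the lift \<open>g\<close>, to be 0 or 1 modulo \<open>L\<close>, passes to
      \<open>f\<close>.\<close>
    note push = rmod_hom_times_jacobson[OF P.right_module_axioms M.right_module_axioms \<pi>_hom]
    show "(\<forall>m\<in>carrier M. f m \<in> times_jacobson R M) \<or>
        (\<forall>m\<in>carrier M. f m \<ominus>\<^bsub>M\<^esub> m \<in> times_jacobson R M)"
      using U.T_two_elements[OF g(1)]
    proof
      assume r: "g \<in> End_radical R P"
      have "f (\<pi> x) \<in> times_jacobson R M" if x: "x \<in> carrier P" for x
      proof -
        have "g x \<in> times_jacobson R P" using r x unfolding End_radical_def by blast
        then show ?thesis unfolding g(2)[OF x, symmetric] by (rule push)
      qed
      then show ?thesis unfolding \<pi>_onto[symmetric] by blast
    next
      assume r: "g \<ominus>\<^bsub>S\<^esub> \<one>\<^bsub>S\<^esub> \<in> End_radical R P"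
      have "f (\<pi> x) \<ominus>\<^bsub>M\<^esub> \<pi> x \<in> times_jacobson R M" if x: "x \<in> carrier P" for x
      proof -
        have "(g \<ominus>\<^bsub>S\<^esub> \<one>\<^bsub>S\<^esub>) x \<in> times_jacobson R P" using r x unfolding End_radical_def by blast
        then have "g x \<ominus>\<^bsub>P\<^esub> x \<in> times_jacobson R P"
          unfolding P.End_ring_minus(2)[OF gc S.one_closed x] End_ring_apply(1)[OF x] .
        then show ?thesis
          unfolding g(2)[OF x, symmetric] \<pi>_minus[OF End_ring_closed[OF gc x] x, symmetric] by (rule push)
      qed
      then show ?thesis unfolding \<pi>_onto[symmetric] by blast
    qed
  qed
  ultimately show ?thesis
    using U.two_le_n indec proj by (intro conjI exI[of _ n] exI[of _ Q]) blast+
qed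

end
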